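(* Let $\mathsf{H}$ be a quaternionic Hilbert space, let $T\in\mathfrak{B}(\mathsf{H})$ be a normal operator, and let $f:U\to\mathbb{H}$ be a slice regular function defined on a circular open neighborhood $U$ of $\sigma_S(T)$ in $\mathbb{H}$. Set $A:=(T+T^* )\frac12$, $B:=|T-T^*|\frac12$; let $J\in\mathfrak{B}(\mathsf{H})$ be an anti self-adjoint and unitary operator with $TJ=JT$, $T^*J=JT^*$ and $T=A+JB$; let $\jmath,\kappa\in\mathbb{S}$ with $\jmath\kappa=-\kappa\jmath$; let $\mathbb{H}\ni q\mapsto L_q$ be a left scalar multiplication of $\mathsf{H}$ such that $L_\jmath=J$ and $L_qA=AL_q$, $L_qB=BL_q$ for every $q\in\mathbb{H}$; and set $K:=L_\kappa$. Then $f|_{\sigma_S(T)}\in\mathcal{S}(\sigma_S(T),\mathbb{H})$ and $$f(T)_{reg}=f|_{\sigma_S(T)}(T),$$ where $f(T)_{reg}$ is the operator given by the slice regular functional calculus and $f|_{\sigma_S(T)}(T)$ is the operator given by the continuous slice functional calculus, both defined with respect to the left scalar multiplication $\mathbb{H}\ni q\mapsto L_q$ of $\mathsf{H}$ (with $L_\jmath=J$, $L_\kappa=K$, and $L_q$ commuting with $A$ and $B$ for every $q\in\mathbb{H}$).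
   Context: $\mathbb{H}$ denotes the quaternions, with conjugation $q\mapsto\overline q$ and norm $|q|=\sqrt{q\overline q}$; $\mathbb{S}=\{q\in\mathbb{H}:q^2=-1\}$; $\mathbb{C}_\imath=\{\alpha+\imath\beta:\alpha,\beta\in\mathbb{R}\}$ for $\imath\in\mathbb{S}$. A quaternionic Hilbert space $\mathsf{H}$ is a nonzero right $\mathbb{H}$-module with a scalar product $\langle\cdot|\cdot\rangle$ valued in $\mathbb{H}$, right $\mathbb{H}$-linear in the second argument, with $\langle u|v\rangle=\overline{\langle v|u\rangle}$, $\langle u|u\rangle\ge0$ (zero only for $u=0$), complete for $\|u\|=\sqrt{\langle u|u\rangle}$. $\mathfrak{B}(\mathsf{H})$: everywhere defined bounded right $\mathbb{H}$-linear operators; $T^*$ adjoint; $\mathrm{I}$ identity; $(Tr)(u)=T(u)r$ for $r\in\mathbb{R}$. Normal: $TT^*=T^*T$; anti self-adjoint: $J^*=-J$; unitary: $J^*J=JJ^*=\mathrm{I}$; $|S|=\sqrt{S^*S}$ (unique positive square root). Left scalar multiplication: given a Hilbert basis $N$ of $\mathsf{H}$ (orthonormal set with dense right $\mathbb{H}$-span), the left scalar multiplication induced by $N$ is $q\mapsto L_q\in\mathfrak{B}(\mathsf{H})$, $L_qu:=\sum_{z\in N}zq\langle z|u\rangle$. For $S\in\mathfrak{B}(\mathsf{H})$, $qS:=L_qS$, $Sq:=SL_q$. Spherical spectrum: $\Delta_q(T):=T^2-T(q+\overline q)+\mathrm{I}|q|^2$; $\sigma_S(T)$ is the set of $q\in\mathbb{H}$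 such that $\Delta_q(T)$ is not invertible in $\mathfrak{B}(\mathsf{H})$; it equals $\Omega_{\mathcal K}$ for a non-empty compact conjugation-invariant $\mathcal K\subset\mathbb{C}$, where $\Omega_{D}:=\{\alpha+\imath\beta:\alpha,\beta\in\mathbb{R},\ \alpha+i\beta\in D,\ \imath\in\mathbb{S}\}$. A set is circular if it is of the form $\Omega_D$. Slice functions: a stem function on a conjugation-invariant $D\subset\mathbb{C}$ is $F=F_1+iF_2:D\to\mathbb{H}\otimes_{\mathbb{R}}\mathbb{C}$, $F_1,F_2:D\to\mathbb{H}$, with $F_1(\overline z)=F_1(z)$, $F_2(\overline z)=-F_2(z)$; it induces the slice function $\mathcal I(F)(\alpha+\imath\beta)=F_1(\alpha+i\beta)+\imath F_2(\alpha+i\beta)$ on $\Omega_D$ ($\imath\in\mathbb{S}$). $\mathcal{S}(\Omega_D,\mathbb{H})$ is the set of slice functions with $F$ continuous; $\mathcal{S}_{\mathbb{R}}(\Omega_D,\mathbb{H})$ the subset with $F_1,F_2$ real-valued. A slice function on a circular open set is slice regular if its stem function is holomorphic (with respect to the complex structure of $\mathbb{H}\otimes_{\mathbb{R}}\mathbb{C}$ given by multiplication by $i$). Continuous slice functional calculus: $\Psi_{\mathbb{R},T}:\mathcal{S}_{\mathbb{R}}(\sigma_S(T),\mathbb{H})\to\mathfrak{B}(\mathsf{H})$ is the unique continuous (for the supremum norm and operator norm) unital real $^*$-algebra homomorphism (pointwise operations, $f^*=\overline f$) sending the inclusion $\sigma_S(T)\hookrightarrow\mathbb{H}$ to $T$.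 Each $g\in\mathcal{S}(\sigma_S(T),\mathbb{H})$ is uniquely $g=g_0+g_1\jmath+g_2\kappa+g_3\jmath\kappa$ with $g_\ell\in\mathcal{S}_{\mathbb{R}}(\sigma_S(T),\mathbb{H})$, and $g(T):=\Psi_{\mathbb{R},T}(g_0)+\Psi_{\mathbb{R},T}(g_1)J+\Psi_{\mathbb{R},T}(g_2)K+\Psi_{\mathbb{R},T}(g_3)JK$. Slice regular functional calculus: for any fixed $\imath\in\mathbb{S}$, $$f(T)_{reg}:=\frac1{2\pi}\int_{\partial(U'\cap\mathbb{C}_\imath)}S_L^{-1}(s,T)\,ds\,\imath^{-1}f(s),\qquad S_L^{-1}(s,T):=-\Delta_s(T)^{-1}(T-\mathrm{I}\,\overline s),$$ where $\mathrm{I}\,\overline s=L_{\overline s}$, quaternions to the right of operators act by the right scalar multiplication $Sq=SL_q$, and $U'$ is a bounded circular open set with $\sigma_S(T)\subset U'$, $\overline{U'}\subset U$, such that $\partial(U'\cap\mathbb{C}_\imath)$ is a finite union of rectifiable Jordan curves (positively oriented); the result does not depend on $U'$ and $\imath$. *)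

theory Defs
  imports "HOL-Complex_Analysis.Complex_Analysis"
begin

section \<open>Quaternions\<close>

datatype quat = Quat (qre: real) (qi: real) (qj: real) (qk: real)

lemma quat_eq_iff: "p = q \<longleftrightarrow> qre p = qre q \<and> qi p = qi q \<and> qj p = qj q \<and> qk p = qk q"
  by (cases p; cases q) auto

instantiation quat :: ring_1
begin

definition "0 = Quat 0 0 0 0"
definition "1 = Quat 1 0 0 0"
definition "p + q = Quat (qre p + qre q) (qi p + qi q) (qj p + qj q) (qk p + qk q)"
definition "- p = Quat (- qre p) (- qi p) (- qj p) (- qk p)"
definition "p - q = Quat (qre p - qre q) (qi p - qi q) (qj p - qj q) (qk p - qk q)"
definition "p * q = Quat
  (qre p * qre q - qi p * qi q - qj p * qj q - qk p * qk q)
  (qre p * qi q + qi p * qre q + qj p * qk q - qk p * qj q)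
  (qre p * qj q - qi p * qk q + qj p * qre q + qk p * qi q)
  (qre p * qk q + qi p * qj q - qj p * qi q + qk p * qre q)"

instance
  by standard
    (simp_all add: quat_eq_iff zero_quat_def one_quat_def plus_quat_def uminus_quat_def
      minus_quat_def times_quat_def algebra_simps)

end

instantiation quat :: real_algebra_1
begin

definition "r *\<^sub>R q = Quat (r * qre q) (r * qi q) (r * qj q) (r * qk q)"

instance
  by standard
    (simp_all add: quat_eq_iff scaleR_quat_def plus_quat_def times_quat_def algebra_simps)

end

definition qcnj :: "quat \<Rightarrow> quat" where
  "qcnj q = Quat (qre q) (- qi q) (- qj q) (- qk q)"

instantiation quat :: real_inner
begin

definition inner_quat :: "quat \<Rightarrow> quat \<Rightarrow> real" where
  "inner_quat p q = qre p * qre q + qi p * qi q + qj p * qj q + qk p * qk q"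

definition norm_quat :: "quat \<Rightarrow> real" where
  "norm_quat q = sqrt (inner q q)"

definition sgn_quat :: "quat \<Rightarrow> quat" where
  "sgn_quat q = q /\<^sub>R norm q"

definition dist_quat :: "quat \<Rightarrow> quat \<Rightarrow> real" where
  "dist_quat p q = norm (p - q)"

definition uniformity_quat :: "(quat \<times> quat) filter" where
  "uniformity_quat = (INF e\<in>{0<..}. principal {(p, q). dist p q < e})"

definition open_quat :: "quat set \<Rightarrow> bool" where
  "open_quat U \<longleftrightarrow> (\<forall>p\<in>U. \<forall>\<^sub>F (p', q) in uniformity. p' = p \<longrightarrow> q \<in> U)"

instance
proof
  fix p q r :: quat and a :: real
  show "dist p q = norm (p - q)" by (rule dist_quat_def)
  show "sgn p = p /\<^sub>R norm p" by (rule sgn_quat_def)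
  show "(uniformity :: (quat \<times> quat) filter) =
      (INF e\<in>{0<..}. principal {(p, q). dist p q < e})" by (rule uniformity_quat_def)
  show "open U \<longleftrightarrow> (\<forall>p\<in>U. \<forall>\<^sub>F (p', q) in uniformity. p' = p \<longrightarrow> q \<in> U)" for U :: "quat set"
    by (rule open_quat_def)
  show "norm p = sqrt (inner p p)" by (rule norm_quat_def)
  show "inner p q = inner q p" by (simp add: inner_quat_def mult.commute)
  show "inner (p + q) r = inner p r + inner q r"
    by (simp add: inner_quat_def plus_quat_def algebra_simps)
  show "inner (a *\<^sub>R p) q = a * inner p q"
    by (simp add: inner_quat_def scaleR_quat_def algebra_simps)
  show "0 \<le> inner p p" by (simp add: inner_quat_def)
  have "inner p p = (qre p)\<^sup>2 + (qi p)\<^sup>2 + ((qj p)\<^sup>2 + (qk p)\<^sup>2)"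
    by (simp add: inner_quat_def power2_eq_square)
  then show "inner p p = 0 \<longleftrightarrow> p = 0"
    by (simp add: quat_eq_iff zero_quat_def add_nonneg_eq_0_iff)
qed

end

lemma inner_quat_mult: "inner (p * q) (p * q) = inner p p * inner q (q :: quat)"
  unfolding inner_quat_def times_quat_def by (simp add: algebra_simps)

lemma mult_qcnj: "q * qcnj q = inner q q *\<^sub>R 1" "qcnj q * q = inner q q *\<^sub>R 1"
  by (simp_all add: quat_eq_iff times_quat_def qcnj_def inner_quat_def scaleR_quat_def one_quat_def)

text \<open>The Euclidean norm is \<open>|q| = sqrt (q * qcnj q)\<close>.\<close>

lemma norm_quat_qcnj: "norm q = sqrt (qre (q * qcnj q))"
  by (simp add: norm_quat_def mult_qcnj scaleR_quat_def one_quat_def)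

instantiation quat :: real_normed_div_algebra
begin

definition inverse_quat :: "quat \<Rightarrow> quat" where
  "inverse_quat q = qcnj q /\<^sub>R (norm q)\<^sup>2"

definition divide_quat :: "quat \<Rightarrow> quat \<Rightarrow> quat" where
  "divide_quat p q = p * inverse q"

instance
proof
  fix p q :: quat
  show "norm (p * q) = norm p * norm q"
    by (simp add: norm_quat_def inner_quat_mult real_sqrt_mult)
  have n: "(norm p)\<^sup>2 = inner p p" by (simp add: norm_quat_def)
  show "p \<noteq> 0 \<Longrightarrow> inverse p * p = 1" "p \<noteq> 0 \<Longrightarrow> p * inverse p = 1"
    by (simp_all add: inverse_quat_def mult_qcnj n)
  show "p div q = p * inverse q" by (rule divide_quat_def)
  show "inverse (0 :: quat) = 0"
    by (simp add: inverse_quat_def norm_quat_def inner_quat_def zero_quat_def scaleR_quat_def)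
qed

end

definition imag_units :: "quat set" (\<open>\<S>\<close>) where
  "\<S> = {q. q\<^sup>2 = -1}"

text \<open>For \<open>\<iota> \<in> \<S>\<close>, \<open>slice \<iota>\<close> is the isometric identification of the complex plane with
  the slice \<open>{\<alpha> + \<iota> \<beta>}\<close>.\<close>

definition slice :: "quat \<Rightarrow> complex \<Rightarrow> quat" where
  "slice \<iota> z = of_real (Re z) + \<iota> * of_real (Im z)"

definition Omega :: "complex set \<Rightarrow> quat set" where
  "Omega D = {slice \<iota> z |\<iota> z. \<iota> \<in> \<S> \<and> z \<in> D}"

definition circular :: "quat set \<Rightarrow> bool" where
  "circular W \<longleftrightarrow> (\<exists>D. W = Omega D)"

text \<open>For circular \<open>W\<close> this is the conjugation-invariant set \<open>D\<close> with \<open>W = Omega D\<close>.\<close>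

definition profile :: "quat set \<Rightarrow> complex set" where
  "profile W = {z. \<exists>\<iota>\<in>\<S>. slice \<iota> z \<in> W}"


section \<open>Slice functions\<close>

text \<open>\<open>H \<otimes> C\<close> is represented by pairs: \<open>F1 + i F2\<close> is \<open>(F1, F2)\<close>, so that multiplication by
  \<open>i\<close> is the map below.\<close>

definition mult_i :: "quat \<times> quat \<Rightarrow> quat \<times> quat" where
  "mult_i w = (- snd w, fst w)"

definition stem_on :: "complex set \<Rightarrow> (complex \<Rightarrow> quat \<times> quat) \<Rightarrow> bool" where
  "stem_on D F \<longleftrightarrow>
     (\<forall>z\<in>D. cnj z \<in> D \<and> fst (F (cnj z)) = fst (F z) \<and> snd (F (cnj z)) = - snd (F z))"

definition induces_on :: "complex set \<Rightarrow> (complex \<Rightarrow> quat \<times> quat) \<Rightarrow> (quat \<Rightarrow> quat) \<Rightarrow> bool" where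
  "induces_on D F f \<longleftrightarrow> (\<forall>\<iota>\<in>\<S>. \<forall>z\<in>D. f (slice \<iota> z) = fst (F z) + \<iota> * snd (F z))"

definition stem_holomorphic_on :: "complex set \<Rightarrow> (complex \<Rightarrow> quat \<times> quat) \<Rightarrow> bool" where
  "stem_holomorphic_on D F \<longleftrightarrow>
     (\<forall>z\<in>D. \<exists>F'. (F has_derivative F') (at z) \<and> (\<forall>w. F' (\<i> * w) = mult_i (F' w)))"

text \<open>Functions on a circular set \<open>W\<close> are total functions of which only the values on \<open>W\<close> matter;
  \<open>f \<in> slice_cont W\<close> thus says that the restriction of \<open>f\<close> to \<open>W\<close> is a slice function with
  continuous stem function.\<close>

definition slice_cont :: "quat set \<Rightarrow> (quat \<Rightarrow> quat) set" where
  "slice_cont W = {f. \<exists>F. stem_on (profile W) F \<and> continuous_on (profile W) F \<and>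
     induces_on (profile W) F f}"

definition slice_cont_real :: "quat set \<Rightarrow> (quat \<Rightarrow> quat) set" where
  "slice_cont_real W = {f. \<exists>F. stem_on (profile W) F \<and> continuous_on (profile W) F \<and>
     (\<forall>z\<in>profile W. fst (F z) \<in> \<real> \<and> snd (F z) \<in> \<real>) \<and> induces_on (profile W) F f}"

definition slice_regular_on :: "quat set \<Rightarrow> (quat \<Rightarrow> quat) \<Rightarrow> bool" where
  "slice_regular_on U f \<longleftrightarrow> (\<exists>F. stem_on (profile U) F \<and> stem_holomorphic_on (profile U) F \<and>
     induces_on (profile U) F f)"


section \<open>Quaternionic Hilbert spaces\<close>

text \<open>\<open>u *\<^sub>H q\<close> is the right scalar multiplication and \<open>qinner u v\<close> the scalar product. Completeness
  for the norm comes from the class \<open>banach\<close>.\<close>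

class quaternionic_hilbert = banach +
  fixes rscaleH :: "'a \<Rightarrow> quat \<Rightarrow> 'a"  (infixl \<open>*\<^sub>H\<close> 75)
    and qinner :: "'a \<Rightarrow> 'a \<Rightarrow> quat"
  assumes rscaleH_add_left: "(u + v) *\<^sub>H q = u *\<^sub>H q + v *\<^sub>H q"
    and rscaleH_add_right: "u *\<^sub>H (p + q) = u *\<^sub>H p + u *\<^sub>H q"
    and rscaleH_mult: "u *\<^sub>H (p * q) = u *\<^sub>H p *\<^sub>H q"
    and rscaleH_one: "u *\<^sub>H 1 = u"
    and scaleR_eq_rscaleH: "r *\<^sub>R u = u *\<^sub>H of_real r"
    and qinner_add_right: "qinner u (v + w) = qinner u v + qinner u w"
    and qinner_rscaleH_right: "qinner u (v *\<^sub>H q) = qinner u v * q"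
    and qinner_commute: "qinner u v = qcnj (qinner v u)"
    and qinner_self_nonneg: "qinner u u \<in> \<real> \<and> 0 \<le> qre (qinner u u)"
    and qinner_self_eq_0: "qinner u u = 0 \<Longrightarrow> u = 0"
    and norm_eq_sqrt_qinner: "norm u = sqrt (qre (qinner u u))"
    and nontrivial_space: "\<exists>u. u \<noteq> 0"

definition qlin_ops :: "('h::quaternionic_hilbert \<Rightarrow>\<^sub>L 'h) set" (\<open>\<BB>\<close>) where
  "\<BB> = {T. \<forall>u q. blinfun_apply T (u *\<^sub>H q) = blinfun_apply T u *\<^sub>H q}"

definition adj :: "('h::quaternionic_hilbert \<Rightarrow>\<^sub>L 'h) \<Rightarrow> 'h \<Rightarrow>\<^sub>L 'h" where
  "adj T = (THE S. S \<in> \<BB> \<and>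
     (\<forall>u v. qinner (blinfun_apply S u) v = qinner u (blinfun_apply T v)))"

definition normal_op :: "('h::quaternionic_hilbert \<Rightarrow>\<^sub>L 'h) \<Rightarrow> bool" where
  "normal_op T \<longleftrightarrow> T o\<^sub>L adj T = adj T o\<^sub>L T"

definition anti_self_adjoint :: "('h::quaternionic_hilbert \<Rightarrow>\<^sub>L 'h) \<Rightarrow> bool" where
  "anti_self_adjoint J \<longleftrightarrow> adj J = - J"

definition unitary_op :: "('h::quaternionic_hilbert \<Rightarrow>\<^sub>L 'h) \<Rightarrow> bool" where
  "unitary_op J \<longleftrightarrow> adj J o\<^sub>L J = id_blinfun \<and> J o\<^sub>L adj J = id_blinfun"

definition positive_op :: "('h::quaternionic_hilbert \<Rightarrow>\<^sub>L 'h) \<Rightarrow> bool" where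
  "positive_op P \<longleftrightarrow>
     (\<forall>u. qinner u (blinfun_apply P u) \<in> \<real> \<and> 0 \<le> qre (qinner u (blinfun_apply P u)))"

definition abs_op :: "('h::quaternionic_hilbert \<Rightarrow>\<^sub>L 'h) \<Rightarrow> 'h \<Rightarrow>\<^sub>L 'h" where
  "abs_op S = (THE P. P \<in> \<BB> \<and> positive_op P \<and> P o\<^sub>L P = adj S o\<^sub>L S)"

definition is_inverse_op ::
    "('h::quaternionic_hilbert \<Rightarrow>\<^sub>L 'h) \<Rightarrow> ('h \<Rightarrow>\<^sub>L 'h) \<Rightarrow> bool" where
  "is_inverse_op S R \<longleftrightarrow> R \<in> \<BB> \<and> S o\<^sub>L R = id_blinfun \<and> R o\<^sub>L S = id_blinfun"

definition inverse_op :: "('h::quaternionic_hilbert \<Rightarrow>\<^sub>L 'h) \<Rightarrow> 'h \<Rightarrow>\<^sub>L 'h" where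
  "inverse_op S = (THE R. is_inverse_op S R)"

text \<open>\<open>q + qcnj q\<close> is real, so that \<open>T (q + qcnj q)\<close> is a real multiple of \<open>T\<close>.\<close>

definition Delta :: "quat \<Rightarrow> ('h::quaternionic_hilbert \<Rightarrow>\<^sub>L 'h) \<Rightarrow> 'h \<Rightarrow>\<^sub>L 'h" where
  "Delta q T = (T o\<^sub>L T) - qre (q + qcnj q) *\<^sub>R T + (norm q)\<^sup>2 *\<^sub>R id_blinfun"

definition spherical_spectrum :: "('h::quaternionic_hilbert \<Rightarrow>\<^sub>L 'h) \<Rightarrow> quat set" (\<open>\<sigma>\<^sub>S\<close>) where
  "\<sigma>\<^sub>S T = {q. \<not> (\<exists>R. is_inverse_op (Delta q T) R)}"

definition rspanH :: "'h::quaternionic_hilbert set \<Rightarrow> 'h set" where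
  "rspanH N = {\<Sum>z\<in>F. z *\<^sub>H c z |F c. finite F \<and> F \<subseteq> N}"

definition hilbert_basis :: "'h::quaternionic_hilbert set \<Rightarrow> bool" where
  "hilbert_basis N \<longleftrightarrow>
     (\<forall>u\<in>N. \<forall>v\<in>N. qinner u v = (if u = v then 1 else 0)) \<and> closure (rspanH N) = UNIV"

definition left_scalar_mult :: "(quat \<Rightarrow> 'h::quaternionic_hilbert \<Rightarrow>\<^sub>L 'h) \<Rightarrow> bool" where
  "left_scalar_mult L \<longleftrightarrow> (\<exists>N. hilbert_basis N \<and>
     (\<forall>q. L q \<in> \<BB> \<and>
       (\<forall>u. ((\<lambda>z. z *\<^sub>H q *\<^sub>H qinner z u) has_sum blinfun_apply (L q) u) N)))"


section \<open>Continuous slice functional calculus\<close>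

text \<open>Continuity at \<open>g\<close> is spelled out, \<open>\<forall>q\<in>\<sigma>\<^sub>S T. norm (h q - g q) \<le> d\<close> being
  the statement that \<open>h - g\<close> has supremum norm at most \<open>d\<close>. It forces \<open>\<Psi> g\<close> to
  depend only on the values of \<open>g\<close> on the spectrum.\<close>

definition is_real_slice_calculus ::
    "('h::quaternionic_hilbert \<Rightarrow>\<^sub>L 'h) \<Rightarrow> ((quat \<Rightarrow> quat) \<Rightarrow> 'h \<Rightarrow>\<^sub>L 'h) \<Rightarrow> bool" where
  "is_real_slice_calculus T \<Psi> \<longleftrightarrow>
     (\<forall>g\<in>slice_cont_real (\<sigma>\<^sub>S T). \<Psi> g \<in> \<BB>) \<and>
     (\<forall>g\<in>slice_cont_real (\<sigma>\<^sub>S T). \<forall>h\<in>slice_cont_real (\<sigma>\<^sub>S T).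
        \<Psi> (\<lambda>q. g q + h q) = \<Psi> g + \<Psi> h \<and> \<Psi> (\<lambda>q. g q * h q) = \<Psi> g o\<^sub>L \<Psi> h) \<and>
     (\<forall>g\<in>slice_cont_real (\<sigma>\<^sub>S T). \<forall>r. \<Psi> (\<lambda>q. r *\<^sub>R g q) = r *\<^sub>R \<Psi> g) \<and>
     (\<forall>g\<in>slice_cont_real (\<sigma>\<^sub>S T). \<Psi> (\<lambda>q. qcnj (g q)) = adj (\<Psi> g)) \<and>
     \<Psi> (\<lambda>q. 1) = id_blinfun \<and>
     \<Psi> (\<lambda>q. q) = T \<and>
     (\<forall>g\<in>slice_cont_real (\<sigma>\<^sub>S T). \<forall>e>0. \<exists>d>0. \<forall>h\<in>slice_cont_real (\<sigma>\<^sub>S T).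
        (\<forall>q\<in>\<sigma>\<^sub>S T. norm (h q - g q) \<le> d) \<longrightarrow> norm (\<Psi> h - \<Psi> g) < e)"

text \<open>For normal \<open>T\<close> such a \<open>\<Psi>\<close> exists and is unique on \<open>slice_cont_real (\<sigma>\<^sub>S T)\<close>; the choice only
  fixes irrelevant values outside that set (which is why this is not a definite description).\<close>

definition real_slice_calculus ::
    "('h::quaternionic_hilbert \<Rightarrow>\<^sub>L 'h) \<Rightarrow> (quat \<Rightarrow> quat) \<Rightarrow> 'h \<Rightarrow>\<^sub>L 'h" where
  "real_slice_calculus T = (SOME \<Psi>. is_real_slice_calculus T \<Psi>)"

definition cont_slice_calculus ::
    "(quat \<Rightarrow> 'h::quaternionic_hilbert \<Rightarrow>\<^sub>L 'h) \<Rightarrow> quat \<Rightarrow> quat \<Rightarrow>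
     ('h \<Rightarrow>\<^sub>L 'h) \<Rightarrow> (quat \<Rightarrow> quat) \<Rightarrow> 'h \<Rightarrow>\<^sub>L 'h" where
  "cont_slice_calculus L \<jj> \<kappa> T g =
     (THE X. \<exists>g0\<in>slice_cont_real (\<sigma>\<^sub>S T). \<exists>g1\<in>slice_cont_real (\<sigma>\<^sub>S T).
             \<exists>g2\<in>slice_cont_real (\<sigma>\<^sub>S T). \<exists>g3\<in>slice_cont_real (\<sigma>\<^sub>S T).
        (\<forall>q\<in>\<sigma>\<^sub>S T. g q = g0 q + g1 q * \<jj> + g2 q * \<kappa> + g3 q * \<jj> * \<kappa>) \<and>
        X = real_slice_calculus T g0 + (real_slice_calculus T g1 o\<^sub>L L \<jj>) +
            (real_slice_calculus T g2 o\<^sub>L L \<kappa>) +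
            (real_slice_calculus T g3 o\<^sub>L L \<jj> o\<^sub>L L \<kappa>))"


section \<open>Slice regular functional calculus\<close>

text \<open>Integrals along rectifiable curves are Riemann-Stieltjes integrals. The integrand is written
  \<open>G s ds\<close>, the increment \<open>ds\<close> being an argument, because in the integral below \<open>ds\<close> stands between
  noncommuting factors.\<close>

definition rectifiable :: "(real \<Rightarrow> complex) \<Rightarrow> bool" where
  "rectifiable \<gamma> \<longleftrightarrow> (\<exists>M. \<forall>\<D>. \<D> division_of {0..1} \<longrightarrow>
     (\<Sum>I\<in>\<D>. norm (\<gamma> (Sup I) - \<gamma> (Inf I))) \<le> M)"

definition has_line_integral ::
    "(complex \<Rightarrow> complex \<Rightarrow> 'b::real_normed_vector) \<Rightarrow> (real \<Rightarrow> complex) \<Rightarrow> 'b \<Rightarrow> bool" where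
  "has_line_integral G \<gamma> X \<longleftrightarrow>
     (\<forall>e>0. \<exists>d>0. \<forall>p. p tagged_division_of {0..1} \<and> (\<lambda>t. ball t d) fine p \<longrightarrow>
        norm ((\<Sum>(t, I)\<in>p. G (\<gamma> t) (\<gamma> (Sup I) - \<gamma> (Inf I))) - X) < e)"

definition line_integral ::
    "(complex \<Rightarrow> complex \<Rightarrow> 'b::real_normed_vector) \<Rightarrow> (real \<Rightarrow> complex) \<Rightarrow> 'b" where
  "line_integral G \<gamma> = (THE X. has_line_integral G \<gamma> X)"

text \<open>The curves \<open>\<gamma>s\<close> are rectifiable Jordan curves whose union is the boundary of \<open>D\<close>. Positive
  orientation is expressed by the winding numbers of the whole cycle.\<close>

definition positively_oriented_boundary ::
    "complex set \<Rightarrow> (real \<Rightarrow> complex) list \<Rightarrow> bool" where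
  "positively_oriented_boundary D \<gamma>s \<longleftrightarrow>
     (\<forall>\<gamma>\<in>set \<gamma>s. simple_path \<gamma> \<and> pathfinish \<gamma> = pathstart \<gamma> \<and> rectifiable \<gamma>) \<and>
     (\<Union>\<gamma>\<in>set \<gamma>s. path_image \<gamma>) = frontier D \<and>
     (\<forall>z\<in>D. (\<Sum>\<gamma>\<leftarrow>\<gamma>s. winding_number \<gamma> z) = 1) \<and>
     (\<forall>z. z \<notin> closure D \<longrightarrow> (\<Sum>\<gamma>\<leftarrow>\<gamma>s. winding_number \<gamma> z) = 0)"

text \<open>Admissible choices of \<open>\<iota>\<close>, of the set \<open>U'\<close> and of its oriented boundary in the slice of \<open>\<iota>\<close>,
  which is transported to the complex plane by \<open>slice \<iota>\<close>.\<close>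

definition admissible_contour ::
    "('h::quaternionic_hilbert \<Rightarrow>\<^sub>L 'h) \<Rightarrow> quat set \<Rightarrow> quat \<Rightarrow> quat set \<Rightarrow>
     (real \<Rightarrow> complex) list \<Rightarrow> bool" where
  "admissible_contour T U \<iota> U' \<gamma>s \<longleftrightarrow>
     \<iota> \<in> \<S> \<and> bounded U' \<and> open U' \<and> circular U' \<and> \<sigma>\<^sub>S T \<subseteq> U' \<and> closure U' \<subseteq> U \<and>
     positively_oriented_boundary {z. slice \<iota> z \<in> U'} \<gamma>s"

definition left_S_resolvent ::
    "(quat \<Rightarrow> 'h::quaternionic_hilbert \<Rightarrow>\<^sub>L 'h) \<Rightarrow> ('h \<Rightarrow>\<^sub>L 'h) \<Rightarrow> quat \<Rightarrow> 'h \<Rightarrow>\<^sub>L 'h" where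
  "left_S_resolvent L T s = - (inverse_op (Delta s T) o\<^sub>L (T - L (qcnj s)))"

definition slice_regular_calculus ::
    "(quat \<Rightarrow> 'h::quaternionic_hilbert \<Rightarrow>\<^sub>L 'h) \<Rightarrow> quat \<Rightarrow> (real \<Rightarrow> complex) list \<Rightarrow>
     ('h \<Rightarrow>\<^sub>L 'h) \<Rightarrow> (quat \<Rightarrow> quat) \<Rightarrow> 'h \<Rightarrow>\<^sub>L 'h" where
  "slice_regular_calculus L \<iota> \<gamma>s T f =
     (1 / (2 * pi)) *\<^sub>R (\<Sum>\<gamma>\<leftarrow>\<gamma>s. line_integral
        (\<lambda>s ds. left_S_resolvent L T (slice \<iota> s) o\<^sub>L L (slice \<iota> ds) o\<^sub>L L (inverse \<iota>) o\<^sub>L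
                L (f (slice \<iota> s))) \<gamma>)"

end

(* Since T = A + J B with J an imaginary unit commuting with the self-adjoint operators A and B, T is a
   "complex" combination of a commuting pair, and q = a + \<iota> b lies outside the spherical spectrum only if
   (A - a)^2 + (B - b)^2 is bounded below. Bernstein approximation on a square, together with the fact that a
   product of commuting positive operators is positive, bounds |p(A, B)| by the supremum of |p| over the
   profile D of the spectrum, so that u(A, B) is defined for continuous u on D by Stone-Weierstrass; the real
   slice calculus is g = u + \<iota> v |-> u(A, B) + J v(A, B).

   Write f = sum of h_e e over e in {1, j, k, jk} with h_e complex holomorphic and h_e(cnj z) = cnj(h_e(z)).
   With C(w) the Cauchy transform of h_e over the contour, the operator integral of one component is
   Phi(P) + Phi(Q) L_\<iota>, where P(w) = (C(w) + cnj C(cnj w))/2 and Q(w) = (C(w) - cnj C(cnj w))/(2 i), because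
   this holds for Riemann sums and Phi is continuous. Cauchy's formula for cycles of rectifiable curves, proved
   by Dixon's argument, turns P into h_e and Q into 0 on D. *)

theory Submission
  imports Defs
begin

section \<open>Quaternions and the real inner product\<close>

text \<open>The obstacle is noncommutativity: \<open>L \<iota>\<close> commutes with A and B, but in
  general not with J, hence not with T. The integrand is therefore not a holomorphic function with
  values in a complex algebra to which Cauchy's theorem could be applied. The way out is to let only
  real coefficients pass across operators. A complex function k on the conjugation-symmetric set D
  is uniquely P + i Q with P and Q compatible with conjugation. Sending k to
  \<open>\<Phi> P + (\<Phi> Q o\<^sub>L L \<iota>)\<close>, with \<open>L \<iota>\<close> kept at
  the right end, is real linear and continuous for the supremum norm, and it takes c / (z - w), as a
  function of w, to the left S-resolvent at z composed with \<open>L (slice \<iota> c)\<close>. All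
  analysis then happens on scalar Cauchy kernels. Norm bounds that refer to D rather than to the
  whole square come from bump functions: a bump concentrated near a point off D is annihilated in
  the limit, because the joint lower bound there contradicts the smallness of the squared distance
  on its support.\<close>

lemma quat_sel [simp]:
  "qre 0 = 0" "qi 0 = 0" "qj 0 = 0" "qk 0 = 0"
  "qre 1 = 1" "qi 1 = 0" "qj 1 = 0" "qk 1 = 0"
  "qre (p + q) = qre p + qre q" "qi (p + q) = qi p + qi q" "qj (p + q) = qj p + qj q" "qk (p + q) = qk p + qk q"
  "qre (p - q) = qre p - qre q" "qi (p - q) = qi p - qi q" "qj (p - q) = qj p - qj q" "qk (p - q) = qk p - qk q"
  "qre (- p) = - qre p" "qi (- p) = - qi p" "qj (- p) = - qj p" "qk (- p) = - qk p"
  "qre (r *\<^sub>R q) = r * qre q" "qi (r *\<^sub>R q) = r * qi q" "qj (r *\<^sub>R q) = r * qj q" "qk (r *\<^sub>R q) = r * qk q"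
  "qre (qcnj q) = qre q" "qi (qcnj q) = - qi q" "qj (qcnj q) = - qj q" "qk (qcnj q) = - qk q"
  by (simp_all add: zero_quat_def one_quat_def plus_quat_def minus_quat_def uminus_quat_def scaleR_quat_def qcnj_def)

lemma quat_sel_of_real [simp]:
  "qre (of_real r) = r" "qi (of_real r) = 0" "qj (of_real r) = 0" "qk (of_real r) = 0"
  by (simp_all add: of_real_def)

lemma quat_sel_mult:
  "qre (p * q) = qre p * qre q - qi p * qi q - qj p * qj q - qk p * qk q"
  "qi (p * q) = qre p * qi q + qi p * qre q + qj p * qk q - qk p * qj q"
  "qj (p * q) = qre p * qj q - qi p * qk q + qj p * qre q + qk p * qi q"
  "qk (p * q) = qre p * qk q + qi p * qj q - qj p * qi q + qk p * qre q"
  by (simp_all add: times_quat_def)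

lemma of_real_commute_quat: "of_real r * (q::quat) = q * of_real r"
  by (simp add: of_real_def)

lemma quat_norm_sq: "(norm (q::quat))\<^sup>2 = (qre q)\<^sup>2 + (qi q)\<^sup>2 + (qj q)\<^sup>2 + (qk q)\<^sup>2"
  by (simp add: norm_quat_def inner_quat_def power2_eq_square)

text \<open>The real parts of the products with 1, i, j, k are the four coordinates up to sign.
  Quaternionic identities can thus be tested on real parts.\<close>

lemma quat_eq_if_qre_mult: assumes "\<And>q. qre (x * q) = qre (y * q)" shows "x = y"
  using assms[of 1] assms[of "Quat 0 1 0 0"] assms[of "Quat 0 0 1 0"] assms[of "Quat 0 0 0 1"]
  by (simp add: quat_eq_iff quat_sel_mult)

lemma imag_units_iff: "q \<in> \<S> \<longleftrightarrow> qre q = 0 \<and> (qi q)\<^sup>2 + (qj q)\<^sup>2 + (qk q)\<^sup>2 = 1"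
proof
  assume "q \<in> \<S>"
  then have "q * q = -1" by (simp add: imag_units_def power2_eq_square)
  then have e: "qre q * qre q - qi q * qi q - qj q * qj q - qk q * qk q = -1"
    "qre q * qi q = 0" "qre q * qj q = 0" "qre q * qk q = 0"
    by (auto simp: quat_eq_iff quat_sel_mult algebra_simps)
  \<comment> \<open>A nonzero real part would force the vector part to vanish through the mixed
    terms, leaving a real square equal to -1.\<close>
  then have "qre q = 0"
    using zero_le_square[of "qre q"] by (cases "qre q = 0") (auto simp del: zero_le_square)
  with e show "qre q = 0 \<and> (qi q)\<^sup>2 + (qj q)\<^sup>2 + (qk q)\<^sup>2 = 1"
    by (simp add: power2_eq_square)
next
  assume "qre q = 0 \<and> (qi q)\<^sup>2 + (qj q)\<^sup>2 + (qk q)\<^sup>2 = 1"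
  then show "q \<in> \<S>"
    by (auto simp: imag_units_def quat_eq_iff quat_sel_mult power2_eq_square algebra_simps)
qed

lemma imag_unit_square: "\<iota> \<in> \<S> \<Longrightarrow> \<iota> * \<iota> = -1"
  by (simp add: imag_units_def power2_eq_square)

lemma uminus_imag_unit [simp]: "- \<iota> \<in> \<S> \<longleftrightarrow> \<iota> \<in> \<S>"
  by (simp add: imag_units_iff)

lemma inverse_imag_unit: "\<iota> \<in> \<S> \<Longrightarrow> inverse \<iota> = - \<iota>"
  by (metis imag_unit_square inverse_unique minus_equation_iff mult_minus_right)

lemma qcnj_imag_unit: "\<iota> \<in> \<S> \<Longrightarrow> qcnj \<iota> = - \<iota>"
  by (simp add: imag_units_iff quat_eq_iff)

lemma quat_i_imag_unit [simp]: "Quat 0 1 0 0 \<in> \<S>"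
  by (simp add: imag_units_iff)

lemma qcnj_mult: "qcnj (p * q) = qcnj q * qcnj p"
  by (simp add: quat_eq_iff quat_sel_mult algebra_simps)

lemma qcnj_of_real [simp]: "qcnj (of_real r) = of_real r"
  by (simp add: quat_eq_iff)

lemma qcnj_add: "qcnj (p + q) = qcnj p + qcnj q"
  by (simp add: quat_eq_iff)

context
  fixes \<iota> :: quat
  assumes \<iota>: "\<iota> \<in> \<S>"
begin

lemma slice_add: "slice \<iota> (z + w) = slice \<iota> z + slice \<iota> w"
  by (simp add: slice_def algebra_simps)

lemma slice_diff: "slice \<iota> (z - w) = slice \<iota> z - slice \<iota> w"
  by (simp add: slice_def algebra_simps)

lemma slice_mult: "slice \<iota> (z * w) = slice \<iota> z * slice \<iota> w"
proof -
  have "slice \<iota> z * slice \<iota> w = of_real (Re z * Re w) + \<iota> * of_real (Re z * Im w) +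
     \<iota> * of_real (Im z * Re w) + (\<iota> * \<iota>) * of_real (Im z * Im w)"
    by (simp add: slice_def of_real_def algebra_simps)
  then show ?thesis
    by (simp add: slice_def imag_unit_square[OF \<iota>] algebra_simps)
qed

lemma slice_cnj: "slice \<iota> (cnj z) = qcnj (slice \<iota> z)"
  by (simp add: slice_def qcnj_add qcnj_mult qcnj_imag_unit[OF \<iota>] of_real_commute_quat)

lemma slice_scaleR: "slice \<iota> (r *\<^sub>R z) = r *\<^sub>R slice \<iota> z"
  by (simp add: slice_def algebra_simps of_real_def)

lemma norm_slice: "norm (slice \<iota> z) = norm z"
proof -
  have s: "(qi \<iota>)\<^sup>2 + (qj \<iota>)\<^sup>2 + (qk \<iota>)\<^sup>2 = 1" "qre \<iota> = 0" using \<iota> by (auto simp: imag_units_iff)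
  have "(norm (slice \<iota> z))\<^sup>2 = (Re z)\<^sup>2 + ((qi \<iota>)\<^sup>2 + (qj \<iota>)\<^sup>2 + (qk \<iota>)\<^sup>2) * (Im z)\<^sup>2"
    unfolding quat_norm_sq by (simp add: slice_def quat_sel_mult s power2_eq_square algebra_simps)
  also have "\<dots> = (norm z)\<^sup>2" by (simp add: s(1) cmod_power2)
  finally show ?thesis by (metis norm_ge_zero power2_eq_imp_eq)
qed

lemma slice_one [simp]: "slice \<iota> 1 = 1"
  by (simp add: slice_def)

lemma qre_slice [simp]: "qre (slice \<iota> z) = Re z"
  using \<iota> by (simp add: slice_def quat_sel_mult imag_units_iff)

end

lemma slice_uminus_unit: "slice (- \<iota>) z = slice \<iota> (cnj z)"
  by (simp add: slice_def)


section \<open>The underlying real Hilbert space\<close>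

definition rinner :: "'h::quaternionic_hilbert \<Rightarrow> 'h \<Rightarrow> real" where
  "rinner u v = qre (qinner u v)"

lemma rscale_zero [simp]: "(u::'h::quaternionic_hilbert) *\<^sub>H 0 = 0"
  using rscaleH_add_right[of u 0 0] by simp

lemma rscaleR_commute: "(r *\<^sub>R u) *\<^sub>H q = r *\<^sub>R ((u::'h::quaternionic_hilbert) *\<^sub>H q)"
  by (simp add: scaleR_eq_rscaleH of_real_commute_quat flip: rscaleH_mult)

lemma rscaleR_right: "u *\<^sub>H (r *\<^sub>R q) = r *\<^sub>R ((u::'h::quaternionic_hilbert) *\<^sub>H q)"
  by (simp add: scaleR_eq_rscaleH rscaleH_mult[symmetric]) (simp add: of_real_def)

lemma qinner_add_left: "qinner (u + v) w = qinner u w + qinner v (w::'h::quaternionic_hilbert)"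
  by (metis qinner_commute qinner_add_right qcnj_add)

lemma qinner_rscale_left: "qinner (u *\<^sub>H q) v = qcnj q * qinner u (v::'h::quaternionic_hilbert)"
  by (metis qinner_commute qinner_rscaleH_right qcnj_mult)

lemma rinner_commute: "rinner u v = rinner v u"
  unfolding rinner_def by (subst qinner_commute) simp

lemma rinner_add_right: "rinner u (v + w) = rinner u v + rinner u w"
  by (simp add: rinner_def qinner_add_right)

lemma rinner_add_left: "rinner (u + v) w = rinner u w + rinner v w"
  by (simp add: rinner_def qinner_add_left)

lemma rinner_scaleR_right: "rinner u (r *\<^sub>R v) = r * rinner u v"
  by (simp add: rinner_def scaleR_eq_rscaleH qinner_rscaleH_right) (simp add: of_real_def)

lemma rinner_scaleR_left: "rinner (r *\<^sub>R u) v = r * rinner u v"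
  by (metis rinner_commute rinner_scaleR_right)

lemma rinner_minus_right: "rinner u (- v) = - rinner u v"
  using rinner_scaleR_right[of u "-1" v] by simp

lemma rinner_minus_left: "rinner (- u) v = - rinner u v"
  by (metis rinner_commute rinner_minus_right)

lemma rinner_diff_right: "rinner u (v - w) = rinner u v - rinner u w"
  using rinner_add_right[of u v "-w"] by (simp add: rinner_minus_right)

lemma rinner_diff_left: "rinner (u - v) w = rinner u w - rinner v w"
  by (metis rinner_commute rinner_diff_right)

lemma rinner_zero [simp]: "rinner u 0 = 0" "rinner 0 u = 0"
  using rinner_add_right[of u 0 0] by (simp_all add: rinner_commute)

lemmas rinner_simps = rinner_add_left rinner_add_right rinner_diff_left rinner_diff_right rinner_minus_left
  rinner_minus_right rinner_scaleR_left rinner_scaleR_right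

lemma rinner_self: "rinner u u = (norm u)\<^sup>2"
  using qinner_self_nonneg[of u] by (simp add: rinner_def norm_eq_sqrt_qinner)

lemma rinner_self_nonneg: "0 \<le> rinner u u"
  by (simp add: rinner_self)

lemma rinner_cauchy_schwarz: "\<bar>rinner u v\<bar> \<le> norm u * norm v"
proof (cases "v = 0")
  case False
  then have nv: "norm v > 0" by simp
  \<comment> \<open>\<open>t *\<^sub>R v\<close> is the orthogonal projection of u to the line of v,
    so this t gives the sharpest inequality.\<close>
  define t where "t = rinner u v / (norm v)\<^sup>2"
  have "0 \<le> rinner (u - t *\<^sub>R v) (u - t *\<^sub>R v)" by (rule rinner_self_nonneg)
  also have "\<dots> = (norm u)\<^sup>2 - 2 * t * rinner u v + t * t * (norm v)\<^sup>2"
    unfolding rinner_self[symmetric] by (simp add: rinner_simps rinner_commute[of v u] algebra_simps)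
  also have "\<dots> = (norm u)\<^sup>2 - (rinner u v)\<^sup>2 / (norm v)\<^sup>2"
    using nv by (simp add: t_def field_simps power2_eq_square)
  finally have "(rinner u v)\<^sup>2 \<le> (norm u * norm v)\<^sup>2"
    using nv by (simp add: field_simps power_mult_distrib)
  then show ?thesis
    by (meson mult_nonneg_nonneg norm_ge_zero power2_le_iff_abs_le)
qed simp

lemma bounded_bilinear_rinner: "bounded_bilinear (rinner :: 'h::quaternionic_hilbert \<Rightarrow> 'h \<Rightarrow> real)"
  by standard (auto simp: rinner_simps intro!: exI[of _ 1] rinner_cauchy_schwarz)

interpretation rinner: bounded_bilinear "rinner :: 'h::quaternionic_hilbert \<Rightarrow> 'h \<Rightarrow> real"
  by (rule bounded_bilinear_rinner)

lemma rinner_eq_self_iff: "(\<And>v. rinner u v = rinner w v) \<Longrightarrow> u = w"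
proof -
  assume "\<And>v. rinner u v = rinner w v"
  then have "rinner (u - w) (u - w) = 0" by (simp add: rinner_diff_left)
  then show ?thesis by (simp add: rinner_self)
qed

lemma norm_rscale: "norm (u *\<^sub>H q) = norm u * norm (q::quat)"
proof -
  have r: "qinner u u = of_real ((norm u)\<^sup>2)"
    using qinner_self_nonneg[of u] rinner_self[of u] unfolding rinner_def by (metis Reals_cases quat_sel_of_real(1))
  have "qinner (u *\<^sub>H q) (u *\<^sub>H q) = qcnj q * q * of_real ((norm u)\<^sup>2)"
    unfolding qinner_rscaleH_right qinner_rscale_left r mult.assoc of_real_commute_quat[of _ q] ..
  then have "rinner (u *\<^sub>H q) (u *\<^sub>H q) = (norm u * norm q)\<^sup>2"
    by (simp add: rinner_def mult_qcnj of_real_def power_mult_distrib power2_norm_eq_inner)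
  then show ?thesis by (simp add: rinner_self)
qed

lemma bounded_linear_rscale: "bounded_linear (\<lambda>u::'h::quaternionic_hilbert. u *\<^sub>H q)"
  by (rule bounded_linear_intro[of _ "norm q"]) (auto simp: rscaleH_add_left rscaleR_commute norm_rscale)

lemma rinner_rscale_right: "rinner u (v *\<^sub>H q) = qre (qinner u v * q)"
  by (simp add: rinner_def qinner_rscaleH_right)

text \<open>The way back from the real scalar product: testing with all right multiples of v
  recovers the quaternionic one.\<close>

lemma qinner_eqI: "(\<And>q. rinner u (v *\<^sub>H q) = rinner u' (v' *\<^sub>H q)) \<Longrightarrow> qinner u v = qinner u' v'"
  by (rule quat_eq_if_qre_mult) (simp add: rinner_rscale_right)

section \<open>Riesz representation and adjoints\<close>

text \<open>The representing vector is the minimiser of the quadratic functional q: minimising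
  sequences are Cauchy by the parallelogram identity, and the first variation at the minimum
  vanishes.\<close>

lemma riesz_real:
  fixes \<phi> :: "'h::quaternionic_hilbert \<Rightarrow> real"
  assumes "bounded_linear \<phi>"
  shows "\<exists>w. \<forall>v. \<phi> v = rinner w v"
proof -
  interpret bounded_linear \<phi> by fact
  obtain K where K: "\<And>x. norm (\<phi> x) \<le> norm x * K" using bounded by blast
  define q where "q x = rinner x x / 2 - \<phi> x" for x
  have "q x \<ge> - K\<^sup>2 / 2" for x
  proof -
    have "\<phi> x \<le> norm x * K" using K[of x] by simp
    moreover have "0 \<le> (norm x - K)\<^sup>2" by simp
    ultimately show ?thesis by (simp add: q_def rinner_self power2_eq_square algebra_simps)
  qed
  then have bb: "bdd_below (range q)" by (intro bdd_belowI2)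
  define m where "m = Inf (range q)"
  have m: "m \<le> q x" for x unfolding m_def by (rule cInf_lower[OF _ bb]) simp
  have "\<exists>x. q x < m + 1 / Suc n" for n
    using cInf_lessD[of "range q" "m + 1 / Suc n"] unfolding m_def by auto
  then obtain X where X: "\<And>n. q (X n) < m + 1 / Suc n" by metis
  \<comment> \<open>The value at the midpoint cannot drop below the infimum m, so two
    near-minimisers are close to each other.\<close>
  have par: "(norm (x - y))\<^sup>2 \<le> 4 * (q x - m) + 4 * (q y - m)" for x y
  proof -
    have "q ((1/2) *\<^sub>R (x + y)) = (q x + q y) / 2 - (norm (x - y))\<^sup>2 / 8"
      unfolding rinner_self[symmetric] q_def
      by (simp add: add scale rinner_simps rinner_commute[of y x] field_simps)
    then have "m \<le> (q x + q y) / 2 - (norm (x - y))\<^sup>2 / 8"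
      using m[of "(1/2) *\<^sub>R (x + y)"] by simp
    then have "8 * m \<le> 4 * q x + 4 * q y - (norm (x - y))\<^sup>2"
      by (simp add: field_simps)
    then show ?thesis by (simp add: algebra_simps)
  qed
  have "Cauchy X"
  proof (rule metric_CauchyI)
    fix e :: real assume e: "e > 0"
    \<comment> \<open>Both values exceed m by less than 1 / N, so \<open>par\<close> bounds the
      squared distance by 8 / N.\<close>
    obtain N where N: "8 / e\<^sup>2 < real N" using reals_Archimedean2 by blast
    show "\<exists>M. \<forall>m\<ge>M. \<forall>n\<ge>M. dist (X m) (X n) < e"
    proof (intro exI allI impI)
      fix k l assume k: "k \<ge> N" and l: "l \<ge> N"
      have N0: "real N > 0" using N e by (smt (verit) divide_pos_pos zero_less_power)
      have a: "1 / real (Suc k) < 1 / real N" if "k \<ge> N" for k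
        using that N0 by (intro divide_strict_left_mono) auto
      have "(norm (X k - X l))\<^sup>2 < 8 / real N"
        using par[of "X k" "X l"] X[of k] X[of l] a[OF k] a[OF l] by simp
      also have "\<dots> < e\<^sup>2" using N N0 e by (simp add: field_simps)
      finally show "dist (X k) (X l) < e"
        using e by (simp add: dist_norm power2_less_imp_less)
    qed
  qed
  then obtain w where w: "X \<longlonglongrightarrow> w" using Cauchy_convergent convergent_def by blast
  have "(\<lambda>n. q (X n)) \<longlonglongrightarrow> q w"
    unfolding q_def by (intro tendsto_intros rinner.tendsto w tendsto) simp
  moreover have "(\<lambda>n. m + 1 / Suc n) \<longlonglongrightarrow> m + 0"
    by (intro tendsto_intros LIMSEQ_Suc[OF lim_1_over_n])
  ultimately have "q w \<le> m"
    using X by (intro LIMSEQ_le) (auto intro!: exI[of _ 0] less_imp_le)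
  then have qw: "q w \<le> q x" for x using m[of x] by simp
  have "\<phi> v = rinner w v" for v
  proof -
    define a where "a = rinner w v - \<phi> v"
    have ineq: "0 \<le> t * a + t\<^sup>2 * ((norm v)\<^sup>2 / 2)" for t
      using qw[of "w + t *\<^sub>R v"]
      by (simp add: q_def a_def add scale rinner_simps rinner_commute[of v w] rinner_self[of v] power2_eq_square field_simps)
    \<comment> \<open>At t = - a / d the quadratic polynomial in t equals - (a / d) squared, which
      contradicts minimality unless a = 0. The added 1 keeps d positive for v = 0.\<close>
    define d where "d = (norm v)\<^sup>2 / 2 + 1"
    have d: "d > 0" by (simp add: d_def add_nonneg_pos)
    have nv: "(norm v)\<^sup>2 / 2 = d - 1" by (simp add: d_def)
    have "0 \<le> (- a / d) * a + (- a / d)\<^sup>2 * ((norm v)\<^sup>2 / 2)" by (rule ineq)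
    also have "\<dots> = - (a\<^sup>2 / d\<^sup>2)"
      unfolding nv using d by (simp add: field_simps power2_eq_square)
    finally have "a = 0" using d by (simp add: divide_le_0_iff)
    then show ?thesis by (simp add: a_def)
  qed
  then show ?thesis by blast
qed

lemma qlin_opsD: "T \<in> \<BB> \<Longrightarrow> T (u *\<^sub>H q) = T u *\<^sub>H q"
  by (simp add: qlin_ops_def)

text \<open>The real representation theorem gives an adjoint only for the real scalar product. Right
  linearity of T upgrades its defining identity to the quaternionic product, and this in turn makes
  the adjoint right linear.\<close>

lemma adj_exists:
  fixes T :: "'h::quaternionic_hilbert \<Rightarrow>\<^sub>L 'h"
  assumes T: "T \<in> \<BB>"
  shows "\<exists>S\<in>\<BB>. \<forall>u v. qinner (S u) v = qinner u (T v)"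
proof -
  have "bounded_linear (\<lambda>v. rinner u (T v))" for u
    by (intro bounded_linear_compose[OF rinner.bounded_linear_right] blinfun.bounded_linear_right)
  then have "\<forall>u. \<exists>w. \<forall>v. rinner u (T v) = rinner w v" using riesz_real by blast
  then obtain s where s: "\<And>u v. rinner u (T v) = rinner (s u) v" by metis
  have qs: "qinner (s u) v = qinner u (T v)" for u v
    by (rule qinner_eqI) (simp flip: s add: qlin_opsD[OF T])
  have "bounded_linear s"
  proof (rule bounded_linear_intro[of _ "norm T"])
    show "s (x + y) = s x + s y" for x y
      by (rule rinner_eq_self_iff) (simp add: rinner_simps flip: s)
    show "s (r *\<^sub>R x) = r *\<^sub>R s x" for r x
      by (rule rinner_eq_self_iff) (simp add: rinner_simps flip: s)
    show "norm (s x) \<le> norm x * norm T" for x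
    proof (cases "s x = 0")
      case False
      have "(norm (s x))\<^sup>2 = rinner x (T (s x))" by (simp add: s rinner_self)
      also have "\<dots> \<le> norm x * (norm T * norm (s x))"
        by (rule order_trans[OF abs_ge_self order_trans[OF rinner_cauchy_schwarz]])
           (simp add: mult_left_mono norm_blinfun)
      finally show ?thesis using False by (simp add: power2_eq_square)
    qed simp
  qed
  note bl = bounded_linear_Blinfun_apply[OF this]
  have "Blinfun s \<in> \<BB>"
    unfolding qlin_ops_def mem_Collect_eq bl
  proof safe
    fix u q
    show "s (u *\<^sub>H q) = s u *\<^sub>H q"
    proof (rule rinner_eq_self_iff)
      fix v
      have "qinner (s (u *\<^sub>H q)) v = qinner (s u *\<^sub>H q) v"
        by (simp add: qs qinner_rscale_left)
      then show "rinner (s (u *\<^sub>H q)) v = rinner (s u *\<^sub>H q) v" by (simp add: rinner_def)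
    qed
  qed
  then show ?thesis using qs bl by metis
qed

lemma adjI:
  fixes S T :: "'h::quaternionic_hilbert \<Rightarrow>\<^sub>L 'h"
  assumes "S \<in> \<BB>" "\<And>u v. qinner (S u) v = qinner u (T v)"
  shows "adj T = S"
  unfolding adj_def
proof (rule the_equality)
  fix S' assume S': "S' \<in> \<BB> \<and> (\<forall>u v. qinner (S' u) v = qinner u (T v))"
  show "S' = S"
    by (rule blinfun_eqI, rule rinner_eq_self_iff) (simp add: rinner_def S' assms)
qed (use assms in auto)

lemma adj_works:
  fixes T :: "'h::quaternionic_hilbert \<Rightarrow>\<^sub>L 'h"
  assumes "T \<in> \<BB>" shows "adj T \<in> \<BB>" "qinner (adj T u) v = qinner u (T v)"
  using adj_exists[OF assms] adjI by metis+

lemma adj_rinner: "T \<in> \<BB> \<Longrightarrow> rinner (adj T u) v = rinner u (T v)"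
  by (simp add: rinner_def adj_works)

lemma qlin_ops_intros [intro]:
  fixes S T :: "'h::quaternionic_hilbert \<Rightarrow>\<^sub>L 'h"
  shows
  "id_blinfun \<in> \<BB>" "S \<in> \<BB> \<Longrightarrow> T \<in> \<BB> \<Longrightarrow> S + T \<in> \<BB>" "S \<in> \<BB> \<Longrightarrow> T \<in> \<BB> \<Longrightarrow> S - T \<in> \<BB>"
  "S \<in> \<BB> \<Longrightarrow> T \<in> \<BB> \<Longrightarrow> S o\<^sub>L T \<in> \<BB>" "S \<in> \<BB> \<Longrightarrow> r *\<^sub>R S \<in> \<BB>" "S \<in> \<BB> \<Longrightarrow> - S \<in> \<BB>"
proof -
  have "(- v) *\<^sub>H q = - (v *\<^sub>H q)" for v :: 'h and q using rscaleR_commute[of "-1" v q] by simp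
  moreover from this have "(v - w) *\<^sub>H q = v *\<^sub>H q - w *\<^sub>H q" for v w :: 'h and q
    using rscaleH_add_left[of v "-w" q] by simp
  ultimately show "id_blinfun \<in> \<BB>" "S \<in> \<BB> \<Longrightarrow> T \<in> \<BB> \<Longrightarrow> S + T \<in> \<BB>" "S \<in> \<BB> \<Longrightarrow> T \<in> \<BB> \<Longrightarrow> S - T \<in> \<BB>"
    "S \<in> \<BB> \<Longrightarrow> T \<in> \<BB> \<Longrightarrow> S o\<^sub>L T \<in> \<BB>" "S \<in> \<BB> \<Longrightarrow> r *\<^sub>R S \<in> \<BB>" "S \<in> \<BB> \<Longrightarrow> - S \<in> \<BB>"
    by (auto simp: qlin_ops_def blinfun.bilinear_simps rscaleH_add_left rscaleR_commute)
qed

lemma qlin_ops_limit: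
  fixes T :: "'h::quaternionic_hilbert \<Rightarrow>\<^sub>L 'h"
  assumes "\<And>n. S n \<in> \<BB>" "S \<longlonglongrightarrow> T" shows "T \<in> \<BB>"
  unfolding qlin_ops_def
proof safe
  fix u q
  have "(\<lambda>n. S n (u *\<^sub>H q)) \<longlonglongrightarrow> T (u *\<^sub>H q)" by (intro blinfun.tendsto assms tendsto_const)
  moreover have "(\<lambda>n. S n u *\<^sub>H q) \<longlonglongrightarrow> T u *\<^sub>H q"
    by (intro bounded_linear.tendsto[OF bounded_linear_rscale] blinfun.tendsto assms tendsto_const)
  ultimately show "T (u *\<^sub>H q) = T u *\<^sub>H q"
    using LIMSEQ_unique by (simp add: qlin_opsD[OF assms(1)]) blast
qed

section \<open>Left scalar multiplications\<close>

text \<open>\<open>L q\<close> multiplies every Fourier coefficient along N by q from the left, and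
  this yields the composition rule. For q = 1 the vector \<open>L 1 u - u\<close> is orthogonal to
  N, whose span is dense.\<close>

lemma left_scalar_mult_algebra:
  assumes "left_scalar_mult L"
  shows "L p o\<^sub>L L q = L (p * q)" "L (p + q) = L p + L q" "L (r *\<^sub>R q) = r *\<^sub>R L q"
    "L 1 = id_blinfun" "L q \<in> \<BB>"
proof -
  obtain N where N: "hilbert_basis N" and LB: "\<And>q. L q \<in> \<BB>"
    and S: "\<And>q u. ((\<lambda>z. z *\<^sub>H q *\<^sub>H qinner z u) has_sum L q u) N"
    using assms unfolding left_scalar_mult_def by blast
  show "L q \<in> \<BB>" by fact
  have on: "\<And>u v. u \<in> N \<Longrightarrow> v \<in> N \<Longrightarrow> qinner u v = (if u = v then 1 else 0)"
    and dn: "closure (rspanH N) = UNIV" using N by (auto simp: hilbert_basis_def)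
  \<comment> \<open>Pairing the defining series termwise with z leaves a single summand by
    orthonormality. The factor p allows a real-valued functional to be applied to the
    series.\<close>
  have coef: "qinner z (L q u) = q * qinner z u" if z: "z \<in> N" for z q u
  proof (rule quat_eq_if_qre_mult)
    fix p
    have bl: "bounded_linear (\<lambda>v. rinner z (v *\<^sub>H p))"
      by (intro bounded_linear_compose[OF rinner.bounded_linear_right] bounded_linear_rscale)
    have "((\<lambda>y. rinner z (y *\<^sub>H q *\<^sub>H qinner y u *\<^sub>H p)) has_sum rinner z (L q u *\<^sub>H p)) N"
      using has_sum_bounded_linear[OF bl S[of q u]] by (simp add: o_def)
    moreover have "((\<lambda>y. rinner z (y *\<^sub>H q *\<^sub>H qinner y u *\<^sub>H p)) has_sum qre (q * qinner z u * p)) N"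
    proof (rule has_sum_finite_neutralI[of "{z}"])
      fix y assume "y \<in> N - {z}"
      then show "rinner z (y *\<^sub>H q *\<^sub>H qinner y u *\<^sub>H p) = 0"
        using z by (auto simp: rinner_def qinner_rscaleH_right on)
    qed (use z in \<open>auto simp: rinner_def qinner_rscaleH_right on\<close>)
    ultimately show "qre (qinner z (L q u) * p) = qre (q * qinner z u * p)"
      using has_sum_unique by (fastforce simp: rinner_rscale_right)
  qed
  show "L p o\<^sub>L L q = L (p * q)"
  proof (rule blinfun_eqI)
    fix u
    have "((\<lambda>z. z *\<^sub>H p *\<^sub>H qinner z (L q u)) has_sum L p (L q u)) N" by (rule S)
    moreover have "((\<lambda>z. z *\<^sub>H p *\<^sub>H qinner z (L q u)) has_sum L (p * q) u) N"
      by (rule has_sum_cong[THEN iffD1, OF _ S[of "p * q" u]])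
         (simp add: coef mult.assoc flip: rscaleH_mult)
    ultimately show "(L p o\<^sub>L L q) u = L (p * q) u" using has_sum_unique by fastforce
  qed
  show "L (p + q) = L p + L q"
  proof (rule blinfun_eqI)
    fix u
    have "((\<lambda>z. z *\<^sub>H (p + q) *\<^sub>H qinner z u) has_sum L p u + L q u) N"
      using has_sum_add[OF S[of p u] S[of q u]] by (simp add: rscaleH_add_right rscaleH_add_left)
    with S[of "p+q" u] show "L (p + q) u = (L p + L q) u"
      using has_sum_unique by (fastforce simp: blinfun.bilinear_simps)
  qed
  show "L (r *\<^sub>R q) = r *\<^sub>R L q"
  proof (rule blinfun_eqI)
    fix u
    have "((\<lambda>z. z *\<^sub>H (r *\<^sub>R q) *\<^sub>H qinner z u) has_sum r *\<^sub>R L q u) N"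
      using has_sum_scaleR[OF S[of q u]] by (simp add: rscaleR_right rscaleR_commute)
    with S[of "r *\<^sub>R q" u] show "L (r *\<^sub>R q) u = (r *\<^sub>R L q) u"
      using has_sum_unique by (fastforce simp: blinfun.bilinear_simps)
  qed
  show "L 1 = id_blinfun"
  proof (rule blinfun_eqI)
    fix u
    define d where "d = L 1 u - u"
    have z0: "qinner d z = 0" if "z \<in> N" for z
    proof -
      have "qinner z d + qinner z u = qinner z u"
        using coef[OF that, of 1 u] by (simp add: d_def flip: qinner_add_right)
      then have "qinner z d = 0" by simp
      then show ?thesis by (subst qinner_commute) (simp add: quat_eq_iff)
    qed
    have "rspanH N \<subseteq> {v. rinner d v = 0}"
    proof
      fix v assume "v \<in> rspanH N"
      then obtain F c where "finite F" "F \<subseteq> N" "v = (\<Sum>z\<in>F. z *\<^sub>H c z)" by (auto simp: rspanH_def)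
      then show "v \<in> {v. rinner d v = 0}"
        by (auto simp: rinner.sum_right rinner_rscale_right z0 subset_iff intro!: sum.neutral)
    qed
    moreover have "closed {v. rinner d v = 0}"
      by (intro closed_Collect_eq continuous_intros linear_continuous_on rinner.bounded_linear_right)
    ultimately have "closure (rspanH N) \<subseteq> {v. rinner d v = 0}" by (rule closure_minimal)
    then have "rinner d d = 0" using dn by auto
    then show "L 1 u = id_blinfun u" by (simp add: rinner_self d_def)
  qed
qed

section \<open>Self-adjoint, positive and commuting operators\<close>

definition self_adj :: "('h::quaternionic_hilbert \<Rightarrow>\<^sub>L 'h) \<Rightarrow> bool" where
  "self_adj S \<longleftrightarrow> (\<forall>u v. rinner (S u) v = rinner u (S v))"

definition nonneg_op :: "('h::quaternionic_hilbert \<Rightarrow>\<^sub>L 'h) \<Rightarrow> bool" where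
  "nonneg_op S \<longleftrightarrow> (\<forall>u. 0 \<le> rinner u (S u))"

definition commutes :: "('h::real_normed_vector \<Rightarrow>\<^sub>L 'h) \<Rightarrow> ('h \<Rightarrow>\<^sub>L 'h) \<Rightarrow> bool" where
  "commutes P Q \<longleftrightarrow> (\<forall>u. P (Q u) = Q (P u))"

lemma commutes_iff_compose: "commutes P Q \<longleftrightarrow> P o\<^sub>L Q = Q o\<^sub>L P"
  by (metis commutes_def blinfun_apply_blinfun_compose blinfun_eqI)

lemma commutes_sym: "commutes P Q \<Longrightarrow> commutes Q P"
  by (simp add: commutes_def)

lemma commutes_refl [simp]: "commutes P P"
  by (simp add: commutes_def)

lemma commutes_id [simp]: "commutes id_blinfun P" "commutes P id_blinfun"
  by (simp_all add: commutes_def)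

lemma commutes_intros:
  "commutes P Q \<Longrightarrow> commutes P R \<Longrightarrow> commutes P (Q + R)"
  "commutes P Q \<Longrightarrow> commutes P R \<Longrightarrow> commutes P (Q - R)"
  "commutes P Q \<Longrightarrow> commutes P R \<Longrightarrow> commutes P (Q o\<^sub>L R)"
  "commutes P Q \<Longrightarrow> commutes P (r *\<^sub>R Q)"
  "commutes P R \<Longrightarrow> commutes Q R \<Longrightarrow> commutes (P + Q) R"
  "commutes P R \<Longrightarrow> commutes Q R \<Longrightarrow> commutes (P - Q) R"
  "commutes P R \<Longrightarrow> commutes Q R \<Longrightarrow> commutes (P o\<^sub>L Q) R"
  "commutes P Q \<Longrightarrow> commutes (r *\<^sub>R P) Q"
  by (simp_all add: commutes_def blinfun.bilinear_simps)

lemma commutes_limit: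
  assumes "\<And>n. commutes P (S n)" "S \<longlonglongrightarrow> T" shows "commutes P T"
  unfolding commutes_def
proof
  fix u
  have "(\<lambda>n. P (S n u)) \<longlonglongrightarrow> P (T u)" by (intro blinfun.tendsto assms tendsto_const)
  moreover have "(\<lambda>n. S n (P u)) \<longlonglongrightarrow> T (P u)" by (intro blinfun.tendsto assms tendsto_const)
  ultimately show "P (T u) = T (P u)" using assms(1) LIMSEQ_unique by (simp add: commutes_def) blast
qed

lemma self_adj_intros:
  "self_adj id_blinfun"
  "self_adj P \<Longrightarrow> self_adj Q \<Longrightarrow> self_adj (P + Q)"
  "self_adj P \<Longrightarrow> self_adj Q \<Longrightarrow> self_adj (P - Q)"
  "self_adj P \<Longrightarrow> self_adj (r *\<^sub>R P)"
  "self_adj P \<Longrightarrow> self_adj Q \<Longrightarrow> commutes P Q \<Longrightarrow> self_adj (P o\<^sub>L Q)"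
  by (simp_all add: self_adj_def commutes_def blinfun.bilinear_simps rinner_simps)

lemma self_adj_limit:
  assumes "\<And>n. self_adj (S n)" "S \<longlonglongrightarrow> T" shows "self_adj T"
  unfolding self_adj_def
proof safe
  fix u v
  have "(\<lambda>n. rinner (S n u) v) \<longlonglongrightarrow> rinner (T u) v" by (intro rinner.tendsto blinfun.tendsto assms tendsto_const)
  moreover have "(\<lambda>n. rinner u (S n v)) \<longlonglongrightarrow> rinner u (T v)" by (intro rinner.tendsto blinfun.tendsto assms tendsto_const)
  ultimately show "rinner (T u) v = rinner u (T v)" using assms(1) LIMSEQ_unique by (simp add: self_adj_def) blast
qed

lemma nonneg_op_limit:
  assumes "\<And>n. nonneg_op (S n)" "S \<longlonglongrightarrow> T" shows "nonneg_op T"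
  unfolding nonneg_op_def
proof
  fix u
  have "(\<lambda>n. rinner u (S n u)) \<longlonglongrightarrow> rinner u (T u)" by (intro rinner.tendsto blinfun.tendsto assms tendsto_const)
  then show "0 \<le> rinner u (T u)" using assms(1) by (intro LIMSEQ_le_const) (auto simp: nonneg_op_def)
qed

lemma nonneg_op_add: "nonneg_op P \<Longrightarrow> nonneg_op Q \<Longrightarrow> nonneg_op (P + Q)"
  by (simp add: nonneg_op_def blinfun.bilinear_simps rinner_simps)

lemma nonneg_op_scaleR: "0 \<le> r \<Longrightarrow> nonneg_op P \<Longrightarrow> nonneg_op (r *\<^sub>R P)"
  by (simp add: nonneg_op_def blinfun.bilinear_simps rinner_simps)

lemma nonneg_op_id [simp]: "nonneg_op id_blinfun"
  by (simp add: nonneg_op_def rinner_self)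

lemma rinner_apply_le: "\<bar>rinner u (blinfun_apply S u)\<bar> \<le> norm S * rinner u u"
proof -
  have "\<bar>rinner u (S u)\<bar> \<le> norm u * (norm S * norm u)"
    by (rule order_trans[OF rinner_cauchy_schwarz]) (simp add: mult_left_mono norm_blinfun)
  then show ?thesis by (simp add: rinner_self power2_eq_square algebra_simps)
qed

text \<open>Iterating \<open>S \<mapsto> S - S\<^sup>2\<close> writes a positive contraction as a series of squares
  of operators that commute with everything it commutes with.\<close>

lemma nonneg_op_compose_contraction:
  fixes P Q :: "'h::quaternionic_hilbert \<Rightarrow>\<^sub>L 'h"
  assumes P: "self_adj P" "nonneg_op P" "nonneg_op (id_blinfun - P)" and Q: "nonneg_op Q" and PQ: "commutes P Q"
  shows "nonneg_op (Q o\<^sub>L P)"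
proof -
  define S where "S = rec_nat P (\<lambda>_ S. S - (S o\<^sub>L S))"
  have S0: "S 0 = P" and Ss: "S (Suc n) = S n - (S n o\<^sub>L S n)" for n by (simp_all add: S_def)
  have inv: "self_adj (S n) \<and> commutes (S n) Q \<and> nonneg_op (S n) \<and> nonneg_op (id_blinfun - S n)" for n
  proof (induction n)
    case (Suc n)
    then have sa: "self_adj (S n)" "commutes (S n) Q" and pos: "nonneg_op (S n)" "nonneg_op (id_blinfun - S n)" by auto
    have "0 \<le> rinner u (S (Suc n) u)" for u
    proof -
      \<comment> \<open>With S for \<open>S n\<close>: S - SS = S (1 - S) S + (1 - S) S (1 - S), a
        sum of two manifestly positive operators.\<close>
      have "0 \<le> rinner (S n u) ((id_blinfun - S n) (S n u))" using pos unfolding nonneg_op_def by blast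
      moreover have "0 \<le> rinner (u - S n u) (S n (u - S n u))" using pos unfolding nonneg_op_def by blast
      ultimately show ?thesis
        using sa unfolding self_adj_def by (simp add: Ss blinfun.bilinear_simps rinner_simps)
    qed
    moreover have "0 \<le> rinner u ((id_blinfun - S (Suc n)) u)" for u
    proof -
      have "0 \<le> rinner u ((id_blinfun - S n) u)" using pos unfolding nonneg_op_def by blast
      then show ?thesis
        using sa rinner_self_nonneg[of "S n u"] unfolding self_adj_def by (simp add: Ss blinfun.bilinear_simps rinner_simps)
    qed
    ultimately show ?case
      using sa by (auto simp: nonneg_op_def) (auto simp: Ss intro!: self_adj_intros commutes_intros)
  qed (use assms S0 in auto)
  show ?thesis unfolding nonneg_op_def
  proof
    fix u
    have sq: "rinner u (S n (S n u)) = (norm (S n u))\<^sup>2" for n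
      using inv[of n] by (simp add: self_adj_def flip: rinner_self)
    \<comment> \<open>The iteration telescopes; boundedness of the partial sums forces
      \<open>S k u\<close> to tend to 0.\<close>
    have sm: "(\<Sum>k<n. (norm (S k u))\<^sup>2) = rinner u (P u) - rinner u (S n u)" for n
      by (induction n) (simp_all add: S0 Ss blinfun.bilinear_simps rinner_simps sq)
    have "summable (\<lambda>k. (norm (S k u))\<^sup>2)"
      by (rule summableI_nonneg_bounded[where x = "rinner u (P u)"])
         (use inv in \<open>auto simp: sm nonneg_op_def\<close>)
    then have "(\<lambda>k. sqrt ((norm (S k u))\<^sup>2)) \<longlonglongrightarrow> sqrt 0"
      by (intro tendsto_real_sqrt summable_LIMSEQ_zero)
    then have lim: "(\<lambda>k. S k u) \<longlonglongrightarrow> 0" by (simp add: tendsto_norm_zero_iff)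
    \<comment> \<open>Each iteration subtracts the quadratic form of Q at \<open>S n u\<close>, so
      these values decrease from n = 0 on. Their limit is 0, whence the value at n = 0 is
      nonnegative.\<close>
    have "rinner u (Q (S n u)) \<le> rinner u (Q (P u))" for n
    proof (induction n)
      case (Suc n)
      have "rinner u (Q (S n (S n u))) = rinner (S n u) (Q (S n u))"
        using inv[of n] by (simp add: commutes_def self_adj_def)
      also have "\<dots> \<ge> 0" using Q unfolding nonneg_op_def by blast
      finally show ?case using Suc by (simp add: Ss blinfun.bilinear_simps rinner_simps)
    qed (simp add: S0)
    moreover have "(\<lambda>n. rinner u (Q (S n u))) \<longlonglongrightarrow> rinner u (Q 0)"
      by (intro rinner.tendsto blinfun.tendsto tendsto_const lim)
    ultimately show "0 \<le> rinner u ((Q o\<^sub>L P) u)"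
      by (intro LIMSEQ_le_const2[of "\<lambda>n. rinner u (Q (S n u))"]) auto
  qed
qed

text \<open>Scaling by 1 / (norm P + 1) reduces to a contraction; the added 1 covers P = 0.\<close>

lemma nonneg_op_compose:
  assumes P: "self_adj P" "nonneg_op P" and Q: "nonneg_op Q" and PQ: "commutes P Q"
  shows "nonneg_op (P o\<^sub>L Q)"
proof -
  define r where "r = 1 / (norm P + 1)"
  have r: "r > 0" by (simp add: r_def add_nonneg_pos)
  have "nonneg_op (id_blinfun - r *\<^sub>R P)"
    unfolding nonneg_op_def
  proof
    fix u
    have "rinner u (P u) \<le> (norm P + 1) * rinner u u"
      using rinner_apply_le[of u P] rinner_self_nonneg[of u] by (simp add: algebra_simps)
    then show "0 \<le> rinner u ((id_blinfun - r *\<^sub>R P) u)"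
      by (simp add: r_def blinfun.bilinear_simps rinner_simps add_nonneg_pos pos_divide_le_eq mult.commute)
  qed
  then have "nonneg_op (Q o\<^sub>L (r *\<^sub>R P))"
    using r P Q PQ by (intro nonneg_op_compose_contraction) (auto intro: self_adj_intros nonneg_op_scaleR commutes_intros)
  then have "nonneg_op ((1 / r) *\<^sub>R (Q o\<^sub>L (r *\<^sub>R P)))" using r by (intro nonneg_op_scaleR) auto
  moreover have "(1 / r) *\<^sub>R (Q o\<^sub>L (r *\<^sub>R P)) = P o\<^sub>L Q"
    using r PQ by (intro blinfun_eqI) (simp add: blinfun.bilinear_simps commutes_def)
  ultimately show ?thesis by simp
qed

text \<open>The product (M - S)(M + S) of commuting positive operators is positive, and its
  quadratic form at u is the square of M * norm u minus the square of norm (S u).\<close>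

lemma norm_le_if_nonneg_op:
  assumes S: "self_adj S" and M: "M \<ge> 0" "nonneg_op (M *\<^sub>R id_blinfun - S)" "nonneg_op (M *\<^sub>R id_blinfun + S)"
  shows "norm S \<le> M"
proof (rule norm_blinfun_bound[OF M(1)])
  fix u
  have "nonneg_op ((M *\<^sub>R id_blinfun - S) o\<^sub>L (M *\<^sub>R id_blinfun + S))"
    using S M by (intro nonneg_op_compose self_adj_intros commutes_intros) auto
  then have "0 \<le> rinner u (((M *\<^sub>R id_blinfun - S) o\<^sub>L (M *\<^sub>R id_blinfun + S)) u)"
    unfolding nonneg_op_def by blast
  also have "\<dots> = M * M * rinner u u - rinner (S u) (S u)"
    using S by (simp add: self_adj_def blinfun.bilinear_simps rinner_simps algebra_simps)
  finally have "(norm (S u))\<^sup>2 \<le> (M * norm u)\<^sup>2"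
    by (simp add: rinner_self power_mult_distrib power2_eq_square mult_ac)
  then show "norm (S u) \<le> M * norm u"
    using M(1) by (meson mult_nonneg_nonneg norm_ge_zero power2_le_imp_le)
qed

section \<open>Bernstein operators\<close>

text \<open>\<open>bernstein X m F\<close> is \<open>\<Sum>k\<le>m. (m choose k) X\<^sup>k (1 - X)\<^sup>m\<^sup>-\<^sup>k F k\<close>.\<close>

primrec bernstein :: "('h::quaternionic_hilbert \<Rightarrow>\<^sub>L 'h) \<Rightarrow> nat \<Rightarrow> (nat \<Rightarrow> 'h \<Rightarrow>\<^sub>L 'h) \<Rightarrow> 'h \<Rightarrow>\<^sub>L 'h" where
  "bernstein X 0 F = F 0"
| "bernstein X (Suc m) F = (X o\<^sub>L bernstein X m (\<lambda>k. F (Suc k))) + ((id_blinfun - X) o\<^sub>L bernstein X m F)"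

lemma bern_add: "bernstein X m (\<lambda>k. F k + G k) = bernstein X m F + bernstein X m G"
proof (induction m arbitrary: F G)
  case (Suc m)
  show ?case
    unfolding bernstein.simps Suc.IH by (rule blinfun_eqI) (simp add: blinfun.bilinear_simps algebra_simps)
qed simp

lemma bern_scaleR: "bernstein X m (\<lambda>k. r *\<^sub>R F k) = r *\<^sub>R bernstein X m F"
proof (induction m arbitrary: F)
  case (Suc m)
  show ?case
    unfolding bernstein.simps Suc.IH by (rule blinfun_eqI) (simp add: blinfun.bilinear_simps algebra_simps)
qed simp

lemma bern_diff: "bernstein X m (\<lambda>k. F k - G k) = bernstein X m F - bernstein X m G"
  using bern_add[of X m F "\<lambda>k. (-1) *\<^sub>R G k"] unfolding bern_scaleR by simp

lemma bern_const: "bernstein X m (\<lambda>k. S) = S"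
  by (induction m) (auto intro!: blinfun_eqI simp: blinfun.bilinear_simps)

lemma bern_compose:
  assumes "commutes Q X" shows "bernstein X m (\<lambda>k. Q o\<^sub>L F k) = Q o\<^sub>L bernstein X m F"
proof (induction m arbitrary: F)
  case (Suc m)
  show ?case
    unfolding bernstein.simps Suc.IH using assms
    by (intro blinfun_eqI) (simp add: blinfun.bilinear_simps commutes_def)
qed simp

lemma bern_comm:
  assumes "commutes Q X" "\<And>k. commutes Q (F k)" shows "commutes Q (bernstein X m F)"
  using assms(2) by (induction m arbitrary: F) (auto intro!: commutes_intros assms(1))

lemma bern_self_adj:
  assumes "self_adj X" "\<And>k. commutes X (F k)" "\<And>k. self_adj (F k)" shows "self_adj (bernstein X m F)"
  using assms(2,3)
proof (induction m arbitrary: F)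
  case (Suc m)
  then show ?case
    by (auto intro!: self_adj_intros commutes_intros bern_comm Suc.IH assms(1))
qed simp

lemma bern_nonneg_op:
  assumes "self_adj X" "nonneg_op X" "nonneg_op (id_blinfun - X)"
    "\<And>k. commutes X (F k)" "\<And>k. self_adj (F k)" "\<And>k. k \<le> m \<Longrightarrow> nonneg_op (F k)"
  shows "nonneg_op (bernstein X m F)"
  using assms(4-)
proof (induction m arbitrary: F)
  case (Suc m)
  have "nonneg_op (bernstein X m (\<lambda>k. F (Suc k)))" by (rule Suc.IH) (use Suc.prems in auto)
  moreover have "nonneg_op (bernstein X m F)" by (rule Suc.IH) (use Suc.prems in auto)
  ultimately show ?case
    unfolding bernstein.simps
    by (intro nonneg_op_add nonneg_op_compose self_adj_intros commutes_intros bern_comm assms Suc.prems commutes_refl commutes_id)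
qed simp

text \<open>Operator version of k * (m+1 choose k) = (m+1) * (m choose k-1): weighting by the index
  extracts one factor X and shifts the coefficients.\<close>

lemma bern_index: "bernstein X (Suc m) (\<lambda>k. real k *\<^sub>R F k) = real (Suc m) *\<^sub>R (X o\<^sub>L bernstein X m (\<lambda>k. F (Suc k)))"
proof (induction m arbitrary: F)
  case 0
  show ?case by (rule blinfun_eqI) (simp add: blinfun.bilinear_simps)
next
  case (Suc m)
  have s: "(\<lambda>k. real (Suc k) *\<^sub>R F (Suc k)) = (\<lambda>k. real k *\<^sub>R F (Suc k) + F (Suc k))"
    by (simp add: algebra_simps)
  show ?case
    unfolding bernstein.simps(2)[of X "Suc m"] s bern_add Suc.IH
    by (rule blinfun_eqI) (simp add: blinfun.bilinear_simps algebra_simps scaleR_2)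
qed

text \<open>Multiplying the coefficients by their node differs from composing with X only by a term
  in first differences of the coefficients. For a finely sampled continuous function these are
  small.\<close>

lemma bern_coordinate:
  "bernstein X (Suc m) (\<lambda>k. (real k / real (Suc m)) *\<^sub>R F k) - (X o\<^sub>L bernstein X (Suc m) F) =
     (X o\<^sub>L (id_blinfun - X)) o\<^sub>L bernstein X m (\<lambda>k. F (Suc k) - F k)"
proof -
  have "bernstein X (Suc m) (\<lambda>k. (real k / real (Suc m)) *\<^sub>R F k) =
      bernstein X (Suc m) (\<lambda>k. (1 / real (Suc m)) *\<^sub>R (real k *\<^sub>R F k))"
    by (simp add: divide_inverse_commute)
  also have "\<dots> = X o\<^sub>L bernstein X m (\<lambda>k. F (Suc k))"
    unfolding bern_scaleR bern_index by simp
  finally show ?thesis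
    unfolding bernstein.simps(2)[of X m F] bern_diff
    by (simp only:) (rule blinfun_eqI, simp add: blinfun.bilinear_simps algebra_simps)
qed

section \<open>Functional calculus of two commuting self-adjoint operators\<close>

text \<open>A relation, since one polynomial function has many expressions; that the operator
  depends only on the function is a consequence of the norm bound below. Coordinates are multiplied
  on from outside one at a time, the form in which \<open>bern_coordinate\<close> can be
  iterated.\<close>

inductive poly_calc :: "('h::quaternionic_hilbert \<Rightarrow>\<^sub>L 'h) \<Rightarrow> ('h \<Rightarrow>\<^sub>L 'h) \<Rightarrow> (complex \<Rightarrow> real) \<Rightarrow> ('h \<Rightarrow>\<^sub>L 'h) \<Rightarrow> bool"
  for A B where
  calc_const: "poly_calc A B (\<lambda>_. c) (c *\<^sub>R id_blinfun)"
| calc_add: "poly_calc A B p S \<Longrightarrow> poly_calc A B q T \<Longrightarrow> poly_calc A B (\<lambda>z. p z + q z) (S + T)"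
| calc_Re: "poly_calc A B p S \<Longrightarrow> poly_calc A B (\<lambda>z. Re z * p z) (A o\<^sub>L S)"
| calc_Im: "poly_calc A B p S \<Longrightarrow> poly_calc A B (\<lambda>z. Im z * p z) (B o\<^sub>L S)"

lemma compose_id [simp]: "S o\<^sub>L id_blinfun = S" "id_blinfun o\<^sub>L S = S"
  by (auto intro: blinfun_eqI)

lemma calc_scaleR: "poly_calc A B p S \<Longrightarrow> poly_calc A B (\<lambda>z. c * p z) (c *\<^sub>R S)"
proof (induction rule: poly_calc.induct)
  case (calc_const c')
  then show ?case using poly_calc.calc_const[of A B "c * c'"] by simp
next
  case (calc_add p S q T)
  then show ?case using poly_calc.calc_add by (force simp: algebra_simps)
next
  case (calc_Re p S)
  have "c *\<^sub>R (A o\<^sub>L S) = A o\<^sub>L (c *\<^sub>R S)"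
    by (rule blinfun_eqI) (simp add: blinfun.bilinear_simps)
  then show ?case using poly_calc.calc_Re[OF calc_Re.IH] by (simp add: mult.left_commute)
next
  case (calc_Im p S)
  have "c *\<^sub>R (B o\<^sub>L S) = B o\<^sub>L (c *\<^sub>R S)"
    by (rule blinfun_eqI) (simp add: blinfun.bilinear_simps)
  then show ?case using poly_calc.calc_Im[OF calc_Im.IH] by (simp add: mult.left_commute)
qed

lemma calc_diff: "poly_calc A B p S \<Longrightarrow> poly_calc A B q T \<Longrightarrow> poly_calc A B (\<lambda>z. p z - q z) (S - T)"
  using calc_add[OF _ calc_scaleR[of A B q T "-1"]] by fastforce

lemma calc_mult: "poly_calc A B p S \<Longrightarrow> poly_calc A B q T \<Longrightarrow> poly_calc A B (\<lambda>z. p z * q z) (S o\<^sub>L T)"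
proof (induction rule: poly_calc.induct)
  case (calc_const c)
  have "(c *\<^sub>R id_blinfun) o\<^sub>L T = c *\<^sub>R T" by (rule blinfun_eqI) (simp add: blinfun.bilinear_simps)
  then show ?case using calc_scaleR[OF calc_const] by simp
next
  case (calc_add p S p' S')
  have "(S + S') o\<^sub>L T = (S o\<^sub>L T) + (S' o\<^sub>L T)" by (rule blinfun_eqI) (simp add: blinfun.bilinear_simps)
  then show ?case using poly_calc.calc_add[OF calc_add.IH(1)[OF calc_add.prems] calc_add.IH(2)[OF calc_add.prems]]
    by (simp add: algebra_simps)
next
  case (calc_Re p S)
  have "(A o\<^sub>L S) o\<^sub>L T = A o\<^sub>L (S o\<^sub>L T)" by (rule blinfun_eqI) simp
  then show ?case using poly_calc.calc_Re[OF calc_Re.IH[OF calc_Re.prems]] by (simp add: mult.assoc)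
next
  case (calc_Im p S)
  have "(B o\<^sub>L S) o\<^sub>L T = B o\<^sub>L (S o\<^sub>L T)" by (rule blinfun_eqI) simp
  then show ?case using poly_calc.calc_Im[OF calc_Im.IH[OF calc_Im.prems]] by (simp add: mult.assoc)
qed

lemma calc_coordinates: "poly_calc A B Re A" "poly_calc A B Im B"
  using calc_Re[OF calc_const, of A B 1] calc_Im[OF calc_const, of A B 1] by simp_all

lemma calc_continuous: "poly_calc A B p S \<Longrightarrow> continuous_on W p"
  by (induction rule: poly_calc.induct) (auto intro!: continuous_intros)

lemma calc_comm: "poly_calc A B p S \<Longrightarrow> commutes Q A \<Longrightarrow> commutes Q B \<Longrightarrow> commutes Q S"
  by (induction rule: poly_calc.induct) (auto intro!: commutes_intros)

lemma calc_qlin: "poly_calc A B p S \<Longrightarrow> A \<in> \<BB> \<Longrightarrow> B \<in> \<BB> \<Longrightarrow> S \<in> \<BB>"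
  by (induction rule: poly_calc.induct) auto

lemma calc_self_adj:
  assumes "poly_calc A B p S" "self_adj A" "self_adj B" "commutes A B" shows "self_adj S"
  using assms(1) by (induction rule: poly_calc.induct)
    (auto intro!: self_adj_intros assms intro: calc_comm[OF _ commutes_refl assms(4)] calc_comm[OF _ commutes_sym[OF assms(4)] commutes_refl])

lemma bern_between:
  assumes X: "self_adj X" "nonneg_op X" "nonneg_op (id_blinfun - X)"
    and F: "\<And>k. commutes X (F k)" "\<And>k. self_adj (F k)"
      "\<And>k. k \<le> m \<Longrightarrow> nonneg_op (M *\<^sub>R id_blinfun - F k)" "\<And>k. k \<le> m \<Longrightarrow> nonneg_op (M *\<^sub>R id_blinfun + F k)"
  shows "nonneg_op (M *\<^sub>R id_blinfun - bernstein X m F)" "nonneg_op (M *\<^sub>R id_blinfun + bernstein X m F)"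
proof -
  have "nonneg_op (bernstein X m (\<lambda>k. M *\<^sub>R id_blinfun - F k))"
    by (intro bern_nonneg_op X F commutes_intros self_adj_intros commutes_id)
  then show "nonneg_op (M *\<^sub>R id_blinfun - bernstein X m F)" by (simp add: bern_diff bern_const)
  have "nonneg_op (bernstein X m (\<lambda>k. M *\<^sub>R id_blinfun + F k))"
    by (intro bern_nonneg_op X F commutes_intros self_adj_intros commutes_id)
  then show "nonneg_op (M *\<^sub>R id_blinfun + bernstein X m F)" by (simp add: bern_add bern_const)
qed

text \<open>D is known here only through \<open>coercive\<close>: it contains the joint approximate
  spectrum of the pair. Points off D must then be invisible to the calculus.\<close>

locale commuting_pair =
  fixes A B :: "'h::quaternionic_hilbert \<Rightarrow>\<^sub>L 'h" and D :: "complex set"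
  assumes saA: "self_adj A" and saB: "self_adj B" and AB: "commutes A B"
    and coercive: "\<And>z. z \<notin> D \<Longrightarrow> \<exists>c>0. \<forall>u. c * rinner u u \<le>
      rinner (A u - Re z *\<^sub>R u) (A u - Re z *\<^sub>R u) + rinner (B u - Im z *\<^sub>R u) (B u - Im z *\<^sub>R u)"
begin

text \<open>X and Y are the affine images of A and B that lie between 0 and 1; \<open>grid\<close>
  is the inverse affine map at the Bernstein nodes k / (m+1), l / (m+1). The added 1 keeps r
  positive when A and B vanish.\<close>

definition r where "r = norm A + norm B + 1"
definition X where "X = (1/2) *\<^sub>R (id_blinfun + (1/r) *\<^sub>R A)"
definition Y where "Y = (1/2) *\<^sub>R (id_blinfun + (1/r) *\<^sub>R B)"
definition grid where
  "grid m k l = Complex (r * (2 * (real k / real (Suc m)) - 1)) (r * (2 * (real l / real (Suc m)) - 1))"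
text \<open>The Bernstein polynomial of \<open>\<psi>\<close> on the square \<open>box\<close>, evaluated at \<open>(A, B)\<close>.\<close>

definition E where
  "E m \<psi> = bernstein X (Suc m) (\<lambda>k. bernstein Y (Suc m) (\<lambda>l. \<psi> (grid m k l) *\<^sub>R id_blinfun))"
definition box where "box = cbox (Complex (-r) (-r)) (Complex r r)"

lemma r_pos: "r > 0" by (simp add: r_def add_nonneg_pos)

lemma contraction:
  assumes "self_adj S" "norm S \<le> r"
  shows "self_adj ((1/2) *\<^sub>R (id_blinfun + (1/r) *\<^sub>R S))" "nonneg_op ((1/2) *\<^sub>R (id_blinfun + (1/r) *\<^sub>R S))"
    "nonneg_op (id_blinfun - (1/2) *\<^sub>R (id_blinfun + (1/r) *\<^sub>R S))"
proof -
  show "self_adj ((1/2) *\<^sub>R (id_blinfun + (1/r) *\<^sub>R S))" using assms by (intro self_adj_intros)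
  have "\<bar>rinner u (S u)\<bar> \<le> r * rinner u u" for u
    using rinner_apply_le[of u S] mult_right_mono[OF assms(2) rinner_self_nonneg[of u]] by linarith
  then have b: "\<bar>rinner u (S u) / r\<bar> \<le> rinner u u" for u
    using r_pos by (simp add: abs_divide pos_divide_le_eq mult.commute)
  have "0 \<le> rinner u u + rinner u (S u) / r" "rinner u (S u) / r \<le> rinner u u" for u
    using abs_le_D1[OF b[of u]] abs_le_D2[OF b[of u]] by linarith+
  then show "nonneg_op ((1/2) *\<^sub>R (id_blinfun + (1/r) *\<^sub>R S))"
    "nonneg_op (id_blinfun - (1/2) *\<^sub>R (id_blinfun + (1/r) *\<^sub>R S))"
    by (auto simp: nonneg_op_def blinfun.bilinear_simps rinner_simps)
qed

lemma X: "self_adj X" "nonneg_op X" "nonneg_op (id_blinfun - X)" and Y: "self_adj Y" "nonneg_op Y" "nonneg_op (id_blinfun - Y)"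
  using contraction[OF saA] contraction[OF saB] by (simp_all add: X_def Y_def r_def)

lemma comm_XY: "commutes Q A \<Longrightarrow> commutes Q X" "commutes Q B \<Longrightarrow> commutes Q Y"
  by (auto simp: X_def Y_def intro!: commutes_intros)

lemma comm_X_Y: "commutes X Y"
  by (rule comm_XY, rule commutes_sym, rule comm_XY, rule commutes_sym, rule AB)

lemma grid_box: "k \<le> Suc m \<Longrightarrow> l \<le> Suc m \<Longrightarrow> grid m k l \<in> box"
  using r_pos by (auto simp: grid_def box_def in_cbox_complex_iff)
     (auto simp: field_simps)

lemma E_inner_comm: "commutes Q B \<Longrightarrow> commutes Q (bernstein Y n (\<lambda>l. g l *\<^sub>R id_blinfun))"
  by (intro bern_comm comm_XY commutes_intros commutes_id)

lemma E_inner_comm_X: "commutes X (bernstein Y n (\<lambda>l. g l *\<^sub>R id_blinfun))"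
  by (intro bern_comm comm_X_Y commutes_intros commutes_id)

lemma E_inner_self_adj: "self_adj (bernstein Y n (\<lambda>l. g l *\<^sub>R id_blinfun))"
  by (intro bern_self_adj Y commutes_intros commutes_id self_adj_intros)

lemma E_comm: "commutes Q A \<Longrightarrow> commutes Q B \<Longrightarrow> commutes Q (E m \<psi>)"
  unfolding E_def by (intro bern_comm comm_XY E_inner_comm)

lemma E_self_adj: "self_adj (E m \<psi>)"
  unfolding E_def by (intro bern_self_adj X E_inner_comm_X E_inner_self_adj)

lemma E_nonneg: "(\<And>z. z \<in> box \<Longrightarrow> 0 \<le> \<psi> z) \<Longrightarrow> nonneg_op (E m \<psi>)"
  unfolding E_def
  by (intro bern_nonneg_op X Y E_inner_comm_X E_inner_self_adj commutes_intros commutes_id self_adj_intros nonneg_op_scaleR nonneg_op_id)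
     (auto simp: grid_box)

lemma E_add: "E m (\<lambda>z. \<phi> z + \<psi> z) = E m \<phi> + E m \<psi>"
  by (simp add: E_def scaleR_add_left bern_add)

lemma E_scaleR: "E m (\<lambda>z. c * \<psi> z) = c *\<^sub>R E m \<psi>"
  by (simp add: E_def bern_scaleR flip: scaleR_scaleR)

lemma E_diff: "E m (\<lambda>z. \<phi> z - \<psi> z) = E m \<phi> - E m \<psi>"
  using E_add[of m \<phi> "\<lambda>z. (-1) * \<psi> z"] E_scaleR[of m "-1" \<psi>] by simp

lemma E_const: "E m (\<lambda>z. c) = c *\<^sub>R id_blinfun"
  by (simp add: E_def bern_const)

lemma E_sum: "finite I \<Longrightarrow> E m (\<lambda>z. \<Sum>i\<in>I. g i z) = (\<Sum>i\<in>I. E m (g i))"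
  by (induction rule: finite_induct) (simp_all add: E_add E_const)

lemma E_le:
  assumes "\<And>z. z \<in> box \<Longrightarrow> \<phi> z \<le> \<psi> z" shows "rinner u (E m \<phi> u) \<le> rinner u (E m \<psi> u)"
proof -
  have "nonneg_op (E m (\<lambda>z. \<psi> z - \<phi> z))" by (rule E_nonneg) (simp add: assms)
  then have "0 \<le> rinner u (E m (\<lambda>z. \<psi> z - \<phi> z) u)" unfolding nonneg_op_def by blast
  then show ?thesis by (simp add: E_diff blinfun.bilinear_simps rinner_simps)
qed

lemma nonneg_op_scalar: "\<bar>c\<bar> \<le> e \<Longrightarrow> nonneg_op (e *\<^sub>R id_blinfun - c *\<^sub>R id_blinfun)"
    "\<bar>c\<bar> \<le> e \<Longrightarrow> nonneg_op (e *\<^sub>R id_blinfun + c *\<^sub>R id_blinfun)"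
  by (simp_all add: nonneg_op_scaleR flip: scaleR_diff_left scaleR_add_left)

text \<open>Bernstein operators preserve order and reproduce constants, so bounds for the
  coefficients pass to the operator.\<close>

lemma double_bern_norm:
  assumes "\<And>k l. k \<le> m \<Longrightarrow> l \<le> n \<Longrightarrow> \<bar>g k l\<bar> \<le> e" "0 \<le> e"
  shows "norm (bernstein X m (\<lambda>k. bernstein Y n (\<lambda>l. g k l *\<^sub>R id_blinfun))) \<le> e"
  by (intro norm_le_if_nonneg_op bern_self_adj X Y E_inner_comm_X E_inner_self_adj bern_between commutes_intros commutes_id self_adj_intros
      nonneg_op_scalar assms)

text \<open>\<open>2 * r / real (Suc m)\<close> is the distance of neighbouring grid points.\<close>

lemma uniform_continuity:
  assumes "continuous_on UNIV \<psi>" "e > 0"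
  shows "\<forall>\<^sub>F m in sequentially. \<forall>z\<in>box. \<forall>w\<in>box. dist z w \<le> 2 * r / real (Suc m) \<longrightarrow> \<bar>\<psi> z - \<psi> w\<bar> \<le> (e::real)"
proof -
  have "uniformly_continuous_on box \<psi>"
    unfolding box_def by (intro compact_uniformly_continuous compact_cbox continuous_on_subset[OF assms(1)]) auto
  then obtain d where d: "d > 0" "\<And>z w. z \<in> box \<Longrightarrow> w \<in> box \<Longrightarrow> dist z w < d \<Longrightarrow> dist (\<psi> z) (\<psi> w) < e"
    using assms(2) unfolding uniformly_continuous_on_def by metis
  have "(\<lambda>m. 2 * r * (1 / real (Suc m))) \<longlonglongrightarrow> 2 * r * 0"
    by (intro tendsto_intros LIMSEQ_Suc[OF lim_1_over_n])
  then have "\<forall>\<^sub>F m in sequentially. 2 * r * (1 / real (Suc m)) < d"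
    using d(1) by (auto dest: order_tendstoD)
  then show ?thesis
    by eventually_elim (use d(2) in \<open>fastforce simp: dist_real_def intro: less_imp_le\<close>)
qed

text \<open>Both A = r (2 X - 1) and the node r (2 k / (m+1) - 1) carry the same constant part,
  which cancels; 2 r times the defect of \<open>bern_coordinate\<close> remains.\<close>

lemma E_Re_eq:
  "E m (\<lambda>z. Re z * \<psi> z) - (A o\<^sub>L E m \<psi>) = (2 * r) *\<^sub>R ((X o\<^sub>L (id_blinfun - X)) o\<^sub>L
     bernstein X m (\<lambda>k. bernstein Y (Suc m) (\<lambda>l. (\<psi> (grid m (Suc k) l) - \<psi> (grid m k l)) *\<^sub>R id_blinfun)))"
proof -
  define F where "F k = bernstein Y (Suc m) (\<lambda>l. \<psi> (grid m k l) *\<^sub>R id_blinfun)" for k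
  have "(Re (grid m k l) * \<psi> (grid m k l)) *\<^sub>R (id_blinfun :: 'h \<Rightarrow>\<^sub>L 'h) =
      (2 * r) *\<^sub>R ((real k / real (Suc m)) *\<^sub>R (\<psi> (grid m k l) *\<^sub>R id_blinfun)) - r *\<^sub>R (\<psi> (grid m k l) *\<^sub>R id_blinfun)"
    for k l
    unfolding scaleR_scaleR scaleR_diff_left[symmetric]
    by (rule arg_cong[where f = "\<lambda>c. c *\<^sub>R id_blinfun"]) (simp add: grid_def algebra_simps)
  then have "E m (\<lambda>z. Re z * \<psi> z) =
    (2 * r) *\<^sub>R bernstein X (Suc m) (\<lambda>k. (real k / real (Suc m)) *\<^sub>R F k) - r *\<^sub>R bernstein X (Suc m) F"
    unfolding E_def F_def bern_scaleR[symmetric] bern_diff[symmetric] by (simp only:)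
  moreover have "A o\<^sub>L E m \<psi> = (2 * r) *\<^sub>R (X o\<^sub>L bernstein X (Suc m) F) - r *\<^sub>R bernstein X (Suc m) F"
    unfolding E_def F_def[symmetric] using r_pos
    by (intro blinfun_eqI) (simp add: X_def blinfun.bilinear_simps algebra_simps)
  ultimately have "E m (\<lambda>z. Re z * \<psi> z) - (A o\<^sub>L E m \<psi>) =
    (2 * r) *\<^sub>R (bernstein X (Suc m) (\<lambda>k. (real k / real (Suc m)) *\<^sub>R F k) - (X o\<^sub>L bernstein X (Suc m) F))"
    by (simp only: scaleR_diff_right diff_diff_eq2 add_diff_cancel diff_add_cancel)
  then show ?thesis
    unfolding bern_coordinate F_def by (simp only: scaleR_diff_left bern_diff)
qed

lemma E_Im_eq:
  "E m (\<lambda>z. Im z * \<psi> z) - (B o\<^sub>L E m \<psi>) = (2 * r) *\<^sub>R ((Y o\<^sub>L (id_blinfun - Y)) o\<^sub>L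
     bernstein X (Suc m) (\<lambda>k. bernstein Y m (\<lambda>l. (\<psi> (grid m k (Suc l)) - \<psi> (grid m k l)) *\<^sub>R id_blinfun)))"
proof -
  define F where "F k l = \<psi> (grid m k l) *\<^sub>R (id_blinfun :: 'h \<Rightarrow>\<^sub>L 'h)" for k l
  have "(Im (grid m k l) * \<psi> (grid m k l)) *\<^sub>R id_blinfun =
      (2 * r) *\<^sub>R ((real l / real (Suc m)) *\<^sub>R F k l) - r *\<^sub>R F k l"
    for k l
    unfolding scaleR_scaleR scaleR_diff_left[symmetric] F_def
    by (rule arg_cong[where f = "\<lambda>c. c *\<^sub>R id_blinfun"]) (simp add: grid_def algebra_simps)
  then have "E m (\<lambda>z. Im z * \<psi> z) =
    bernstein X (Suc m) (\<lambda>k. (2 * r) *\<^sub>R bernstein Y (Suc m) (\<lambda>l. (real l / real (Suc m)) *\<^sub>R F k l) - r *\<^sub>R bernstein Y (Suc m) (F k))"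
    unfolding E_def by (simp only: bern_diff bern_scaleR)
  \<comment> \<open>The imaginary coordinate belongs to the inner Bernstein sum, so B has to be
    pulled through the outer one, which is possible because it commutes with X.\<close>
  moreover have "B o\<^sub>L E m \<psi> = bernstein X (Suc m) (\<lambda>k. B o\<^sub>L bernstein Y (Suc m) (F k))"
    unfolding E_def F_def by (rule bern_compose[symmetric]) (rule comm_XY, rule commutes_sym, rule AB)
  moreover have BS: "B o\<^sub>L S = (2 * r) *\<^sub>R (Y o\<^sub>L S) - r *\<^sub>R S" for S :: "'h \<Rightarrow>\<^sub>L 'h"
    using r_pos by (intro blinfun_eqI) (simp add: Y_def blinfun.bilinear_simps algebra_simps)
  ultimately have "E m (\<lambda>z. Im z * \<psi> z) - (B o\<^sub>L E m \<psi>) = bernstein X (Suc m)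
    (\<lambda>k. (2 * r) *\<^sub>R bernstein Y (Suc m) (\<lambda>l. (real l / real (Suc m)) *\<^sub>R F k l) - r *\<^sub>R bernstein Y (Suc m) (F k)
      - (B o\<^sub>L bernstein Y (Suc m) (F k)))"
    by (simp only: bern_diff)
  also have "\<dots> = bernstein X (Suc m)
    (\<lambda>k. (2 * r) *\<^sub>R (bernstein Y (Suc m) (\<lambda>l. (real l / real (Suc m)) *\<^sub>R F k l) - (Y o\<^sub>L bernstein Y (Suc m) (F k))))"
    unfolding BS by (simp only: scaleR_diff_right diff_diff_eq2 add_diff_cancel diff_add_cancel)
  also have "\<dots> = (2 * r) *\<^sub>R bernstein X (Suc m)
     (\<lambda>k. (Y o\<^sub>L (id_blinfun - Y)) o\<^sub>L bernstein Y m (\<lambda>l. F k (Suc l) - F k l))"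
    unfolding bern_coordinate bern_scaleR ..
  also have "bernstein X (Suc m) (\<lambda>k. (Y o\<^sub>L (id_blinfun - Y)) o\<^sub>L bernstein Y m (\<lambda>l. F k (Suc l) - F k l)) =
     (Y o\<^sub>L (id_blinfun - Y)) o\<^sub>L bernstein X (Suc m) (\<lambda>k. bernstein Y m (\<lambda>l. F k (Suc l) - F k l))"
    by (rule bern_compose) (intro commutes_intros commutes_id commutes_sym[OF comm_X_Y])
  finally show ?thesis unfolding F_def by (simp only: scaleR_diff_left)
qed

lemma norm_compose_small:
  assumes "norm S \<le> e" shows "norm ((2 * r) *\<^sub>R (Q o\<^sub>L S)) \<le> 2 * r * norm Q * e"
proof -
  have "norm (Q o\<^sub>L S) \<le> norm Q * e"
    using norm_blinfun_compose[of Q S] mult_left_mono[OF assms norm_ge_zero[of Q]] by linarith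
  then show ?thesis using r_pos by (simp add: mult.assoc)
qed

text \<open>The defect is a double Bernstein operator whose coefficients are first differences
  between neighbouring nodes; uniform continuity on the box makes all of them small at once.\<close>

lemma E_coordinate_tendsto:
  assumes c: "continuous_on UNIV \<psi>"
  shows "(\<lambda>m. E m (\<lambda>z. Re z * \<psi> z) - (A o\<^sub>L E m \<psi>)) \<longlonglongrightarrow> 0"
    "(\<lambda>m. E m (\<lambda>z. Im z * \<psi> z) - (B o\<^sub>L E m \<psi>)) \<longlonglongrightarrow> 0"
proof -
  have aux: "f \<longlonglongrightarrow> 0" if ev: "\<And>e. e > 0 \<Longrightarrow> \<forall>\<^sub>F m in sequentially. norm (f m) \<le> 2 * r * norm Q * e"
    for f :: "nat \<Rightarrow> 'h \<Rightarrow>\<^sub>L 'h" and Q :: "'h \<Rightarrow>\<^sub>L 'h"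
  proof (rule tendstoI)
    fix e :: real assume e: "e > 0"
    \<comment> \<open>The added 1 avoids a zero denominator and makes the final inequality
      strict.\<close>
    define d where "d = e / (2 * r * norm Q + 1)"
    have pos: "2 * r * norm Q + 1 > 0" using r_pos by (simp add: add_nonneg_pos)
    then have d: "d > 0" "2 * r * norm Q * d < e"
      using e by (simp_all add: d_def field_simps)
    show "\<forall>\<^sub>F m in sequentially. dist (f m) 0 < e"
      using ev[OF d(1)] by eventually_elim (use d in auto)
  qed
  have dg: "dist (grid m (Suc k) l) (grid m k l) \<le> 2 * r / real (Suc m)"
    "dist (grid m k (Suc l)) (grid m k l) \<le> 2 * r / real (Suc m)" for m k l
  proof -
    have "grid m (Suc k) l - grid m k l = of_real (2 * r / real (Suc m))"
      by (simp add: grid_def complex_eq_iff flip: right_diff_distrib diff_divide_distrib)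
    then show "dist (grid m (Suc k) l) (grid m k l) \<le> 2 * r / real (Suc m)"
      using r_pos by (simp only: dist_norm norm_of_real) simp
    have "grid m k (Suc l) - grid m k l = \<i> * of_real (2 * r / real (Suc m))"
      by (simp add: grid_def complex_eq_iff flip: right_diff_distrib diff_divide_distrib)
    then show "dist (grid m k (Suc l)) (grid m k l) \<le> 2 * r / real (Suc m)"
      using r_pos by (simp only: dist_norm norm_of_real norm_mult) simp
  qed
  show "(\<lambda>m. E m (\<lambda>z. Re z * \<psi> z) - (A o\<^sub>L E m \<psi>)) \<longlonglongrightarrow> 0"
  proof (rule aux)
    fix e :: real assume e: "e > 0"
    show "\<forall>\<^sub>F m in sequentially. norm (E m (\<lambda>z. Re z * \<psi> z) - (A o\<^sub>L E m \<psi>)) \<le> 2 * r * norm (X o\<^sub>L (id_blinfun - X)) * e"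
      using uniform_continuity[OF c e]
    proof eventually_elim
      case (elim m)
      show ?case unfolding E_Re_eq
      proof (intro norm_compose_small double_bern_norm)
        fix k l assume kl: "k \<le> m" "l \<le> Suc m"
        show "\<bar>\<psi> (grid m (Suc k) l) - \<psi> (grid m k l)\<bar> \<le> e"
          using elim dg(1)[of m k l] kl by (simp add: grid_box)
      qed (use e in simp)
    qed
  qed
  show "(\<lambda>m. E m (\<lambda>z. Im z * \<psi> z) - (B o\<^sub>L E m \<psi>)) \<longlonglongrightarrow> 0"
  proof (rule aux)
    fix e :: real assume e: "e > 0"
    show "\<forall>\<^sub>F m in sequentially. norm (E m (\<lambda>z. Im z * \<psi> z) - (B o\<^sub>L E m \<psi>)) \<le> 2 * r * norm (Y o\<^sub>L (id_blinfun - Y)) * e"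
      using uniform_continuity[OF c e]
    proof eventually_elim
      case (elim m)
      show ?case unfolding E_Im_eq
      proof (intro norm_compose_small double_bern_norm)
        fix k l assume kl: "k \<le> Suc m" "l \<le> m"
        show "\<bar>\<psi> (grid m k (Suc l)) - \<psi> (grid m k l)\<bar> \<le> e"
          using elim dg(2)[of m k l] kl by (simp add: grid_box)
      qed (use e in simp)
    qed
  qed
qed

lemma tendsto_compose_zero: "f \<longlonglongrightarrow> 0 \<Longrightarrow> (\<lambda>m. Q o\<^sub>L f m) \<longlonglongrightarrow> 0" for f :: "nat \<Rightarrow> 'h \<Rightarrow>\<^sub>L 'h"
  using bounded_bilinear.tendsto[OF bounded_bilinear_blinfun_compose tendsto_const, of f 0 sequentially Q] by simp

text \<open>Asymptotic multiplicativity. The induction peels off one coordinate and applies the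
  coordinate estimate to the continuous function p \<psi>; a general \<psi> is kept because bump
  functions are inserted for it.\<close>

lemma E_calc_tendsto:
  assumes "poly_calc A B p S" "continuous_on UNIV \<psi>"
  shows "(\<lambda>m. E m (\<lambda>z. p z * \<psi> z) - (S o\<^sub>L E m \<psi>)) \<longlonglongrightarrow> 0"
  using assms(1)
proof (induction rule: poly_calc.induct)
  case (calc_const c)
  have "E m (\<lambda>z. c * \<psi> z) - ((c *\<^sub>R id_blinfun) o\<^sub>L E m \<psi>) = 0" for m
    unfolding E_scaleR by (rule blinfun_eqI) (simp add: blinfun.bilinear_simps)
  then show ?case by simp
next
  case (calc_add p S q T)
  have "(E m (\<lambda>z. p z * \<psi> z) - (S o\<^sub>L E m \<psi>)) + (E m (\<lambda>z. q z * \<psi> z) - (T o\<^sub>L E m \<psi>)) =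
     E m (\<lambda>z. (p z + q z) * \<psi> z) - ((S + T) o\<^sub>L E m \<psi>)" for m
    unfolding distrib_right E_add by (rule blinfun_eqI) (simp add: blinfun.bilinear_simps)
  with tendsto_add[OF calc_add.IH] show ?case by simp
next
  case (calc_Re p S)
  have "(E m (\<lambda>z. Re z * (p z * \<psi> z)) - (A o\<^sub>L E m (\<lambda>z. p z * \<psi> z))) + (A o\<^sub>L (E m (\<lambda>z. p z * \<psi> z) - (S o\<^sub>L E m \<psi>)))
     = E m (\<lambda>z. Re z * p z * \<psi> z) - ((A o\<^sub>L S) o\<^sub>L E m \<psi>)" for m
    unfolding mult.assoc by (rule blinfun_eqI) (simp add: blinfun.bilinear_simps)
  moreover have "continuous_on UNIV (\<lambda>z. p z * \<psi> z)"
    by (intro continuous_intros assms calc_continuous[OF calc_Re.hyps])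
  ultimately show ?case
    using tendsto_add[OF E_coordinate_tendsto(1)[of "\<lambda>z. p z * \<psi> z"] tendsto_compose_zero[OF calc_Re.IH, of A]] by simp
next
  case (calc_Im p S)
  have "(E m (\<lambda>z. Im z * (p z * \<psi> z)) - (B o\<^sub>L E m (\<lambda>z. p z * \<psi> z))) + (B o\<^sub>L (E m (\<lambda>z. p z * \<psi> z) - (S o\<^sub>L E m \<psi>)))
     = E m (\<lambda>z. Im z * p z * \<psi> z) - ((B o\<^sub>L S) o\<^sub>L E m \<psi>)" for m
    unfolding mult.assoc by (rule blinfun_eqI) (simp add: blinfun.bilinear_simps)
  moreover have "continuous_on UNIV (\<lambda>z. p z * \<psi> z)"
    by (intro continuous_intros assms calc_continuous[OF calc_Im.hyps])
  ultimately show ?case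
    using tendsto_add[OF E_coordinate_tendsto(2)[of "\<lambda>z. p z * \<psi> z"] tendsto_compose_zero[OF calc_Im.IH, of B]] by simp
qed

lemma E_calc: "poly_calc A B p S \<Longrightarrow> (\<lambda>m. E m p) \<longlonglongrightarrow> S"
  using E_calc_tendsto[of p S "\<lambda>_. 1"] by (simp add: E_const LIM_zero_iff)


text \<open>Let h be the squared distance to z0 and H the operator assigned to it. Coercivity says H
  \<ge> c, so H composed with \<open>E m b\<close> dominates c times \<open>E m b\<close>. On the
  support of b one has h \<le> c / 2, so the operator of h b is at most c / 2 times
  \<open>E m b\<close>. The two agree up to an error tending to 0, which squeezes
  \<open>E m b\<close> to 0.\<close>

lemma E_bump:
  assumes "z0 \<notin> D"
  shows "\<exists>b. continuous_on UNIV b \<and> (\<forall>z. 0 \<le> b z) \<and> 0 < b z0 \<and> (\<lambda>m. E m b) \<longlonglongrightarrow> 0"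
proof -
  obtain c where c: "c > 0" "\<And>u. c * rinner u u \<le>
      rinner (A u - Re z0 *\<^sub>R u) (A u - Re z0 *\<^sub>R u) + rinner (B u - Im z0 *\<^sub>R u) (B u - Im z0 *\<^sub>R u)"
    using coercive[OF assms] by blast
  define h where "h z = (Re z - Re z0) * (Re z - Re z0) + (Im z - Im z0) * (Im z - Im z0)" for z
  define SA where "SA = A - Re z0 *\<^sub>R id_blinfun"
  define SB where "SB = B - Im z0 *\<^sub>R id_blinfun"
  define H where "H = (SA o\<^sub>L SA) + (SB o\<^sub>L SB)"
  have calcH: "poly_calc A B h H"
    unfolding h_def H_def SA_def SB_def
    by (intro calc_add calc_mult calc_diff calc_const calc_coordinates)
  \<comment> \<open>Cutting off at half the coercivity constant leaves the gap c / 2 that drives the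
    estimate \<open>key\<close>.\<close>
  define b where "b z = max 0 (c / 2 - h z)" for z
  have cb: "continuous_on UNIV b" unfolding b_def h_def by (intro continuous_intros)
  have b0: "0 \<le> b z" for z by (simp add: b_def)
  have hb: "h z * b z \<le> (c / 2) * b z" for z
  proof (cases "h z \<le> c / 2")
    case True
    then show ?thesis by (rule mult_right_mono[OF _ b0])
  qed (simp add: b_def)
  define \<Delta> where "\<Delta> m = E m (\<lambda>z. h z * b z) - (H o\<^sub>L E m b)" for m
  have \<Delta>0: "\<Delta> \<longlonglongrightarrow> 0" unfolding \<Delta>_def by (rule E_calc_tendsto[OF calcH cb])
  have sa: "self_adj SA" "self_adj SB" unfolding SA_def SB_def by (intro self_adj_intros saA saB)+
  have Hc: "nonneg_op (H - c *\<^sub>R id_blinfun)"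
    unfolding nonneg_op_def
  proof
    fix u
    have "rinner u (H u) = rinner (SA u) (SA u) + rinner (SB u) (SB u)"
      using sa by (simp add: H_def blinfun.bilinear_simps rinner_simps self_adj_def)
    also have "\<dots> \<ge> c * rinner u u"
      using c(2)[of u] by (simp add: SA_def SB_def blinfun.bilinear_simps)
    finally show "0 \<le> rinner u ((H - c *\<^sub>R id_blinfun) u)" by (simp add: blinfun.bilinear_simps rinner_simps)
  qed
  have key: "(c / 2) * rinner u (E m b u) \<le> norm (\<Delta> m) * rinner u u" for u m
  proof -
    have "self_adj (H - c *\<^sub>R id_blinfun)"
      by (intro self_adj_intros calc_self_adj[OF calcH] saA saB AB)
    moreover have "commutes (H - c *\<^sub>R id_blinfun) (E m b)"
      by (intro commutes_intros commutes_id)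
         (rule commutes_sym, rule calc_comm[OF calcH]; rule commutes_sym; rule E_comm; simp add: AB commutes_sym[OF AB])
    ultimately have "nonneg_op ((H - c *\<^sub>R id_blinfun) o\<^sub>L E m b)"
      by (intro nonneg_op_compose Hc E_nonneg b0)
    then have "0 \<le> rinner u (((H - c *\<^sub>R id_blinfun) o\<^sub>L E m b) u)" unfolding nonneg_op_def by blast
    then have "c * rinner u (E m b u) \<le> rinner u (H (E m b u))"
      by (simp add: blinfun.bilinear_simps rinner_simps)
    moreover have "rinner u (E m (\<lambda>z. h z * b z) u) \<le> rinner u (E m (\<lambda>z. (c/2) * b z) u)"
      by (rule E_le) (rule hb)
    then have "rinner u (E m (\<lambda>z. h z * b z) u) \<le> (c/2) * rinner u (E m b u)"
      unfolding E_scaleR by (simp add: blinfun.bilinear_simps rinner_simps)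
    moreover have "- rinner u (\<Delta> m u) \<le> norm (\<Delta> m) * rinner u u"
      using rinner_apply_le[of u "\<Delta> m"] by linarith
    ultimately show ?thesis by (simp add: \<Delta>_def blinfun.bilinear_simps rinner_simps)
  qed
  have "norm (E m b) \<le> (2 / c) * norm (\<Delta> m)" for m
  proof (rule norm_le_if_nonneg_op)
    have En: "nonneg_op (E m b)" by (rule E_nonneg) (rule b0)
    show "0 \<le> (2 / c) * norm (\<Delta> m)" using c(1) by simp
    then show "nonneg_op (((2 / c) * norm (\<Delta> m)) *\<^sub>R id_blinfun + E m b)"
      by (intro nonneg_op_add nonneg_op_scaleR nonneg_op_id En)
    show "nonneg_op (((2 / c) * norm (\<Delta> m)) *\<^sub>R id_blinfun - E m b)"
      unfolding nonneg_op_def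
    proof
      fix u
      have "rinner u (E m b u) \<le> (2 / c) * norm (\<Delta> m) * rinner u u"
        using key[of u m] c(1) by (simp add: field_simps)
      then show "0 \<le> rinner u ((((2 / c) * norm (\<Delta> m)) *\<^sub>R id_blinfun - E m b) u)"
        by (simp add: blinfun.bilinear_simps rinner_simps)
    qed
  qed (rule E_self_adj)
  moreover have "(\<lambda>m. (2 / c) * norm (\<Delta> m)) \<longlonglongrightarrow> 0"
    using tendsto_mult_left[OF tendsto_norm[OF \<Delta>0], of "2 / c"] by simp
  ultimately have "(\<lambda>m. E m b) \<longlonglongrightarrow> 0"
    by (intro Lim_null_comparison[of "\<lambda>m. E m b"] always_eventually allI)
  moreover have "b z0 > 0" using c(1) by (simp add: b_def h_def)
  ultimately show ?thesis using cb b0 by blast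
qed

text \<open>The part K of the box where p \<ge> M + e misses D, so by compactness finitely many
  bumps with sum \<beta> cover it, and p \<le> M + e + C \<beta> on the whole box. Positivity of E
  and the vanishing of the bumps in the limit leave S \<le> M + e.\<close>

lemma calc_upper_bound:
  assumes p: "poly_calc A B p S" and M: "\<And>z. z \<in> D \<Longrightarrow> p z \<le> M"
  shows "nonneg_op (M *\<^sub>R id_blinfun - S)"
proof -
  have "nonneg_op ((M + e) *\<^sub>R id_blinfun - S)" if e: "e > 0" for e
  proof -
    have cp: "continuous_on W p" for W by (rule calc_continuous[OF p])
    define K where "K = {z \<in> box. M + e \<le> p z}"
    have cK: "compact K"
    proof -
      have "K = box \<inter> {z. M + e \<le> p z}" by (auto simp: K_def)
      moreover have "closed {z. M + e \<le> p z}" by (intro closed_Collect_le continuous_intros cp)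
      ultimately show ?thesis unfolding box_def by (simp add: compact_Int_closed)
    qed
    have "\<forall>z\<in>K. \<exists>b. continuous_on UNIV b \<and> (\<forall>z. 0 \<le> b z) \<and> 0 < b z \<and> (\<lambda>m. E m b) \<longlonglongrightarrow> 0"
    proof
      fix z assume "z \<in> K"
      then have "z \<notin> D" using M[of z] e by (auto simp: K_def)
      then show "\<exists>b. continuous_on UNIV b \<and> (\<forall>z. 0 \<le> b z) \<and> 0 < b z \<and> (\<lambda>m. E m b) \<longlonglongrightarrow> 0"
        by (rule E_bump)
    qed
    then obtain b where b': "\<forall>z\<in>K. continuous_on UNIV (b z) \<and> (\<forall>w. 0 \<le> b z w) \<and> 0 < b z z \<and> (\<lambda>m. E m (b z)) \<longlonglongrightarrow> 0"
      by (rule bchoice[THEN exE])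
    have b: "\<And>z. z \<in> K \<Longrightarrow> continuous_on UNIV (b z)" "\<And>z w. z \<in> K \<Longrightarrow> 0 \<le> b z w"
        "\<And>z. z \<in> K \<Longrightarrow> 0 < b z z" "\<And>z. z \<in> K \<Longrightarrow> (\<lambda>m. E m (b z)) \<longlonglongrightarrow> 0"
      using b' by simp_all
    have op: "open {w. 0 < b z w}" if "z \<in> K" for z
      by (intro open_Collect_less continuous_intros b that)
    obtain F where F: "F \<subseteq> K" "finite F" "K \<subseteq> (\<Union>z\<in>F. {w. 0 < b z w})"
    proof (rule compactE_image[OF cK, of K "\<lambda>z. {w. 0 < b z w}"])
      show "K \<subseteq> (\<Union>z\<in>K. {w. 0 < b z w})" using b(3) by blast
    qed (use op in auto)
    define \<beta> where "\<beta> w = (\<Sum>z\<in>F. b z w)" for w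
    have \<beta>0: "0 \<le> \<beta> w" for w unfolding \<beta>_def using F(1) b(2) by (intro sum_nonneg) auto
    have \<beta>K: "0 < \<beta> w" if w: "w \<in> K" for w
    proof -
      obtain z where "z \<in> F" "0 < b z w" using F(3) w by blast
      then show ?thesis unfolding \<beta>_def using F(1,2) b(2) by (intro sum_pos2) auto
    qed
    have c\<beta>: "continuous_on W \<beta>" for W
      unfolding \<beta>_def using F(1) by (intro continuous_on_sum continuous_on_subset[OF b(1)]) auto
    obtain \<eta> where \<eta>: "\<eta> > 0" "\<And>w. w \<in> K \<Longrightarrow> \<eta> \<le> \<beta> w"
    proof (cases "K = {}")
      case False
      obtain w0 where "w0 \<in> K" "\<forall>w\<in>K. \<beta> w0 \<le> \<beta> w"
        using continuous_attains_inf[OF cK False c\<beta>] by blast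
      then show ?thesis using that[of "\<beta> w0"] \<beta>K by blast
    qed (use that[of 1] in auto)
    have "bounded (p ` box)" unfolding box_def by (intro compact_imp_bounded compact_continuous_image cp compact_cbox)
    then obtain P where P: "\<And>w. w \<in> box \<Longrightarrow> \<bar>p w\<bar> \<le> P" unfolding bounded_iff by auto
    \<comment> \<open>On K, where \<beta> is at least \<eta>, the term C \<beta> then exceeds
      \<bar>P\<bar> + \<bar>M\<bar>, hence p - M.\<close>
    define C where "C = (\<bar>P\<bar> + \<bar>M\<bar>) / \<eta>"
    have C0: "C \<ge> 0" using \<eta> by (simp add: C_def)
    have pb: "p w \<le> (M + e) + C * \<beta> w" if w: "w \<in> box" for w
    proof (cases "w \<in> K")
      case True
      have "\<bar>P\<bar> + \<bar>M\<bar> = C * \<eta>" using \<eta> by (simp add: C_def)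
      also have "\<dots> \<le> C * \<beta> w" using \<eta>(2)[OF True] C0 by (simp add: mult_left_mono)
      finally show ?thesis using P[OF w] e by linarith
    next
      case False
      then show ?thesis using w C0 \<beta>0[of w] by (auto simp: K_def not_le intro: order_trans[OF less_imp_le])
    qed
    have lim: "(\<lambda>m. (M + e) *\<^sub>R id_blinfun + C *\<^sub>R (\<Sum>z\<in>F. E m (b z)) - E m p)
        \<longlonglongrightarrow> (M + e) *\<^sub>R id_blinfun + C *\<^sub>R (\<Sum>z\<in>F. 0) - S"
      using F(1) by (intro tendsto_intros E_calc[OF p] b(4)) auto
    have "nonneg_op ((M + e) *\<^sub>R id_blinfun + C *\<^sub>R (\<Sum>z\<in>F. 0) - S)"
    proof (rule nonneg_op_limit[OF _ lim])
      fix m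
      have "nonneg_op (E m (\<lambda>w. ((M + e) + C * \<beta> w) - p w))" by (rule E_nonneg) (use pb in force)
      then show "nonneg_op ((M + e) *\<^sub>R id_blinfun + C *\<^sub>R (\<Sum>z\<in>F. E m (b z)) - E m p)"
        unfolding E_diff E_add E_const E_scaleR \<beta>_def E_sum[OF F(2)] by (simp add: scaleR_add_left)
    qed
    then show ?thesis by simp
  qed
  then have le0: "rinner u (S u) \<le> (M + e) * rinner u u" if "e > 0" for u e
    using that unfolding nonneg_op_def by (force simp: blinfun.bilinear_simps rinner_simps)
  have le: "rinner u (S u) \<le> M * rinner u u + e * rinner u u" if "e > 0" for u e
    using le0[OF that, of u] by (simp add: distrib_right)
  have "rinner u (S u) \<le> M * rinner u u" for u
  proof (cases "rinner u u = 0")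
    case False
    then have pos: "rinner u u > 0" using rinner_self_nonneg[of u] by simp
    show ?thesis
    proof (rule field_le_epsilon)
      fix e :: real assume "e > 0"
      then show "rinner u (S u) \<le> M * rinner u u + e" using le[of "e / rinner u u" u] pos by simp
    qed
  qed (use le[of 1 u] in simp)
  then show ?thesis by (simp add: nonneg_op_def blinfun.bilinear_simps rinner_simps)
qed

lemma calc_norm_le:
  assumes p: "poly_calc A B p S" and M: "\<And>z. z \<in> D \<Longrightarrow> \<bar>p z\<bar> \<le> M" "M \<ge> 0"
  shows "norm S \<le> M"
proof (rule norm_le_if_nonneg_op)
  show "self_adj S" by (rule calc_self_adj[OF p saA saB AB])
  show "nonneg_op (M *\<^sub>R id_blinfun - S)" by (rule calc_upper_bound[OF p]) (use M in force)
  have "nonneg_op (M *\<^sub>R id_blinfun - (-1) *\<^sub>R S)"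
    by (rule calc_upper_bound[OF calc_scaleR[OF p]]) (use M in force)
  then show "nonneg_op (M *\<^sub>R id_blinfun + S)" by simp
qed fact

section \<open>Continuous functions of the pair on D\<close>

definition cfun :: "(complex \<Rightarrow> real) \<Rightarrow> ('h \<Rightarrow>\<^sub>L 'h) \<Rightarrow> bool" where
  "cfun u S \<longleftrightarrow> (\<exists>p Sn. (\<forall>n. poly_calc A B (p n) (Sn n)) \<and> uniform_limit D p u sequentially \<and> Sn \<longlonglongrightarrow> S)"

lemma cfun_norm_le:
  assumes "cfun u S" and M: "\<And>z. z \<in> D \<Longrightarrow> \<bar>u z\<bar> \<le> M" "M \<ge> 0"
  shows "norm S \<le> M"
proof (rule field_le_epsilon)
  fix e :: real assume e: "e > 0"
  obtain p Sn where p: "\<And>n. poly_calc A B (p n) (Sn n)" "uniform_limit D p u sequentially" "Sn \<longlonglongrightarrow> S"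
    using assms(1) unfolding cfun_def by blast
  have "\<forall>\<^sub>F n in sequentially. \<forall>z\<in>D. dist (p n z) (u z) < e" using p(2) e unfolding uniform_limit_iff by blast
  then have "\<forall>\<^sub>F n in sequentially. norm (Sn n) \<le> M + e"
  proof eventually_elim
    case (elim n)
    show ?case
    proof (rule calc_norm_le[OF p(1)])
      fix z assume "z \<in> D"
      with elim M(1)[of z] show "\<bar>p n z\<bar> \<le> M + e" by (fastforce simp: dist_real_def)
    qed (use M e in auto)
  qed
  then show "norm S \<le> M + e"
    by (intro tendsto_upperbound[OF tendsto_norm[OF p(3)]]) auto
qed

lemma cfun_calc: "poly_calc A B p S \<Longrightarrow> cfun p S"
  unfolding cfun_def by (rule exI[of _ "\<lambda>_. p"], rule exI[of _ "\<lambda>_. S"]) (auto intro: uniform_limit_const)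

lemma cfun_add: "cfun u S \<Longrightarrow> cfun v T \<Longrightarrow> cfun (\<lambda>z. u z + v z) (S + T)"
  unfolding cfun_def
  by (elim exE conjE, rule_tac x="\<lambda>n z. p n z + pa n z" in exI, rule_tac x="\<lambda>n. Sn n + Sna n" in exI)
     (auto intro!: calc_add uniform_limit_add tendsto_add)

lemma cfun_scaleR: "cfun u S \<Longrightarrow> cfun (\<lambda>z. c * u z) (c *\<^sub>R S)"
  unfolding cfun_def
  by (elim exE conjE, rule_tac x="\<lambda>n z. c * p n z" in exI, rule_tac x="\<lambda>n. c *\<^sub>R Sn n" in exI)
     (auto intro!: calc_scaleR bounded_linear.uniform_limit[OF bounded_linear_mult_right] tendsto_scaleR)

lemma cfun_diff: "cfun u S \<Longrightarrow> cfun v T \<Longrightarrow> cfun (\<lambda>z. u z - v z) (S - T)"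
  using cfun_add[OF _ cfun_scaleR[of v T "-1"]] by fastforce

lemma cfun_unique:
  assumes "cfun u S" "cfun v T" "\<And>z. z \<in> D \<Longrightarrow> u z = v z" shows "S = T"
proof -
  have "norm (S - T) \<le> 0" by (rule cfun_norm_le[OF cfun_diff[OF assms(1,2)]]) (use assms(3) in auto)
  then show ?thesis by simp
qed

text \<open>The locale does not make D compact, and a product of uniform limits is a uniform limit
  only under bounds on the factors.\<close>

lemma cfun_mult:
  assumes "cfun u S" "cfun v T" "bounded (u ` D)" "bounded (v ` D)"
  shows "cfun (\<lambda>z. u z * v z) (S o\<^sub>L T)"
proof -
  obtain p Sn where p: "\<And>n. poly_calc A B (p n) (Sn n)" "uniform_limit D p u sequentially" "Sn \<longlonglongrightarrow> S"
    using assms(1) unfolding cfun_def by blast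
  obtain q Tn where q: "\<And>n. poly_calc A B (q n) (Tn n)" "uniform_limit D q v sequentially" "Tn \<longlonglongrightarrow> T"
    using assms(2) unfolding cfun_def by blast
  have "uniform_limit D (\<lambda>n z. p n z * q n z) (\<lambda>z. u z * v z) sequentially"
    by (rule uniform_lim_mult[OF p(2) q(2) assms(3,4)])
  moreover have "(\<lambda>n. Sn n o\<^sub>L Tn n) \<longlonglongrightarrow> (S o\<^sub>L T)"
    by (rule bounded_bilinear.tendsto[OF bounded_bilinear_blinfun_compose p(3) q(3)])
  ultimately show ?thesis
    unfolding cfun_def using calc_mult[OF p(1) q(1)]
    by (intro exI[of _ "\<lambda>n z. p n z * q n z"] exI[of _ "\<lambda>n. Sn n o\<^sub>L Tn n"]) auto
qed

lemma cfun_self_adj: "cfun u S \<Longrightarrow> self_adj S"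
  unfolding cfun_def using self_adj_limit calc_self_adj[OF _ saA saB AB] by blast

lemma cfun_comm: "cfun u S \<Longrightarrow> commutes Q A \<Longrightarrow> commutes Q B \<Longrightarrow> commutes Q S"
  unfolding cfun_def using commutes_limit calc_comm by metis

lemma cfun_qlin: "cfun u S \<Longrightarrow> A \<in> \<BB> \<Longrightarrow> B \<in> \<BB> \<Longrightarrow> S \<in> \<BB>"
  unfolding cfun_def using qlin_ops_limit calc_qlin by metis

text \<open>The norm bound applied to differences of approximating polynomials turns their uniform
  closeness on D into a Cauchy sequence of operators.\<close>

lemma cfun_exists:
  assumes D: "compact D" and u: "continuous_on D u"
  shows "\<exists>S. cfun u S"
proof -
  have "\<exists>p. (\<exists>S. poly_calc A B p S) \<and> (\<forall>z\<in>D. \<bar>u z - p z\<bar> < 1 / real (Suc n))" for n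
  proof (rule Stone_Weierstrass_HOL[OF D])
    fix x y :: complex assume "x \<in> D \<and> y \<in> D \<and> x \<noteq> y"
    then show "\<exists>f. (\<exists>S. poly_calc A B f S) \<and> f x \<noteq> f y"
      using calc_coordinates[of A B] complex_eq_iff[of x y] by metis
  qed (use u in \<open>auto intro: calc_const calc_continuous calc_add calc_mult\<close>)
  then obtain p Sn where p: "\<And>n. poly_calc A B (p n) (Sn n)" "\<And>n z. z \<in> D \<Longrightarrow> \<bar>u z - p n z\<bar> < 1 / real (Suc n)"
    by metis
  have small: "\<forall>\<^sub>F n in sequentially. 1 / real (Suc n) < e" if "e > 0" for e
    using order_tendstoD(2)[OF LIMSEQ_Suc[OF lim_1_over_n] that] .
  have ul: "uniform_limit D p u sequentially"
    unfolding uniform_limit_iff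
  proof safe
    fix e :: real assume "e > 0"
    from small[OF this] show "\<forall>\<^sub>F n in sequentially. \<forall>z\<in>D. dist (p n z) (u z) < e"
      by eventually_elim (auto simp: dist_real_def abs_minus_commute intro: less_trans[OF p(2)])
  qed
  have d: "norm (Sn n - Sn m) \<le> 1 / real (Suc n) + 1 / real (Suc m)" for n m
    by (rule calc_norm_le[OF calc_diff[OF p(1) p(1)]])
       (use p(2)[of _ n] p(2)[of _ m] in \<open>fastforce+\<close>)
  have "Cauchy Sn"
  proof (rule metric_CauchyI)
    fix e :: real assume e: "e > 0"
    then obtain N where N: "\<And>n. n \<ge> N \<Longrightarrow> 1 / real (Suc n) < e / 2"
      using small[of "e / 2"] unfolding eventually_sequentially by auto
    show "\<exists>M. \<forall>m\<ge>M. \<forall>n\<ge>M. dist (Sn m) (Sn n) < e"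
    proof (intro exI[of _ N] allI impI)
      fix m n assume "m \<ge> N" "n \<ge> N"
      with N[of m] N[of n] d[of m n] show "dist (Sn m) (Sn n) < e" by (simp add: dist_norm)
    qed
  qed
  then obtain S where "Sn \<longlonglongrightarrow> S" using Cauchy_convergent convergent_def by blast
  then show ?thesis unfolding cfun_def using p(1) ul by blast
qed

end

section \<open>The continuous calculus of real slice functions\<close>

text \<open>u + K u = v says that u is the fixed point of the contraction u \<mapsto> v - K u.
  Uniqueness of the fixed point gives additivity, homogeneity and right linearity of the solution
  map.\<close>

lemma banach_contraction_inverse:
  fixes K :: "'h::quaternionic_hilbert \<Rightarrow>\<^sub>L 'h"
  assumes K: "norm K < 1" "K \<in> \<BB>"
  shows "\<exists>R. is_inverse_op (id_blinfun + K) R"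
proof -
  have ex: "\<exists>!u. v - K u = u" for v
  proof -
    have "\<forall>x y. dist (v - K x) (v - K y) \<le> norm K * dist x y"
    proof (intro allI)
      fix x y
      have "dist (v - K x) (v - K y) = norm (K (y - x))" by (simp add: dist_norm blinfun.diff_right)
      also have "\<dots> \<le> norm K * dist x y" using norm_blinfun[of K "y - x"] by (simp add: dist_norm norm_minus_commute)
      finally show "dist (v - K x) (v - K y) \<le> norm K * dist x y" .
    qed
    then show ?thesis using K(1) by (intro banach_fix_type[of "norm K"]) auto
  qed
  define s where "s v = (THE u. v - K u = u)" for v
  have s: "v - K (s v) = s v" for v unfolding s_def by (rule theI'[OF ex])
  have sI: "s v = u" if "v = u + K u" for u v
  proof -
    have "v - K u = u" using that by simp
    with ex[of v] s[of v] show ?thesis by blast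
  qed
  have sK: "s v + K (s v) = v" for v using s[of v] by (simp add: algebra_simps)
  have bl: "bounded_linear s"
  proof (rule bounded_linear_intro[of _ "1 / (1 - norm K)"])
    show "s (v + w) = s v + s w" for v w
      by (rule sI) (use sK[of v] sK[of w] in \<open>simp add: blinfun.bilinear_simps algebra_simps\<close>)
    show "s (r *\<^sub>R v) = r *\<^sub>R s v" for r v
      by (rule sI) (use sK[of v] in \<open>simp add: blinfun.bilinear_simps flip: scaleR_add_right\<close>)
    show "norm (s v) \<le> norm v * (1 / (1 - norm K))" for v
    proof -
      have "norm (s v) \<le> norm v + norm (K (s v))"
        using norm_triangle_ineq4[of v "K (s v)"] by (simp add: s)
      also have "\<dots> \<le> norm v + norm K * norm (s v)" by (simp add: norm_blinfun)
      finally show ?thesis using K(1) by (simp add: field_simps)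
    qed
  qed
  note ap = bounded_linear_Blinfun_apply[OF bl]
  have "Blinfun s \<in> \<BB>"
    unfolding qlin_ops_def mem_Collect_eq ap
  proof safe
    fix u q
    have "u *\<^sub>H q = s u *\<^sub>H q + K (s u *\<^sub>H q)"
      by (subst sK[of u, symmetric]) (simp add: qlin_opsD[OF K(2)] rscaleH_add_left)
    then show "s (u *\<^sub>H q) = s u *\<^sub>H q" by (rule sI)
  qed
  moreover have "(id_blinfun + K) o\<^sub>L Blinfun s = id_blinfun"
    by (rule blinfun_eqI) (simp add: ap blinfun.bilinear_simps sK)
  moreover have "Blinfun s o\<^sub>L (id_blinfun + K) = id_blinfun"
    by (rule blinfun_eqI) (simp add: ap blinfun.bilinear_simps sI)
  ultimately show ?thesis unfolding is_inverse_op_def by blast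
qed

lemma blinfun_assoc: "(S o\<^sub>L T) o\<^sub>L R = S o\<^sub>L (T o\<^sub>L R)"
  by (rule blinfun_eqI) simp

lemma is_inverse_op_compose:
  assumes "is_inverse_op S R" "is_inverse_op S' R'" shows "is_inverse_op (S o\<^sub>L S') (R' o\<^sub>L R)"
proof -
  have 1: "S (R u) = u" "R (S u) = u" "S' (R' u) = u" "R' (S' u) = u" for u
    using assms unfolding is_inverse_op_def by (metis blinfun_apply_blinfun_compose blinfun_apply_id_blinfun id_apply)+
  show ?thesis
    using assms unfolding is_inverse_op_def by (auto intro!: blinfun_eqI simp: 1)
qed

lemma is_inverse_op_unique: "is_inverse_op S R \<Longrightarrow> is_inverse_op S R' \<Longrightarrow> R = R'"
  unfolding is_inverse_op_def by (metis blinfun_assoc compose_id)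

lemma inverse_op_eq: "is_inverse_op S R \<Longrightarrow> inverse_op S = R"
  unfolding inverse_op_def using is_inverse_op_unique by blast

text \<open>S' = S (1 + R (S' - S)), and the second factor is a small perturbation of the
  identity.\<close>

lemma is_inverse_op_perturb:
  assumes "is_inverse_op S R" "S \<in> \<BB>" "S' \<in> \<BB>" "norm R * norm (S' - S) < 1"
  shows "\<exists>R'. is_inverse_op S' R'"
proof -
  have R: "R \<in> \<BB>" "S o\<^sub>L R = id_blinfun" using assms(1) by (auto simp: is_inverse_op_def)
  have "norm (R o\<^sub>L (S' - S)) < 1" using norm_blinfun_compose[of R "S' - S"] assms(4) by linarith
  then obtain Q where "is_inverse_op (id_blinfun + (R o\<^sub>L (S' - S))) Q"
    using banach_contraction_inverse R assms by blast
  from is_inverse_op_compose[OF assms(1) this]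
  have "is_inverse_op (S o\<^sub>L (id_blinfun + (R o\<^sub>L (S' - S)))) (Q o\<^sub>L R)" .
  moreover have "S o\<^sub>L (id_blinfun + (R o\<^sub>L (S' - S))) = S'"
  proof (rule blinfun_eqI)
    fix u
    have "S (R v) = v" for v using R(2) by (metis blinfun_apply_blinfun_compose blinfun_apply_id_blinfun id_apply)
    then show "(S o\<^sub>L (id_blinfun + (R o\<^sub>L (S' - S)))) u = S' u" by (simp add: blinfun.bilinear_simps)
  qed
  ultimately show ?thesis by auto
qed

section \<open>The spherical spectrum and its profile\<close>

definition sph_op :: "('h::quaternionic_hilbert \<Rightarrow>\<^sub>L 'h) \<Rightarrow> complex \<Rightarrow> 'h \<Rightarrow>\<^sub>L 'h" where
  "sph_op T z = (T o\<^sub>L T) - (2 * Re z) *\<^sub>R T + (norm z)\<^sup>2 *\<^sub>R id_blinfun"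

lemma Delta_slice: "\<iota> \<in> \<S> \<Longrightarrow> Delta (slice \<iota> z) T = sph_op T z"
  by (simp add: Delta_def sph_op_def norm_slice)

text \<open>\<open>Delta\<close> sees only the real part and the norm of a quaternion, so the
  existential quantifier over units in \<open>profile\<close> may equally be a universal
  one.\<close>

lemma profile_spectrum:
  "z \<in> profile (\<sigma>\<^sub>S T) \<longleftrightarrow> \<not> (\<exists>R. is_inverse_op (sph_op T z) R)"
  "\<iota> \<in> \<S> \<Longrightarrow> slice \<iota> z \<in> \<sigma>\<^sub>S T \<longleftrightarrow> z \<in> profile (\<sigma>\<^sub>S T)"
proof -
  have *: "slice \<iota> z \<in> \<sigma>\<^sub>S T \<longleftrightarrow> \<not> (\<exists>R. is_inverse_op (sph_op T z) R)" if "\<iota> \<in> \<S>" for \<iota>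
    by (simp add: spherical_spectrum_def Delta_slice that)
  show "z \<in> profile (\<sigma>\<^sub>S T) \<longleftrightarrow> \<not> (\<exists>R. is_inverse_op (sph_op T z) R)"
    unfolding profile_def using * quat_i_imag_unit by blast
  with * show "\<iota> \<in> \<S> \<Longrightarrow> slice \<iota> z \<in> \<sigma>\<^sub>S T \<longleftrightarrow> z \<in> profile (\<sigma>\<^sub>S T)" by blast
qed

lemma cnj_profile_spectrum: "z \<in> profile (\<sigma>\<^sub>S T) \<Longrightarrow> cnj z \<in> profile (\<sigma>\<^sub>S T)"
  by (simp add: profile_spectrum sph_op_def)

lemma quat_slice_exists: "\<exists>\<iota>\<in>\<S>. \<exists>z. q = slice \<iota> z"
proof (cases "q = of_real (qre q)")
  case True
  \<comment> \<open>A real quaternion lies on every slice; the unit i is an arbitrary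
    choice.\<close>
  then have "q = slice (Quat 0 1 0 0) (of_real (qre q))" by (simp add: slice_def)
  then show ?thesis using quat_i_imag_unit by blast
next
  case False
  define v where "v = q - of_real (qre q)"
  define \<iota> where "\<iota> = v /\<^sub>R norm v"
  have v: "norm v \<noteq> 0" using False by (simp add: v_def)
  have "(qi v)\<^sup>2 + (qj v)\<^sup>2 + (qk v)\<^sup>2 = (norm v)\<^sup>2" "qre v = 0"
    by (simp_all add: quat_norm_sq v_def)
  then have "\<iota> \<in> \<S>"
    using v by (simp add: imag_units_iff \<iota>_def power_mult_distrib flip: distrib_left) (simp add: field_simps)
  moreover have "q = slice \<iota> (Complex (qre q) (norm v))"
    using v by (simp add: slice_def \<iota>_def of_real_def) (simp add: v_def of_real_def)
  ultimately show ?thesis by blast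
qed

lemma spectrum_slice: "q \<in> \<sigma>\<^sub>S T \<Longrightarrow> \<exists>\<iota>\<in>\<S>. \<exists>z\<in>profile (\<sigma>\<^sub>S T). q = slice \<iota> z"
  using quat_slice_exists profile_spectrum(2) by metis

lemma compact_profile_spectrum:
  assumes T: "T \<in> \<BB>" shows "compact (profile (\<sigma>\<^sub>S T))"
proof -
  have sB: "sph_op T z \<in> \<BB>" for z unfolding sph_op_def using T by auto
  have "open (- profile (\<sigma>\<^sub>S T))"
    unfolding open_contains_ball
  proof
    fix z0 assume "z0 \<in> - profile (\<sigma>\<^sub>S T)"
    then obtain R where R: "is_inverse_op (sph_op T z0) R" by (auto simp: profile_spectrum)
    have "continuous_on UNIV (\<lambda>z. norm R * norm (sph_op T z - sph_op T z0))"
      unfolding sph_op_def by (intro continuous_intros)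
    then have "open {z. norm R * norm (sph_op T z - sph_op T z0) < 1}"
      by (rule open_Collect_less[OF _ continuous_on_const])
    then obtain e where e: "e > 0" "ball z0 e \<subseteq> {z. norm R * norm (sph_op T z - sph_op T z0) < 1}"
      by (rule openE[of _ z0]) simp_all
    have "ball z0 e \<subseteq> - profile (\<sigma>\<^sub>S T)"
    proof
      fix z assume "z \<in> ball z0 e"
      with e(2) have "norm R * norm (sph_op T z - sph_op T z0) < 1" by blast
      then show "z \<in> - profile (\<sigma>\<^sub>S T)"
        using is_inverse_op_perturb[OF R sB sB] by (simp add: profile_spectrum)
    qed
    then show "\<exists>e>0. ball z0 e \<subseteq> - profile (\<sigma>\<^sub>S T)" using e(1) by blast
  qed
  moreover have "bounded (profile (\<sigma>\<^sub>S T))"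
  proof (rule boundedI)
    fix z assume z: "z \<in> profile (\<sigma>\<^sub>S T)"
    \<comment> \<open>Beyond 3 * norm T the norm of T T - 2 Re z T is at most 3 * norm z * norm T,
      hence below the square of norm z, and the scalar term dominates. The added 1 makes z nonzero
      when T = 0.\<close>
    show "norm z \<le> 3 * norm T + 1"
    proof (rule ccontr)
      assume "\<not> norm z \<le> 3 * norm T + 1"
      then have big: "3 * norm T < norm z" "0 < norm z" using norm_ge_zero[of T] by linarith+
      define S where "S = (norm z)\<^sup>2 *\<^sub>R (id_blinfun :: 'a \<Rightarrow>\<^sub>L 'a)"
      define R where "R = inverse ((norm z)\<^sup>2) *\<^sub>R (id_blinfun :: 'a \<Rightarrow>\<^sub>L 'a)"
      have inv: "is_inverse_op S R"
        unfolding is_inverse_op_def S_def R_def using big(2)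
        by (auto intro!: blinfun_eqI simp: blinfun.bilinear_simps)
      have nR: "norm R \<le> inverse ((norm z)\<^sup>2)"
        unfolding R_def using mult_left_mono[OF norm_blinfun_id_le[where 'a='a], of "inverse ((norm z)\<^sup>2)"] by simp
      have "norm (sph_op T z - S) \<le> norm (T o\<^sub>L T) + norm ((2 * Re z) *\<^sub>R T)"
        unfolding sph_op_def S_def add_diff_cancel_right' by (rule norm_triangle_ineq4)
      also have "\<dots> \<le> norm T * norm T + 2 * norm z * norm T"
        using norm_blinfun_compose[of T T] abs_Re_le_cmod[of z] by (intro add_mono) (auto intro!: mult_right_mono simp: abs_mult)
      also have "\<dots> \<le> norm z * norm T + 2 * norm z * norm T"
        using big(1) norm_ge_zero[of T] by (intro add_right_mono mult_right_mono) linarith+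
      also have "\<dots> = norm z * (3 * norm T)" by simp
      also have "\<dots> < norm z * norm z" using big by (intro mult_strict_left_mono)
      finally have less: "norm (sph_op T z - S) < (norm z)\<^sup>2" by (simp add: power2_eq_square)
      have "norm R * norm (sph_op T z - S) \<le> inverse ((norm z)\<^sup>2) * norm (sph_op T z - S)"
        by (rule mult_right_mono[OF nR]) simp
      also have "\<dots> < inverse ((norm z)\<^sup>2) * (norm z)\<^sup>2" using less big by (intro mult_strict_left_mono) auto
      also have "\<dots> = 1" using big by simp
      finally have "norm R * norm (sph_op T z - S) < 1" .
      then have "\<exists>R'. is_inverse_op (sph_op T z) R'"
        by (intro is_inverse_op_perturb[OF inv]) (auto simp: S_def sB)
      then show False using z by (simp add: profile_spectrum)
    qed
  qed
  ultimately show ?thesis by (simp add: compact_eq_bounded_closed closed_open)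
qed

text \<open>Reads the two stem components off the slice of the unit i, where a real slice function
  takes values in the span of 1 and i. Being explicit, it spares the choice of a stem
  function.\<close>

definition stem_at_i :: "(quat \<Rightarrow> quat) \<Rightarrow> complex \<Rightarrow> complex" where
  "stem_at_i g z = Complex (qre (g (slice (Quat 0 1 0 0) z))) (qi (g (slice (Quat 0 1 0 0) z)))"

lemma continuous_on_qre: "continuous_on W F \<Longrightarrow> continuous_on W (\<lambda>z. qre (F z))"
proof -
  have "qre q = inner 1 q" for q by (simp add: inner_quat_def)
  then show "continuous_on W F \<Longrightarrow> continuous_on W (\<lambda>z. qre (F z))" by (simp add: continuous_on_inner)
qed

lemma slice_cont_realD:
  assumes "g \<in> slice_cont_real W"
  shows "continuous_on (profile W) (stem_at_i g)"
    "\<iota> \<in> \<S> \<Longrightarrow> z \<in> profile W \<Longrightarrow> g (slice \<iota> z) = slice \<iota> (stem_at_i g z)"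
    "z \<in> profile W \<Longrightarrow> stem_at_i g (cnj z) = cnj (stem_at_i g z)"
proof -
  obtain F where F: "stem_on (profile W) F" "continuous_on (profile W) F"
    "\<And>z. z \<in> profile W \<Longrightarrow> fst (F z) \<in> \<real> \<and> snd (F z) \<in> \<real>" "induces_on (profile W) F g"
    using assms by (auto simp: slice_cont_real_def)
  have r: "fst (F z) = of_real (qre (fst (F z)))" "snd (F z) = of_real (qre (snd (F z)))" if "z \<in> profile W" for z
    using F(3)[OF that] by (auto elim!: Reals_cases)
  have eq: "stem_at_i g z = Complex (qre (fst (F z))) (qre (snd (F z)))" if z: "z \<in> profile W" for z
  proof -
    have "g (slice (Quat 0 1 0 0) z) = fst (F z) + Quat 0 1 0 0 * snd (F z)"
      using F(4) z quat_i_imag_unit by (simp add: induces_on_def)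
    then have "g (slice (Quat 0 1 0 0) z) = of_real (qre (fst (F z))) + Quat 0 1 0 0 * of_real (qre (snd (F z)))"
      using r[OF z] by simp
    then show ?thesis by (simp add: stem_at_i_def quat_sel_mult)
  qed
  have "continuous_on (profile W) (\<lambda>z. Complex (qre (fst (F z))) (qre (snd (F z))))"
    unfolding Complex_eq by (intro continuous_intros continuous_on_qre F(2))
  then show "continuous_on (profile W) (stem_at_i g)"
    by (rule continuous_on_eq) (simp add: eq)
  show "g (slice \<iota> z) = slice \<iota> (stem_at_i g z)" if "\<iota> \<in> \<S>" "z \<in> profile W"
  proof -
    have "g (slice \<iota> z) = fst (F z) + \<iota> * snd (F z)" using F(4) that by (simp add: induces_on_def)
    then show ?thesis using r[OF that(2)] by (simp add: eq[OF that(2)] slice_def)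
  qed
  show "stem_at_i g (cnj z) = cnj (stem_at_i g z)" if "z \<in> profile W"
    using F(1) that by (simp add: stem_on_def eq complex_eq_iff)
qed

lemma adjI_rinner:
  fixes S T :: "'h::quaternionic_hilbert \<Rightarrow>\<^sub>L 'h"
  assumes "S \<in> \<BB>" "T \<in> \<BB>" "\<And>u v. rinner (S u) v = rinner u (T v)"
  shows "adj T = S"
  by (rule adjI[OF assms(1)], rule qinner_eqI) (simp add: assms(3) flip: qlin_opsD[OF assms(2)])

section \<open>The real slice calculus of a normal operator\<close>

locale normal_decomposition =
  fixes T A B J :: "'h::quaternionic_hilbert \<Rightarrow>\<^sub>L 'h"
  assumes qlin: "A \<in> \<BB>" "B \<in> \<BB>" "J \<in> \<BB>"
    and sa: "self_adj A" "self_adj B" and comms: "commutes A B" "commutes J A" "commutes J B"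
    and J_anti: "\<And>u v. rinner (J u) v = - rinner u (J v)" and J_square: "\<And>u. J (J u) = - u"
    and T_eq: "T = A + (J o\<^sub>L B)"
begin

lemma T_qlin: "T \<in> \<BB>"
  unfolding T_eq using qlin by auto

abbreviation spec :: "complex set" where "spec \<equiv> profile (\<sigma>\<^sub>S T)"

lemma J_isometry: "rinner (J u) (J v) = rinner u v"
  using J_anti[of u "J v"] by (simp add: J_square rinner_minus_right)

text \<open>J W is skew for the real scalar product, so its real quadratic form vanishes.\<close>

lemma rinner_J_self_adjoint: "self_adj W \<Longrightarrow> commutes J W \<Longrightarrow> rinner u (J (W u)) = 0"
proof -
  assume W: "self_adj W" "commutes J W"
  have "rinner u (J (W u)) = - rinner (J u) (W u)" by (simp add: J_anti)
  also have "rinner (J u) (W u) = rinner (W (J u)) u" using W(1) by (simp add: self_adj_def)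
  also have "\<dots> = rinner u (J (W u))" using W(2) by (simp add: commutes_def rinner_commute)
  finally show ?thesis by simp
qed

text \<open>With z read as Re z + J Im z, the spherical operator factors as (T - cnj z)(T - z) = N'
  N. If it has the inverse R, then R N' is a left inverse of N, which is thus bounded below; the
  norm of N u splits by Pythagoras because the cross term is the quadratic form of J P Q.\<close>

lemma spectrum_coercive:
  assumes "z \<notin> spec"
  shows "\<exists>c>0. \<forall>u. c * rinner u u \<le>
    rinner (A u - Re z *\<^sub>R u) (A u - Re z *\<^sub>R u) + rinner (B u - Im z *\<^sub>R u) (B u - Im z *\<^sub>R u)"
proof -
  obtain R where R: "is_inverse_op (sph_op T z) R" using assms by (auto simp: profile_spectrum)
  define P where "P = A - Re z *\<^sub>R id_blinfun"
  define Q where "Q = B - Im z *\<^sub>R id_blinfun"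
  define N where "N = P + (J o\<^sub>L Q)"
  define N' where "N' = P + (J o\<^sub>L (B + Im z *\<^sub>R id_blinfun))"
  have c: "A (J u) = J (A u)" "B (J u) = J (B u)" "B (A u) = A (B u)" for u
    using comms by (simp_all add: commutes_def)
  have nz: "(norm z)\<^sup>2 = Re z * Re z + Im z * Im z" by (simp add: cmod_power2 flip: power2_eq_square)
  have s2: "(2 * Re z) *\<^sub>R T = Re z *\<^sub>R T + Re z *\<^sub>R T" by (simp only: mult_2 scaleR_add_left)
  have "sph_op T z = N' o\<^sub>L N"
    unfolding sph_op_def s2
    by (rule blinfun_eqI)
      (simp add: N_def N'_def P_def Q_def T_eq blinfun.bilinear_simps c J_square nz algebra_simps)
  then have RN: "R (N' (N u)) = u" for u
    using R unfolding is_inverse_op_def by (metis blinfun_apply_blinfun_compose blinfun_apply_id_blinfun id_apply)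
  have Nn: "rinner (N u) (N u) = rinner (P u) (P u) + rinner (Q u) (Q u)" for u
  proof -
    have s: "self_adj P" "self_adj Q" unfolding P_def Q_def by (intro self_adj_intros sa)+
    have PQ: "self_adj (P o\<^sub>L Q)" "commutes J (P o\<^sub>L Q)"
      unfolding P_def Q_def by (intro self_adj_intros sa commutes_intros commutes_id comms)+
    have "rinner (P u) (J (Q u)) = rinner u (J ((P o\<^sub>L Q) u))"
      using s(1) by (simp add: self_adj_def) (simp add: P_def blinfun.bilinear_simps c)
    also have "\<dots> = 0" by (rule rinner_J_self_adjoint[OF PQ])
    finally show ?thesis
      by (simp add: N_def blinfun.bilinear_simps rinner_simps J_isometry rinner_commute[of "J (Q u)"])
  qed
  define k where "k = norm (R o\<^sub>L N') + 1"
  have k: "k > 0" by (simp add: k_def add_nonneg_pos)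
  have "rinner u u \<le> k\<^sup>2 * rinner (N u) (N u)" for u
  proof -
    have "norm u = norm ((R o\<^sub>L N') (N u))" by (simp add: RN)
    also have "\<dots> \<le> norm (R o\<^sub>L N') * norm (N u)" by (rule norm_blinfun)
    also have "\<dots> \<le> k * norm (N u)" by (rule mult_right_mono) (simp_all add: k_def)
    finally have "(norm u)\<^sup>2 \<le> (k * norm (N u))\<^sup>2" by (intro power_mono) auto
    then show ?thesis by (simp add: rinner_self power_mult_distrib)
  qed
  then have "(1 / k\<^sup>2) * rinner u u \<le> rinner (P u) (P u) + rinner (Q u) (Q u)" for u
    using k by (simp add: pos_divide_le_eq mult.commute flip: Nn)
  moreover have "P u = A u - Re z *\<^sub>R u" "Q u = B u - Im z *\<^sub>R u" for u
    by (simp_all add: P_def Q_def blinfun.bilinear_simps)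
  ultimately show ?thesis using k by (intro exI[of _ "1 / k\<^sup>2"]) auto
qed

sublocale commuting_pair A B spec
  by unfold_locales (use sa comms spectrum_coercive in auto)

definition cfun_op :: "(complex \<Rightarrow> real) \<Rightarrow> 'h \<Rightarrow>\<^sub>L 'h" where "cfun_op u = (THE S. cfun u S)"

definition slice_calc :: "(quat \<Rightarrow> quat) \<Rightarrow> 'h \<Rightarrow>\<^sub>L 'h" where
  "slice_calc g = cfun_op (\<lambda>z. Re (stem_at_i g z)) + (J o\<^sub>L cfun_op (\<lambda>z. Im (stem_at_i g z)))"

lemma cf_eq: 
  assumes "cfun v S" "continuous_on spec u" "\<And>z. z \<in> spec \<Longrightarrow> u z = v z" shows "cfun_op u = S"
proof -
  obtain S' where S': "cfun u S'"
    using cfun_exists[OF compact_profile_spectrum[OF T_qlin] assms(2)] by blast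
  have "S' = S" by (rule cfun_unique[OF S' assms(1,3)])
  with S' show ?thesis unfolding cfun_op_def using cfun_unique by blast
qed

lemma slice_calc_eq:
  assumes "cfun u U" "cfun v V" "continuous_on spec (stem_at_i g)"
    "\<And>z. z \<in> spec \<Longrightarrow> stem_at_i g z = Complex (u z) (v z)"
  shows "slice_calc g = U + (J o\<^sub>L V)"
proof -
  have "cfun_op (\<lambda>z. Re (stem_at_i g z)) = U"
    by (rule cf_eq[OF assms(1) continuous_on_Re[OF assms(3)]]) (simp add: assms(4))
  moreover have "cfun_op (\<lambda>z. Im (stem_at_i g z)) = V"
    by (rule cf_eq[OF assms(2) continuous_on_Im[OF assms(3)]]) (simp add: assms(4))
  ultimately show ?thesis by (simp add: slice_calc_def)
qed

lemma stem_cfun: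
  assumes "g \<in> slice_cont_real (\<sigma>\<^sub>S T)"
  obtains U V where "cfun (\<lambda>z. Re (stem_at_i g z)) U" "cfun (\<lambda>z. Im (stem_at_i g z)) V"
    "slice_calc g = U + (J o\<^sub>L V)"
proof -
  note c = slice_cont_realD(1)[OF assms]
  have "continuous_on spec (\<lambda>z. Re (stem_at_i g z))" "continuous_on spec (\<lambda>z. Im (stem_at_i g z))"
    by (intro continuous_intros c)+
  then obtain U V where "cfun (\<lambda>z. Re (stem_at_i g z)) U" "cfun (\<lambda>z. Im (stem_at_i g z)) V"
    using cfun_exists[OF compact_profile_spectrum[OF T_qlin]] by blast
  with that slice_calc_eq[OF _ _ c] show ?thesis by auto
qed

lemma stem_bounded:
  assumes "g \<in> slice_cont_real (\<sigma>\<^sub>S T)"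
  shows "bounded ((\<lambda>z. Re (stem_at_i g z)) ` spec)" "bounded ((\<lambda>z. Im (stem_at_i g z)) ` spec)"
  by (intro compact_imp_bounded compact_continuous_image continuous_intros slice_cont_realD(1)[OF assms]
      compact_profile_spectrum T_qlin)+

text \<open>J squares to -1 and commutes with U and V, so U + J V multiplies as complex numbers do.
  Since J is skew and U, V are self-adjoint, the adjoint is U - J V, matching the conjugate
  stem.\<close>

lemma slice_calc_is_calculus: "is_real_slice_calculus T slice_calc"
  unfolding is_real_slice_calculus_def
proof (intro conjI ballI allI impI)
  let ?i = "Quat 0 1 0 0"
  have val: "g (slice ?i z) = slice ?i (stem_at_i g z)" if "g \<in> slice_cont_real (\<sigma>\<^sub>S T)" "z \<in> spec" for g z
    by (rule slice_cont_realD(2)[OF that(1) quat_i_imag_unit that(2)])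
  have stem_slice: "stem_at_i g z = w" if "g (slice ?i z) = slice ?i w" for g z w
    by (simp add: stem_at_i_def that) (simp add: slice_def quat_sel_mult)
  fix g assume g: "g \<in> slice_cont_real (\<sigma>\<^sub>S T)"
  note cg = slice_cont_realD(1)[OF g]
  obtain U V where UV: "cfun (\<lambda>z. Re (stem_at_i g z)) U" "cfun (\<lambda>z. Im (stem_at_i g z)) V"
    "slice_calc g = U + (J o\<^sub>L V)" by (rule stem_cfun[OF g])
  have UVB: "U \<in> \<BB>" "V \<in> \<BB>" using UV cfun_qlin qlin by auto
  have UVJ: "commutes J U" "commutes J V" using UV cfun_comm comms by auto
  show "slice_calc g \<in> \<BB>" unfolding UV using UVB qlin by auto
  show "slice_calc (\<lambda>q. r *\<^sub>R g q) = r *\<^sub>R slice_calc g" for r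
  proof -
    have s: "stem_at_i (\<lambda>q. r *\<^sub>R g q) z = r *\<^sub>R stem_at_i g z" for z
      by (simp add: stem_at_i_def complex_eq_iff)
    have "slice_calc (\<lambda>q. r *\<^sub>R g q) = r *\<^sub>R U + (J o\<^sub>L (r *\<^sub>R V))"
      by (rule slice_calc_eq[OF cfun_scaleR[OF UV(1)] cfun_scaleR[OF UV(2)]])
         (auto simp: s complex_eq_iff intro!: continuous_intros cg)
    also have "\<dots> = r *\<^sub>R slice_calc g"
      unfolding UV by (rule blinfun_eqI) (simp add: blinfun.bilinear_simps algebra_simps)
    finally show ?thesis .
  qed
  show "slice_calc (\<lambda>q. qcnj (g q)) = adj (slice_calc g)"
  proof -
    have s: "stem_at_i (\<lambda>q. qcnj (g q)) z = cnj (stem_at_i g z)" for z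
      by (simp add: stem_at_i_def complex_eq_iff)
    have "slice_calc (\<lambda>q. qcnj (g q)) = U + (J o\<^sub>L ((-1) *\<^sub>R V))"
      by (rule slice_calc_eq[OF UV(1) cfun_scaleR[OF UV(2)]])
         (auto simp: s complex_eq_iff intro!: continuous_intros cg)
    also have "\<dots> = adj (slice_calc g)"
    proof (rule adjI_rinner[symmetric])
      fix u v
      have "self_adj U" "self_adj V" using UV cfun_self_adj by auto
      then show "rinner ((U + (J o\<^sub>L ((-1) *\<^sub>R V))) u) v = rinner u (slice_calc g v)"
        unfolding UV(3) using UVJ
        by (simp add: blinfun.bilinear_simps rinner_simps J_anti self_adj_def commutes_def)
    qed (use UVB qlin UV(3) in auto)
    finally show ?thesis .
  qed
  {
    fix h assume h: "h \<in> slice_cont_real (\<sigma>\<^sub>S T)"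
    note ch = slice_cont_realD(1)[OF h]
    obtain U' V' where UV': "cfun (\<lambda>z. Re (stem_at_i h z)) U'" "cfun (\<lambda>z. Im (stem_at_i h z)) V'"
      "slice_calc h = U' + (J o\<^sub>L V')" by (rule stem_cfun[OF h])
    have UVJ': "commutes J U'" "commutes J V'" using UV' cfun_comm comms by auto
    show "slice_calc (\<lambda>q. g q + h q) = slice_calc g + slice_calc h"
    proof -
      have s: "stem_at_i (\<lambda>q. g q + h q) z = stem_at_i g z + stem_at_i h z" for z
        by (simp add: stem_at_i_def complex_eq_iff)
      have "slice_calc (\<lambda>q. g q + h q) = (U + U') + (J o\<^sub>L (V + V'))"
        by (rule slice_calc_eq[OF cfun_add[OF UV(1) UV'(1)] cfun_add[OF UV(2) UV'(2)]])
           (auto simp: s complex_eq_iff intro!: continuous_intros cg ch)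
      also have "\<dots> = slice_calc g + slice_calc h"
        unfolding UV UV' by (rule blinfun_eqI) (simp add: blinfun.bilinear_simps algebra_simps)
      finally show ?thesis .
    qed
    show "slice_calc (\<lambda>q. g q * h q) = slice_calc g o\<^sub>L slice_calc h"
    proof -
      \<comment> \<open>Only on the spectrum are the values known to stay in the slice of i;
        elsewhere reading off two coordinates is not multiplicative.\<close>
      have s: "stem_at_i (\<lambda>q. g q * h q) z = stem_at_i g z * stem_at_i h z" if "z \<in> spec" for z
        by (rule stem_slice) (simp add: val g h that slice_mult)
      note b = stem_bounded[OF g] stem_bounded[OF h]
      have "slice_calc (\<lambda>q. g q * h q) =
          ((U o\<^sub>L U') - (V o\<^sub>L V')) + (J o\<^sub>L ((U o\<^sub>L V') + (V o\<^sub>L U')))"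
        by (rule slice_calc_eq[OF cfun_diff[OF cfun_mult[OF UV(1) UV'(1)] cfun_mult[OF UV(2) UV'(2)]]
              cfun_add[OF cfun_mult[OF UV(1) UV'(2)] cfun_mult[OF UV(2) UV'(1)]]])
           (auto simp: s complex_eq_iff b cong: continuous_on_cong intro!: continuous_intros cg ch)
      also have "\<dots> = slice_calc g o\<^sub>L slice_calc h"
        unfolding UV UV' using UVJ UVJ'
        by (intro blinfun_eqI) (simp add: commutes_def blinfun.bilinear_simps J_square algebra_simps)
      finally show ?thesis .
    qed
  }
  fix e :: real assume e: "e > 0"
  \<comment> \<open>Errors d in both stem components cost d (1 + norm J) = e / 2, strictly below
    e.\<close>
  define k where "k = 1 + norm J"
  define d where "d = e / (2 * k)"
  have nJ: "k > 0" by (simp add: k_def add_pos_nonneg)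
  have "d * k = e / 2" using nJ by (simp add: d_def)
  then have d: "d > 0" "d * (1 + norm J) < e" using e nJ by (simp_all add: d_def flip: k_def)
  show "\<exists>d>0. \<forall>h\<in>slice_cont_real (\<sigma>\<^sub>S T). (\<forall>q\<in>\<sigma>\<^sub>S T. norm (h q - g q) \<le> d) \<longrightarrow> norm (slice_calc h - slice_calc g) < e"
  proof (intro exI conjI ballI impI)
    fix h assume h: "h \<in> slice_cont_real (\<sigma>\<^sub>S T)" and hg: "\<forall>q\<in>\<sigma>\<^sub>S T. norm (h q - g q) \<le> d"
    obtain U' V' where UV': "cfun (\<lambda>z. Re (stem_at_i h z)) U'" "cfun (\<lambda>z. Im (stem_at_i h z)) V'"
      "slice_calc h = U' + (J o\<^sub>L V')" by (rule stem_cfun[OF h])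
    have "norm (stem_at_i h z - stem_at_i g z) \<le> d" if z: "z \<in> spec" for z
    proof -
      have "norm (h (slice ?i z) - g (slice ?i z)) \<le> d" using hg z by (simp add: profile_spectrum(2))
      then show ?thesis by (simp add: val g h z norm_slice flip: slice_diff)
    qed
    then have b: "\<bar>Re (stem_at_i h z) - Re (stem_at_i g z)\<bar> \<le> d" "\<bar>Im (stem_at_i h z) - Im (stem_at_i g z)\<bar> \<le> d"
      if "z \<in> spec" for z
      using that abs_Re_le_cmod[of "stem_at_i h z - stem_at_i g z"] abs_Im_le_cmod[of "stem_at_i h z - stem_at_i g z"]
      by fastforce+
    have n: "norm (U' - U) \<le> d" "norm (V' - V) \<le> d"
      using d(1) by (auto intro!: cfun_norm_le[OF cfun_diff[OF UV'(1) UV(1)]] cfun_norm_le[OF cfun_diff[OF UV'(2) UV(2)]] b)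
    have "slice_calc h - slice_calc g = (U' - U) + (J o\<^sub>L (V' - V))"
      unfolding UV UV' by (rule blinfun_eqI) (simp add: blinfun.bilinear_simps algebra_simps)
    also have "norm \<dots> \<le> norm (U' - U) + norm J * norm (V' - V)"
      using norm_triangle_ineq norm_blinfun_compose by (meson add_left_mono order_trans)
    also have "\<dots> \<le> d + norm J * d" using n by (intro add_mono mult_left_mono) auto
    also have "\<dots> < e" using d(2) by (simp add: algebra_simps)
    finally show "norm (slice_calc h - slice_calc g) < e" .
  qed (rule d(1))
next
  have "stem_at_i (\<lambda>q. 1) = (\<lambda>z. 1)" by (simp add: fun_eq_iff stem_at_i_def complex_eq_iff)
  then have "slice_calc (\<lambda>q. 1) = 1 *\<^sub>R id_blinfun + (J o\<^sub>L (0 *\<^sub>R id_blinfun))"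
    by (intro slice_calc_eq[OF cfun_calc[OF calc_const] cfun_calc[OF calc_const]])
       (auto simp: complex_eq_iff)
  then show "slice_calc (\<lambda>q. 1) = id_blinfun" by simp
next
  have "stem_at_i (\<lambda>q. q) = (\<lambda>z. z)"
    by (simp add: fun_eq_iff stem_at_i_def complex_eq_iff slice_def quat_sel_mult)
  then have "slice_calc (\<lambda>q. q) = A + (J o\<^sub>L B)"
    by (intro slice_calc_eq[OF cfun_calc[OF calc_coordinates(1)] cfun_calc[OF calc_coordinates(2)]])
       (auto simp: complex_eq_iff)
  then show "slice_calc (\<lambda>q. q) = T" by (simp add: T_eq)
qed

lemma real_slice_calculus: "is_real_slice_calculus T (real_slice_calculus T)"
  unfolding real_slice_calculus_def by (rule someI[of _ slice_calc]) (rule slice_calc_is_calculus)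

end

text \<open>Applying J to J B = T - A and using that J squares to -1 gives B = - (1/2) J (T -
  \<open>adj T\<close>). In this form self-adjointness and the commutation relations of B follow
  from those of J, T and \<open>adj T\<close>.\<close>

lemma normal_decomposition_intro:
  fixes T A B J :: "'h::quaternionic_hilbert \<Rightarrow>\<^sub>L 'h"
  assumes T: "T \<in> \<BB>" "normal_op T"
    and A: "A = (1/2) *\<^sub>R (T + adj T)"
    and J: "J \<in> \<BB>" "anti_self_adjoint J" "unitary_op J"
      "T o\<^sub>L J = J o\<^sub>L T" "adj T o\<^sub>L J = J o\<^sub>L adj T" "T = A + (J o\<^sub>L B)"
  shows "normal_decomposition T A B J"
proof -
  note adjT = adj_works(1)[OF T(1)]
  have TT: "commutes T (adj T)" using T(2) by (simp add: normal_op_def commutes_iff_compose)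
  have JT: "commutes J T" "commutes J (adj T)" using J(4,5) by (simp_all add: commutes_iff_compose)
  have JJ: "J (J u) = - u" for u
  proof -
    have "adj J o\<^sub>L J = id_blinfun" "adj J = - J" using J(2,3) by (auto simp: anti_self_adjoint_def unitary_op_def)
    then have "- J (J u) = u" by (metis blinfun_apply_blinfun_compose blinfun_apply_id_blinfun id_apply blinfun.minus_left)
    then show ?thesis by (metis minus_minus)
  qed
  have Janti: "rinner (J u) v = - rinner u (J v)" for u v
    using adj_rinner[OF J(1), of u v] J(2) by (simp add: anti_self_adjoint_def blinfun.bilinear_simps rinner_simps)
  have TA: "J (B u) = T u - A u" for u
    using arg_cong[OF J(6), of "\<lambda>S. blinfun_apply S u"] by (simp add: blinfun.bilinear_simps)
  have B: "B = (-1/2) *\<^sub>R (J o\<^sub>L (T - adj T))"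
  proof (rule blinfun_eqI)
    fix u
    have "B u = - J (J (B u))" by (simp add: JJ)
    also have "\<dots> = - J (T u - A u)" by (simp add: TA)
    also have "T u - A u = (1/2) *\<^sub>R (T u - adj T u)"
      by (simp add: A blinfun.bilinear_simps algebra_simps flip: scaleR_add_left)
    finally show "B u = ((-1/2) *\<^sub>R (J o\<^sub>L (T - adj T))) u" by (simp add: blinfun.bilinear_simps)
  qed
  have adjr: "rinner (adj T u) v = rinner u (T v)" "rinner (T u) v = rinner u (adj T v)" for u v
    using adj_rinner[OF T(1)] by (auto simp: rinner_commute[of "T u"] rinner_commute[of u "adj T v"])
  have Jc: "T (J u) = J (T u)" "adj T (J u) = J (adj T u)" for u using JT by (simp_all add: commutes_def)
  show ?thesis
  proof
    show "A \<in> \<BB>" "B \<in> \<BB>" "J \<in> \<BB>" unfolding A B using T adjT J(1) by auto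
    show "self_adj A" unfolding self_adj_def A by (simp add: blinfun.bilinear_simps rinner_simps adjr)
    show "self_adj B" unfolding self_adj_def B by (simp add: blinfun.bilinear_simps rinner_simps adjr Janti Jc)
    show "commutes A B" unfolding A B
      by (intro commutes_intros commutes_refl commutes_sym[OF JT(1)] commutes_sym[OF JT(2)] TT commutes_sym[OF TT])
    show "commutes J A" unfolding A by (intro commutes_intros JT)
    show "commutes J B" unfolding B by (intro commutes_intros commutes_refl JT)
  qed (fact Janti JJ J(6))+
qed

section \<open>Riemann-Stieltjes integrals along rectifiable paths\<close>

abbreviation fine_tagged :: "real \<Rightarrow> (real \<times> real set) set \<Rightarrow> bool" where
  "fine_tagged d p \<equiv> p tagged_division_of {0..1} \<and> (\<lambda>t. ball t d) fine p"

abbreviation riemann_sum ::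
    "(complex \<Rightarrow> complex \<Rightarrow> 'b::real_normed_vector) \<Rightarrow> (real \<Rightarrow> complex) \<Rightarrow> (real \<times> real set) set \<Rightarrow> 'b" where
  "riemann_sum G \<gamma> p \<equiv> \<Sum>(t, I)\<in>p. G (\<gamma> t) (\<gamma> (Sup I) - \<gamma> (Inf I))"

text \<open>The value 0 at the empty set makes increments additive over intersections of cells,
  which may be empty.\<close>

definition increment :: "(real \<Rightarrow> 'a::real_normed_vector) \<Rightarrow> real set \<Rightarrow> 'a" where
  "increment \<gamma> K = (if K = {} then 0 else \<gamma> (Sup K) - \<gamma> (Inf K))"

lemma increment_division: "d division_of {a..b} \<Longrightarrow> sum (increment \<gamma>) d = increment \<gamma> {a..b}"
proof -
  interpret operative_real plus 0 "increment \<gamma>"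
    rewrites "comm_monoid_set.F (+) 0 = sum"
    by standard[1] (auto simp: sum_def increment_def)
  show "d division_of {a..b} \<Longrightarrow> sum (increment \<gamma>) d = increment \<gamma> {a..b}" by (rule division)
qed

lemma increment_interior_empty:
  assumes "K = {a..b}" "interior K = {}" shows "increment \<gamma> K = 0"
  using assms by (cases a b rule: linorder_cases) (auto simp: increment_def interior_atLeastAtMost_real)

lemma tagged_cells:
  fixes p :: "(real \<times> real set) set"
  assumes "p tagged_division_of {0..1::real}" "(t, K) \<in> p"
  shows "t \<in> K" "t \<in> {0..1}" "\<exists>a b. K = {a..b}" "K \<subseteq> {0..1}" "K \<noteq> {}"
  using tagged_division_ofD(2-4)[OF assms] by auto

lemma interval_Int_exists: "\<exists>a b. I = {a..b::real} \<Longrightarrow> \<exists>a b. K = {a..b} \<Longrightarrow> \<exists>a b. I \<inter> K = {a..b}"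
  by (metis Int_atLeastAtMost)

text \<open>The sum runs over tagged cells, while additivity speaks of a set of intervals. Two
  tagged cells with the same trace on I meet in a set with empty interior, where the increment is 0,
  so the reindexing loses nothing.\<close>

lemma increment_split:
  fixes p :: "(real \<times> real set) set"
  assumes p: "p tagged_division_of {0..1::real}" and I: "I = {a..b}" "a \<le> b" "I \<subseteq> {0..1}"
  shows "(\<Sum>x\<in>p. increment \<gamma> (I \<inter> snd x)) = increment \<gamma> I"
proof -
  note fin = tagged_division_ofD(1)[OF p]
  define \<D> where "\<D> = {k1 \<inter> k2 |k1 k2. k1 \<in> {I} \<and> k2 \<in> snd ` p \<and> k1 \<inter> k2 \<noteq> {}}"
  have "{I} division_of I" using I by (simp add: division_of_self[of a b, unfolded box_real])
  from division_inter[OF this division_of_tagged_division[OF p]]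
  have D: "\<D> division_of {a..b}" using I by (simp add: \<D>_def Int_absorb2)
  have "(\<Sum>x\<in>p. increment \<gamma> (I \<inter> snd x)) = sum (increment \<gamma>) ((\<lambda>x. I \<inter> snd x) ` p)"
  proof (subst sum.reindex_nontrivial[OF fin])
    fix x y assume xy: "x \<in> p" "y \<in> p" "x \<noteq> y" "I \<inter> snd x = I \<inter> snd y"
    have "interior (snd x) \<inter> interior (snd y) = {}"
      using tagged_division_ofD(5)[OF p, of "fst x" "snd x" "fst y" "snd y"] xy by simp
    then have "interior (I \<inter> snd x) = {}"
      using xy(4) interior_mono[of "I \<inter> snd x" "snd x"] interior_mono[of "I \<inter> snd x" "snd y"] by auto
    moreover have "\<exists>a b. I \<inter> snd x = {a..b}"
      using tagged_cells(3)[OF p, of "fst x" "snd x"] xy(1) I by (intro interval_Int_exists) auto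
    ultimately show "increment \<gamma> (I \<inter> snd x) = 0" using increment_interior_empty by blast
  qed simp
  also have "\<dots> = sum (increment \<gamma>) \<D>"
    by (rule sum.mono_neutral_right) (use fin in \<open>auto simp: \<D>_def increment_def\<close>)
  also have "\<dots> = increment \<gamma> I" using increment_division[OF D] I by simp
  finally show ?thesis .
qed

definition variation_bound :: "(real \<Rightarrow> complex) \<Rightarrow> real \<Rightarrow> bool" where
  "variation_bound \<gamma> V \<longleftrightarrow> 0 \<le> V \<and> (\<forall>\<D>. \<D> division_of {0..1} \<longrightarrow>
     (\<Sum>I\<in>\<D>. norm (\<gamma> (Sup I) - \<gamma> (Inf I))) \<le> V)"

lemma rectifiable_variation_bound: "rectifiable \<gamma> \<Longrightarrow> \<exists>V. variation_bound \<gamma> V"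
proof -
  assume "rectifiable \<gamma>"
  then obtain M where M: "\<forall>\<D>. \<D> division_of {0..1} \<longrightarrow> (\<Sum>I\<in>\<D>. norm (\<gamma> (Sup I) - \<gamma> (Inf I))) \<le> M"
    unfolding rectifiable_def by blast
  have "variation_bound \<gamma> (max 0 M)"
    unfolding variation_bound_def using M by (auto simp: le_max_iff_disj)
  then show ?thesis by blast
qed

lemma division_increment_le:
  assumes "variation_bound \<gamma> V" "\<D> division_of {0..1}"
  shows "(\<Sum>I\<in>\<D>. norm (increment \<gamma> I)) \<le> V"
proof -
  have "(\<Sum>I\<in>\<D>. norm (increment \<gamma> I)) = (\<Sum>I\<in>\<D>. norm (\<gamma> (Sup I) - \<gamma> (Inf I)))"
    using division_ofD(3)[OF assms(2)] by (intro sum.cong) (auto simp: increment_def)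
  then show ?thesis using assms unfolding variation_bound_def by auto
qed

lemma tagged_increment_le:
  fixes p :: "(real \<times> real set) set"
  assumes V: "variation_bound \<gamma> V" and p: "p tagged_division_of {0..1::real}"
  shows "(\<Sum>x\<in>p. norm (increment \<gamma> (snd x))) \<le> V"
proof -
  have "(\<Sum>(t, K)\<in>p. norm (increment \<gamma> K)) = (\<Sum>K\<in>snd ` p. norm (increment \<gamma> K))"
  proof (rule sum.over_tagged_division_lemma[OF p])
    fix u v :: real assume "box u v = {}"
    then show "norm (increment \<gamma> (cbox u v)) = 0"
      using increment_interior_empty[of "{u..v}" u v \<gamma>] by (simp add: interior_atLeastAtMost_real)
  qed
  with division_increment_le[OF V division_of_tagged_division[OF p]] show ?thesis
    by (simp add: case_prod_beta)
qed

text \<open>The nonempty intersections form a division of the unit interval; an intersection that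
  occurs for several pairs of cells is degenerate and contributes 0.\<close>

lemma common_refinement_le:
  fixes p q :: "(real \<times> real set) set"
  assumes V: "variation_bound \<gamma> V" and p: "p tagged_division_of {0..1::real}" and q: "q tagged_division_of {0..1::real}"
  shows "(\<Sum>x\<in>p. \<Sum>y\<in>q. norm (increment \<gamma> (snd x \<inter> snd y))) \<le> V"
proof -
  note fin = tagged_division_ofD(1)[OF p] tagged_division_ofD(1)[OF q]
  define \<D> where "\<D> = {k1 \<inter> k2 |k1 k2. k1 \<in> snd ` p \<and> k2 \<in> snd ` q \<and> k1 \<inter> k2 \<noteq> {}}"
  define \<phi> where "\<phi> z = snd (fst z) \<inter> snd (snd z)" for z :: "(real \<times> real set) \<times> (real \<times> real set)"
  from division_inter[OF division_of_tagged_division[OF p] division_of_tagged_division[OF q]]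
  have D: "\<D> division_of {0..1}" by (simp add: \<D>_def)
  have "(\<Sum>x\<in>p. \<Sum>y\<in>q. norm (increment \<gamma> (snd x \<inter> snd y))) = (\<Sum>z\<in>p \<times> q. norm (increment \<gamma> (\<phi> z)))"
    by (simp add: sum.cartesian_product \<phi>_def case_prod_beta)
  also have "\<dots> = (\<Sum>K\<in>\<phi> ` (p \<times> q). norm (increment \<gamma> K))"
  proof (subst sum.reindex_nontrivial)
    fix z w assume zw: "z \<in> p \<times> q" "w \<in> p \<times> q" "z \<noteq> w" "\<phi> z = \<phi> w"
    have sub: "\<phi> z \<subseteq> snd (fst z)" "\<phi> z \<subseteq> snd (fst w)" "\<phi> z \<subseteq> snd (snd z)" "\<phi> z \<subseteq> snd (snd w)"
      using zw(4) by (auto simp: \<phi>_def)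
    have "interior (\<phi> z) = {}"
    proof (cases "fst z = fst w")
      case False
      then have "interior (snd (fst z)) \<inter> interior (snd (fst w)) = {}"
        using tagged_division_ofD(5)[OF p, of "fst (fst z)" "snd (fst z)" "fst (fst w)" "snd (fst w)"] zw by auto
      then show ?thesis using interior_mono[OF sub(1)] interior_mono[OF sub(2)] by auto
    next
      case True
      then have "snd z \<noteq> snd w" using zw(3) by (simp add: prod_eq_iff)
      then have "interior (snd (snd z)) \<inter> interior (snd (snd w)) = {}"
        using tagged_division_ofD(5)[OF q, of "fst (snd z)" "snd (snd z)" "fst (snd w)" "snd (snd w)"] zw by auto
      then show ?thesis using interior_mono[OF sub(3)] interior_mono[OF sub(4)] by auto
    qed
    moreover have "\<exists>a b. \<phi> z = {a..b}"
      unfolding \<phi>_def using zw(1) tagged_cells(3)[OF p, of "fst (fst z)" "snd (fst z)"]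
        tagged_cells(3)[OF q, of "fst (snd z)" "snd (snd z)"]
      by (intro interval_Int_exists) auto
    ultimately show "norm (increment \<gamma> (\<phi> z)) = 0" using increment_interior_empty by (metis norm_zero)
  qed (use fin in auto)
  also have "\<dots> = (\<Sum>K\<in>\<D>. norm (increment \<gamma> K))"
  proof (rule sum.mono_neutral_right)
    show "\<D> \<subseteq> \<phi> ` (p \<times> q)"
    proof
      fix K assume "K \<in> \<D>"
      then obtain x y where "x \<in> p" "y \<in> q" "K = snd x \<inter> snd y" unfolding \<D>_def by blast
      then show "K \<in> \<phi> ` (p \<times> q)" unfolding \<phi>_def by (intro image_eqI[of _ _ "(x, y)"]) auto
    qed
    show "\<forall>K\<in>\<phi> ` (p \<times> q) - \<D>. norm (increment \<gamma> K) = 0"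
    proof
      fix K assume K: "K \<in> \<phi> ` (p \<times> q) - \<D>"
      then obtain x y where xy: "x \<in> p" "y \<in> q" "K = snd x \<inter> snd y" by (auto simp: \<phi>_def)
      then have "K = {}" using K unfolding \<D>_def by blast
      then show "norm (increment \<gamma> K) = 0" by (simp add: increment_def)
    qed
  qed (use fin in auto)
  also have "\<dots> \<le> V" by (rule division_increment_le[OF V D])
  finally show ?thesis .
qed

definition rsum :: "(complex \<Rightarrow> complex) \<Rightarrow> (real \<Rightarrow> complex) \<Rightarrow> (real \<times> real set) set \<Rightarrow> complex" where
  "rsum g \<gamma> p = (\<Sum>(t, I)\<in>p. g (\<gamma> t) * (\<gamma> (Sup I) - \<gamma> (Inf I)))"

lemma rsum_increment:
  assumes "p tagged_division_of {0..1::real}"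
  shows "rsum g \<gamma> p = (\<Sum>x\<in>p. g (\<gamma> (fst x)) * increment \<gamma> (snd x))"
  unfolding rsum_def using tagged_cells(5)[OF assms]
  by (intro sum.cong) (auto simp: increment_def)

text \<open>Both sums are expanded over the common refinement. Two cells that meet lie in balls of
  radius d around their tags, so the tags are less than 2 d apart.\<close>

lemma rsum_compare:
  assumes V: "variation_bound \<gamma> V"
    and p: "p tagged_division_of {0..1::real}" "(\<lambda>t. ball t d) fine p"
    and q: "q tagged_division_of {0..1::real}" "(\<lambda>t. ball t d) fine q"
    and g: "\<And>t t'. t \<in> {0..1} \<Longrightarrow> t' \<in> {0..1} \<Longrightarrow> dist t t' < 2 * d \<Longrightarrow> norm (g (\<gamma> t) - g (\<gamma> t')) \<le> e" and e: "0 \<le> e"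
  shows "norm (rsum g \<gamma> p - rsum g \<gamma> q) \<le> e * V"
proof -
  have split: "rsum g \<gamma> p = (\<Sum>x\<in>p. \<Sum>y\<in>q. g (\<gamma> (fst x)) * increment \<gamma> (snd x \<inter> snd y))"
    if p: "p tagged_division_of {0..1::real}" and q: "q tagged_division_of {0..1::real}" for p q
    unfolding rsum_increment[OF p]
  proof (rule sum.cong[OF refl])
    fix x assume x: "x \<in> p"
    then obtain a b where "snd x = {a..b}" "a \<le> b" "snd x \<subseteq> {0..1}"
      using tagged_cells[OF p, of "fst x" "snd x"] by auto
    from increment_split[OF q this, of \<gamma>]
    show "g (\<gamma> (fst x)) * increment \<gamma> (snd x) = (\<Sum>y\<in>q. g (\<gamma> (fst x)) * increment \<gamma> (snd x \<inter> snd y))"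
      by (simp flip: sum_distrib_left)
  qed
  have "rsum g \<gamma> q = (\<Sum>x\<in>p. \<Sum>y\<in>q. g (\<gamma> (fst y)) * increment \<gamma> (snd x \<inter> snd y))"
    unfolding split[OF q(1) p(1)] by (subst sum.swap) (simp add: Int_commute)
  then have "rsum g \<gamma> p - rsum g \<gamma> q =
      (\<Sum>x\<in>p. \<Sum>y\<in>q. (g (\<gamma> (fst x)) - g (\<gamma> (fst y))) * increment \<gamma> (snd x \<inter> snd y))"
    by (simp add: split[OF p(1) q(1)] left_diff_distrib flip: sum_subtractf)
  also have "norm \<dots> \<le> (\<Sum>x\<in>p. \<Sum>y\<in>q. e * norm (increment \<gamma> (snd x \<inter> snd y)))"
  proof (intro sum_norm_le)
    fix x y assume x: "x \<in> p" and y: "y \<in> q"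
    show "norm ((g (\<gamma> (fst x)) - g (\<gamma> (fst y))) * increment \<gamma> (snd x \<inter> snd y)) \<le> e * norm (increment \<gamma> (snd x \<inter> snd y))"
    proof (cases "snd x \<inter> snd y = {}")
      case False
      then obtain s where s: "s \<in> snd x" "s \<in> snd y" by auto
      have "snd x \<subseteq> ball (fst x) d" "snd y \<subseteq> ball (fst y) d"
        using fineD[OF p(2), of "fst x" "snd x"] fineD[OF q(2), of "fst y" "snd y"] x y by auto
      with s have "dist (fst x) s < d" "dist (fst y) s < d" by auto
      then have "dist (fst x) (fst y) < 2 * d" using dist_triangle_less_add by fastforce
      moreover have "fst x \<in> {0..1}" "fst y \<in> {0..1}"
        using tagged_cells(2)[OF p(1), of "fst x" "snd x"] tagged_cells(2)[OF q(1), of "fst y" "snd y"] x y by auto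
      ultimately have "norm (g (\<gamma> (fst x)) - g (\<gamma> (fst y))) \<le> e" by (intro g)
      then show ?thesis by (simp add: norm_mult mult_right_mono)
    qed (simp add: increment_def)
  qed
  also have "\<dots> = e * (\<Sum>x\<in>p. \<Sum>y\<in>q. norm (increment \<gamma> (snd x \<inter> snd y)))"
    by (simp add: sum_distrib_left)
  also have "\<dots> \<le> e * V" by (rule mult_left_mono[OF common_refinement_le[OF V p(1) q(1)] e])
  finally show ?thesis .
qed

lemma ball_fine_exists:
  assumes "d > 0" obtains p where "p tagged_division_of {0..1::real}" "(\<lambda>t. ball t d) fine p"
  using fine_division_exists_real[OF gauge_ball[OF assms], of 0 1] by blast

lemma fine_ball_mono: "d \<le> d' \<Longrightarrow> (\<lambda>t. ball t d) fine p \<Longrightarrow> (\<lambda>t. ball t d') fine p" for p :: "(real \<times> real set) set"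
  unfolding fine_def by (fastforce dest: subset_ball[of d d'])

lemma has_line_integral_unique:
  assumes "has_line_integral G \<gamma> X" "has_line_integral G \<gamma> Y" shows "X = Y"
proof (rule ccontr)
  assume "X \<noteq> Y"
  then have e: "norm (X - Y) / 2 > 0" by simp
  obtain d where d: "d > 0" "\<And>p. p tagged_division_of {0..1::real} \<Longrightarrow> (\<lambda>t. ball t d) fine p \<Longrightarrow>
      norm (riemann_sum G \<gamma> p - X) < norm (X - Y) / 2"
    using assms(1) e unfolding has_line_integral_def by meson
  obtain d' where d': "d' > 0" "\<And>p. p tagged_division_of {0..1::real} \<Longrightarrow> (\<lambda>t. ball t d') fine p \<Longrightarrow>
      norm (riemann_sum G \<gamma> p - Y) < norm (X - Y) / 2"
    using assms(2) e unfolding has_line_integral_def by meson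
  obtain p where p: "p tagged_division_of {0..1::real}" "(\<lambda>t. ball t (min d d')) fine p"
    using ball_fine_exists[of "min d d'"] d(1) d'(1) by auto
  have "(\<lambda>t. ball t d) fine p" "(\<lambda>t. ball t d') fine p" by (rule fine_ball_mono[OF _ p(2)]; simp)+
  from d(2)[OF p(1) this(1)] d'(2)[OF p(1) this(2)] show False
    using norm_triangle_ineq4[of "riemann_sum G \<gamma> p - Y" "riemann_sum G \<gamma> p - X"]
    by simp
qed

lemma line_integral_eq: "has_line_integral G \<gamma> X \<Longrightarrow> line_integral G \<gamma> = X"
  unfolding line_integral_def using has_line_integral_unique by blast

lemma has_line_integral_add:
  assumes "has_line_integral G \<gamma> X" "has_line_integral H \<gamma> Y"
  shows "has_line_integral (\<lambda>s ds. G s ds + H s ds) \<gamma> (X + Y)"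
  unfolding has_line_integral_def
proof (intro allI impI)
  fix e :: real assume e: "e > 0"
  obtain d where d: "d > 0" "\<And>p. p tagged_division_of {0..1} \<Longrightarrow> (\<lambda>t. ball t d) fine p \<Longrightarrow>
      norm (riemann_sum G \<gamma> p - X) < e / 2"
    using assms(1) half_gt_zero[OF e] unfolding has_line_integral_def by meson
  obtain d' where d': "d' > 0" "\<And>p. p tagged_division_of {0..1} \<Longrightarrow> (\<lambda>t. ball t d') fine p \<Longrightarrow>
      norm (riemann_sum H \<gamma> p - Y) < e / 2"
    using assms(2) half_gt_zero[OF e] unfolding has_line_integral_def by meson
  show "\<exists>d>0. \<forall>p. fine_tagged d p \<longrightarrow>
     norm ((\<Sum>(t, I)\<in>p. G (\<gamma> t) (\<gamma> (Sup I) - \<gamma> (Inf I)) + H (\<gamma> t) (\<gamma> (Sup I) - \<gamma> (Inf I))) - (X + Y)) < e"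
  proof (intro exI[of _ "min d d'"] conjI allI impI)
    fix p :: "(real \<times> real set) set" assume p: "fine_tagged (min d d') p"
    have f: "(\<lambda>t. ball t d) fine p" "(\<lambda>t. ball t d') fine p"
      by (rule fine_ball_mono[OF _ conjunct2[OF p]]; simp)+
    have "(\<Sum>(t, I)\<in>p. G (\<gamma> t) (\<gamma> (Sup I) - \<gamma> (Inf I)) + H (\<gamma> t) (\<gamma> (Sup I) - \<gamma> (Inf I))) - (X + Y) =
       (riemann_sum G \<gamma> p - X) + (riemann_sum H \<gamma> p - Y)"
      by (simp add: case_prod_beta sum.distrib)
    moreover have "norm ((riemann_sum G \<gamma> p - X) +
        (riemann_sum H \<gamma> p - Y)) < e"
      by (rule norm_triangle_lt) (use d(2)[OF conjunct1[OF p] f(1)] d'(2)[OF conjunct1[OF p] f(2)] in simp)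
    ultimately show "norm ((\<Sum>(t, I)\<in>p. G (\<gamma> t) (\<gamma> (Sup I) - \<gamma> (Inf I)) + H (\<gamma> t) (\<gamma> (Sup I) - \<gamma> (Inf I))) - (X + Y)) < e"
      by (simp only:)
  qed (use d d' in simp)
qed

lemma has_line_integral_bounded_linear:
  assumes "bounded_linear F" "has_line_integral G \<gamma> X"
  shows "has_line_integral (\<lambda>s ds. F (G s ds)) \<gamma> (F X)"
  unfolding has_line_integral_def
proof (intro allI impI)
  interpret bounded_linear F by fact
  obtain K where K: "K > 0" "\<And>x. norm (F x) \<le> norm x * K" using pos_bounded by blast
  fix e :: real assume e: "e > 0"
  then have "e / K > 0" using K by simp
  then obtain d where d: "d > 0" "\<And>p. fine_tagged d p \<Longrightarrow>
      norm (riemann_sum G \<gamma> p - X) < e / K"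
    using assms(2) unfolding has_line_integral_def by meson
  show "\<exists>d>0. \<forall>p. fine_tagged d p \<longrightarrow>
     norm ((\<Sum>(t, I)\<in>p. F (G (\<gamma> t) (\<gamma> (Sup I) - \<gamma> (Inf I)))) - F X) < e"
  proof (intro exI[of _ d] conjI allI impI)
    fix p :: "(real \<times> real set) set" assume p: "fine_tagged d p"
    have "(\<Sum>(t, I)\<in>p. F (G (\<gamma> t) (\<gamma> (Sup I) - \<gamma> (Inf I)))) - F X =
        F (riemann_sum G \<gamma> p - X)"
      by (simp add: case_prod_beta diff sum)
    also have "norm \<dots> \<le> norm (riemann_sum G \<gamma> p - X) * K" by (rule K(2))
    also have "\<dots> < e" using d(2)[OF p] K(1) by (simp add: pos_less_divide_eq)
    finally show "norm ((\<Sum>(t, I)\<in>p. F (G (\<gamma> t) (\<gamma> (Sup I) - \<gamma> (Inf I)))) - F X) < e" .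
  qed (rule d(1))
qed

lemma has_line_integral_cong:
  assumes "\<And>s ds. s \<in> path_image \<gamma> \<Longrightarrow> G s ds = H s ds" "has_line_integral G \<gamma> X"
  shows "has_line_integral H \<gamma> X"
proof -
  have r: "riemann_sum H \<gamma> p = riemann_sum G \<gamma> p"
    if p: "p tagged_division_of {0..1}" for p :: "(real \<times> real set) set"
    using tagged_cells(2)[OF p] by (intro sum.cong) (auto simp: assms(1) path_image_def)
  show ?thesis
    unfolding has_line_integral_def
  proof (intro allI impI)
    fix e :: real assume "e > 0"
    then obtain d where d: "d > 0" "\<forall>p. fine_tagged d p \<longrightarrow>
        norm (riemann_sum G \<gamma> p - X) < e"
      using assms(2) unfolding has_line_integral_def by blast
    then show "\<exists>d>0. \<forall>p. fine_tagged d p \<longrightarrow>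
        norm (riemann_sum H \<gamma> p - X) < e"
      by (intro exI[of _ d]) (simp add: r)
  qed
qed

abbreviation integrand :: "(complex \<Rightarrow> complex) \<Rightarrow> complex \<Rightarrow> complex \<Rightarrow> complex" where
  "integrand g \<equiv> \<lambda>s ds. g s * ds"

lemma has_line_integral_rsum:
  "has_line_integral (integrand g) \<gamma> X \<longleftrightarrow> (\<forall>e>0. \<exists>d>0. \<forall>p. fine_tagged d p \<longrightarrow>
     norm (rsum g \<gamma> p - X) < e)"
  by (simp add: has_line_integral_def rsum_def)

text \<open>Comparing with ever finer divisions passes to the limit and keeps an error bound that
  depends only on the modulus of continuity and V.\<close>

lemma rsum_limit:
  assumes V: "variation_bound \<gamma> V" and X: "has_line_integral (integrand g) \<gamma> X"
    and p: "p tagged_division_of {0..1::real}" "(\<lambda>t. ball t d) fine p" and d: "d > 0"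
    and g: "\<And>t t'. t \<in> {0..1} \<Longrightarrow> t' \<in> {0..1} \<Longrightarrow> dist t t' < 2 * d \<Longrightarrow> norm (g (\<gamma> t) - g (\<gamma> t')) \<le> e" and e: "0 \<le> e"
  shows "norm (rsum g \<gamma> p - X) \<le> e * V"
proof (rule field_le_epsilon)
  fix \<epsilon> :: real assume "\<epsilon> > 0"
  then obtain d' where d': "d' > 0" "\<And>q. q tagged_division_of {0..1::real} \<Longrightarrow> (\<lambda>t. ball t d') fine q \<Longrightarrow> norm (rsum g \<gamma> q - X) < \<epsilon>"
    using X unfolding has_line_integral_rsum by meson
  obtain q where q: "q tagged_division_of {0..1::real}" "(\<lambda>t. ball t (min d d')) fine q"
    using ball_fine_exists[of "min d d'"] d d'(1) by auto
  have f: "(\<lambda>t. ball t d) fine q" "(\<lambda>t. ball t d') fine q" by (rule fine_ball_mono[OF _ q(2)]; simp)+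
  have "norm (rsum g \<gamma> p - rsum g \<gamma> q) \<le> e * V"
    by (rule rsum_compare[where g = g, OF V p q(1) f(1) g e])
  moreover have "norm (rsum g \<gamma> q - X) < \<epsilon>" by (rule d'(2)[OF q(1) f(2)])
  ultimately show "norm (rsum g \<gamma> p - X) \<le> e * V + \<epsilon>"
    using norm_triangle_ineq[of "rsum g \<gamma> p - rsum g \<gamma> q" "rsum g \<gamma> q - X"] by simp
qed

text \<open>The parameter w runs through a compact set, so that one d serves all integrands of the
  family.\<close>

lemma path_modulus:
  fixes g :: "'b::metric_space \<Rightarrow> complex \<Rightarrow> complex"
  assumes \<gamma>: "path \<gamma>" and g: "continuous_on (path_image \<gamma> \<times> K) (\<lambda>(s, w). g w s)" and K: "compact K" and e: "e > 0"
  shows "\<exists>d>0. \<forall>w\<in>K. \<forall>t\<in>{0..1}. \<forall>t'\<in>{0..1}. dist t t' < 2 * d \<longrightarrow> norm (g w (\<gamma> t) - g w (\<gamma> t')) \<le> e"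
proof -
  have "continuous_on ({0..1} \<times> K) ((\<lambda>(s, w). g w s) \<circ> (\<lambda>(t, w). (\<gamma> t, w)))"
  proof (rule continuous_on_compose)
    have "continuous_on ({0..1} \<times> K) (\<lambda>z. (\<gamma> (fst z), snd z))"
      using \<gamma> unfolding path_def
      by (intro continuous_on_Pair continuous_on_snd continuous_on_id continuous_on_compose2[OF _ continuous_on_fst[OF continuous_on_id]]) auto
    then show "continuous_on ({0..1} \<times> K) (\<lambda>(t, w). (\<gamma> t, w))" by (simp add: case_prod_beta)
    show "continuous_on ((\<lambda>(t, w). (\<gamma> t, w)) ` ({0..1} \<times> K)) (\<lambda>(s, w). g w s)"
      by (rule continuous_on_subset[OF g]) (auto simp: path_image_def)
  qed
  then have "uniformly_continuous_on ({0..1} \<times> K) (\<lambda>(t, w). g w (\<gamma> t))"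
    using K by (intro compact_uniformly_continuous compact_Times) (auto simp: o_def case_prod_beta)
  then obtain d where d: "d > 0" "\<And>x y. x \<in> {0..1} \<times> K \<Longrightarrow> y \<in> {0..1} \<times> K \<Longrightarrow> dist y x < d \<Longrightarrow>
      dist ((\<lambda>(t, w). g w (\<gamma> t)) y) ((\<lambda>(t, w). g w (\<gamma> t)) x) < e"
    using e unfolding uniformly_continuous_on_def by metis
  show ?thesis
  proof (intro exI[of _ "d / 2"] conjI ballI impI)
    fix w t t' assume "w \<in> K" "t \<in> {0..1::real}" "t' \<in> {0..1}" "dist t t' < 2 * (d / 2)"
    then show "norm (g w (\<gamma> t) - g w (\<gamma> t')) \<le> e"
      using d(2)[of "(t', w)" "(t, w)"] by (simp add: dist_Pair_Pair) (simp add: dist_norm)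
  qed (use d in simp)
qed

lemma has_line_integral_exists:
  assumes \<gamma>: "path \<gamma>" "rectifiable \<gamma>" and g: "continuous_on (path_image \<gamma>) g"
  shows "\<exists>X. has_line_integral (integrand g) \<gamma> X"
proof -
  obtain V where V: "variation_bound \<gamma> V" using rectifiable_variation_bound[OF \<gamma>(2)] by blast
  have V0: "V \<ge> 0" using V by (simp add: variation_bound_def)
  \<comment> \<open>A single integrand is treated as a family over the one-point parameter
    set.\<close>
  have gp: "continuous_on (path_image \<gamma> \<times> {0::real}) (\<lambda>(s, w). g s)"
    unfolding case_prod_beta by (intro continuous_on_compose2[OF g continuous_on_fst[OF continuous_on_id]]) auto
  have mod: "\<exists>d>0. \<forall>p q. fine_tagged d p \<and>
     fine_tagged d q \<longrightarrow> norm (rsum g \<gamma> p - rsum g \<gamma> q) < e" if e: "e > 0" for e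
  proof -
    \<comment> \<open>Dividing by V + 1 instead of V also covers a constant path.\<close>
    have e': "e / (V + 1) > 0" "e / (V + 1) * V < e" using e V0 by (auto simp: field_simps)
    obtain d where d: "d > 0" "\<forall>t\<in>{0..1}. \<forall>t'\<in>{0..1}. dist t t' < 2 * d \<longrightarrow> norm (g (\<gamma> t) - g (\<gamma> t')) \<le> e / (V + 1)"
      using path_modulus[OF \<gamma>(1) gp _ e'(1)] by auto
    show ?thesis
    proof (intro exI[of _ d] conjI allI impI)
      fix p q assume "fine_tagged d p \<and> fine_tagged d q"
      then have "norm (rsum g \<gamma> p - rsum g \<gamma> q) \<le> e / (V + 1) * V"
        using d(2) e'(1) by (intro rsum_compare[OF V, where d = d]) auto
      with e'(2) show "norm (rsum g \<gamma> p - rsum g \<gamma> q) < e" by linarith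
    qed (rule d(1))
  qed
  have "\<exists>p. p tagged_division_of {0..1::real} \<and> (\<lambda>t::real. ball t (1 / real (Suc n))) fine p" for n
    using ball_fine_exists[of "1 / real (Suc n)"] by (metis of_nat_0_less_iff zero_less_Suc zero_less_divide_1_iff)
  then obtain P where P: "\<And>n. P n tagged_division_of {0..1::real}" "\<And>n. (\<lambda>t::real. ball t (1 / real (Suc n))) fine P n" by metis
  have small: "\<exists>N. \<forall>n\<ge>N. 1 / real (Suc n) < d" if "d > 0" for d
    using order_tendstoD(2)[OF LIMSEQ_Suc[OF lim_1_over_n] that] by (simp add: eventually_sequentially)
  have "Cauchy (\<lambda>n. rsum g \<gamma> (P n))"
  proof (rule metric_CauchyI)
    fix e :: real assume e: "e > 0"
    obtain d where d: "d > 0" "\<And>p q. p tagged_division_of {0..1::real} \<Longrightarrow> (\<lambda>t. ball t d) fine p \<Longrightarrow>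
     q tagged_division_of {0..1::real} \<Longrightarrow> (\<lambda>t. ball t d) fine q \<Longrightarrow> norm (rsum g \<gamma> p - rsum g \<gamma> q) < e"
      using mod[OF e] by blast
    obtain N where N: "\<And>n. n \<ge> N \<Longrightarrow> 1 / real (Suc n) < d" using small[OF d(1)] by blast
    show "\<exists>M. \<forall>m\<ge>M. \<forall>n\<ge>M. dist (rsum g \<gamma> (P m)) (rsum g \<gamma> (P n)) < e"
    proof (intro exI[of _ N] allI impI)
      fix m n assume "m \<ge> N" "n \<ge> N"
      then have "(\<lambda>t. ball t d) fine P m" "(\<lambda>t. ball t d) fine P n"
        using N fine_ball_mono[OF _ P(2)] by (meson less_imp_le)+
      then show "dist (rsum g \<gamma> (P m)) (rsum g \<gamma> (P n)) < e"
        unfolding dist_norm by (intro d(2) P)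
    qed
  qed
  then obtain X where X: "(\<lambda>n. rsum g \<gamma> (P n)) \<longlonglongrightarrow> X" using Cauchy_convergent convergent_def by blast
  have "has_line_integral (integrand g) \<gamma> X"
    unfolding has_line_integral_rsum
  proof (intro allI impI)
    fix e :: real assume e: "e > 0"
    obtain d where d: "d > 0" "\<And>p q. p tagged_division_of {0..1::real} \<Longrightarrow> (\<lambda>t. ball t d) fine p \<Longrightarrow>
     q tagged_division_of {0..1::real} \<Longrightarrow> (\<lambda>t. ball t d) fine q \<Longrightarrow> norm (rsum g \<gamma> p - rsum g \<gamma> q) < e / 2"
      using mod[of "e / 2"] e by (metis half_gt_zero)
    obtain N where N: "\<And>n. n \<ge> N \<Longrightarrow> 1 / real (Suc n) < d" using small[OF d(1)] by blast
    obtain N' where N': "\<And>n. n \<ge> N' \<Longrightarrow> norm (rsum g \<gamma> (P n) - X) < e / 2"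
      using LIMSEQ_D[OF X, of "e / 2"] e by auto
    define n where "n = max N N'"
    have fn: "(\<lambda>t. ball t d) fine P n" using N[of n] fine_ball_mono[OF _ P(2)] by (simp add: n_def)
    show "\<exists>d>0. \<forall>p. fine_tagged d p \<longrightarrow> norm (rsum g \<gamma> p - X) < e"
    proof (intro exI[of _ d] conjI allI impI)
      fix p assume "fine_tagged d p"
      then have "norm (rsum g \<gamma> p - rsum g \<gamma> (P n)) < e / 2" by (intro d(2) P fn) auto
      moreover have "norm (rsum g \<gamma> (P n) - X) < e / 2" by (rule N') (simp add: n_def)
      ultimately show "norm (rsum g \<gamma> p - X) < e"
        using norm_triangle_ineq[of "rsum g \<gamma> p - rsum g \<gamma> (P n)" "rsum g \<gamma> (P n) - X"] by simp
    qed (rule d(1))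
  qed
  then show ?thesis by blast
qed

abbreviation path_int :: "(complex \<Rightarrow> complex) \<Rightarrow> (real \<Rightarrow> complex) \<Rightarrow> complex" where
  "path_int g \<gamma> \<equiv> line_integral (integrand g) \<gamma>"

lemma has_pint:
  assumes "path \<gamma>" "rectifiable \<gamma>" "continuous_on (path_image \<gamma>) g"
  shows "has_line_integral (integrand g) \<gamma> (path_int g \<gamma>)"
  using has_line_integral_exists[OF assms] line_integral_eq by metis

text \<open>Uniformity in w serves two limits: holomorphic functions converging locally uniformly,
  and functions on D fed into a calculus that is continuous for the supremum norm.\<close>

lemma rsum_uniform:
  fixes g :: "'b::metric_space \<Rightarrow> complex \<Rightarrow> complex"
  assumes \<gamma>: "path \<gamma>" "rectifiable \<gamma>" and g: "continuous_on (path_image \<gamma> \<times> K) (\<lambda>(s, w). g w s)"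
    and K: "compact K" and e: "e > 0"
  shows "\<exists>d>0. \<forall>p. fine_tagged d p \<longrightarrow>
     (\<forall>w\<in>K. norm (rsum (g w) \<gamma> p - path_int (g w) \<gamma>) < e)"
proof -
  obtain V where V: "variation_bound \<gamma> V" using rectifiable_variation_bound[OF \<gamma>(2)] by blast
  have V0: "V \<ge> 0" using V by (simp add: variation_bound_def)
  have e': "e / (V + 1) > 0" "e / (V + 1) * V < e" using e V0 by (auto simp: field_simps)
  obtain d where d: "d > 0" "\<forall>w\<in>K. \<forall>t\<in>{0..1}. \<forall>t'\<in>{0..1}. dist t t' < 2 * d \<longrightarrow> norm (g w (\<gamma> t) - g w (\<gamma> t')) \<le> e / (V + 1)"
    using path_modulus[OF \<gamma>(1) g K e'(1)] by auto
  show ?thesis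
  proof (intro exI[of _ d] conjI allI impI ballI)
    fix p w assume p: "fine_tagged d p" and w: "w \<in> K"
    have "continuous_on (path_image \<gamma>) ((\<lambda>(s, w). g w s) \<circ> (\<lambda>s. (s, w)))"
      by (intro continuous_on_compose continuous_intros continuous_on_subset[OF g]) (use w in auto)
    then have "continuous_on (path_image \<gamma>) (g w)" by (simp add: o_def)
    then have "norm (rsum (g w) \<gamma> p - path_int (g w) \<gamma>) \<le> e / (V + 1) * V"
      using d w p e'(1) by (intro rsum_limit[OF V has_pint[OF \<gamma>], where d = d]) auto
    with e'(2) show "norm (rsum (g w) \<gamma> p - path_int (g w) \<gamma>) < e" by linarith
  qed (rule d(1))
qed

lemma has_line_integral_linear:
  assumes "has_line_integral (integrand g) \<gamma> X" "has_line_integral (integrand h) \<gamma> Y"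
  shows "has_line_integral (integrand (\<lambda>s. g s - c * h s)) \<gamma> (X - c * Y)"
  using has_line_integral_add[OF assms(1) has_line_integral_bounded_linear[OF bounded_linear_mult_right[of "- c"] assms(2)]]
  by (simp add: algebra_simps)

lemma pint_norm_le:
  assumes V: "variation_bound \<gamma> V" and X: "has_line_integral (integrand g) \<gamma> X"
    and g: "\<And>s. s \<in> path_image \<gamma> \<Longrightarrow> norm (g s) \<le> M"
  shows "norm X \<le> M * V"
proof (rule field_le_epsilon)
  fix e :: real assume "e > 0"
  then obtain d where d: "d > 0" "\<And>p. p tagged_division_of {0..1::real} \<Longrightarrow> (\<lambda>t. ball t d) fine p \<Longrightarrow> norm (rsum g \<gamma> p - X) < e"
    using X unfolding has_line_integral_rsum by meson
  obtain p where p: "p tagged_division_of {0..1::real}" "(\<lambda>t. ball t d) fine p"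
    using ball_fine_exists[OF d(1)] .
  have "\<gamma> 0 \<in> path_image \<gamma>" by (simp add: path_image_def)
  then have M: "M \<ge> 0" using order_trans[OF norm_ge_zero g] by blast
  have "norm (rsum g \<gamma> p) \<le> (\<Sum>x\<in>p. M * norm (increment \<gamma> (snd x)))"
    unfolding rsum_increment[OF p(1)]
  proof (rule sum_norm_le)
    fix x assume "x \<in> p"
    then have "\<gamma> (fst x) \<in> path_image \<gamma>"
      using tagged_cells(2)[OF p(1), of "fst x" "snd x"] by (auto simp: path_image_def)
    then show "norm (g (\<gamma> (fst x)) * increment \<gamma> (snd x)) \<le> M * norm (increment \<gamma> (snd x))"
      by (simp add: norm_mult g mult_right_mono)
  qed
  also have "\<dots> \<le> M * V"
    unfolding sum_distrib_left[symmetric] by (rule mult_left_mono[OF tagged_increment_le[OF V p(1)] M])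
  finally show "norm X \<le> M * V + e"
    using d(2)[OF p] norm_triangle_ineq3[of "rsum g \<gamma> p" X] by linarith
qed

section \<open>Cauchy's formula for cycles of rectifiable curves\<close>

text \<open>The function exp x - x has the small derivative exp x - 1 near 0. The error is relative
  to the increment, so it can be summed against a variation.\<close>

lemma exp_increment_estimate:
  fixes e :: real
  assumes "e > 0"
  shows "\<exists>r>0. \<forall>u v. norm u < r \<longrightarrow> norm v < r \<longrightarrow>
    norm (exp u - exp v - (u - v)) \<le> e * norm (u - v :: complex)"
proof -
  have "isCont exp (0::complex)" by simp
  then obtain r where r: "r > 0" "\<And>x::complex. norm x < r \<Longrightarrow> norm (exp x - 1) < e"
    using assms unfolding isCont_def LIM_def by (auto simp: dist_norm) (metis norm_zero right_minus_eq exp_zero assms)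
  have "norm (exp u - exp v - (u - v)) \<le> e * norm (u - v)" if "norm u < r" "norm v < r" for u v :: complex
  proof -
    have "norm ((exp u - u) - (exp v - v)) \<le> e * norm (u - v)"
    proof (rule field_differentiable_bound[of "ball 0 r" "\<lambda>x. exp x - x" "\<lambda>x. exp x - 1"])
      show "((\<lambda>x. exp x - x) has_field_derivative exp z - 1) (at z within ball 0 r)" for z :: complex
        by (auto intro!: derivative_eq_intros)
    qed (use that r in \<open>auto intro: less_imp_le\<close>)
    then show ?thesis by (simp add: algebra_simps)
  qed
  with r(1) show ?thesis by blast
qed

text \<open>A rectifiable curve offers no derivative to integrate. Instead \<gamma> = z + exp q with
  a continuous logarithm q: each Riemann term is a difference of exponentials close to the increment
  of q over the cell, and these increments telescope to 2 pi i times the winding number. The total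
  error is at most a small multiple of the variation of \<gamma>.\<close>

lemma has_line_integral_winding:
  assumes \<gamma>: "path \<gamma>" "rectifiable \<gamma>" and z: "z \<notin> path_image \<gamma>"
  shows "has_line_integral (integrand (\<lambda>s. 1 / (s - z))) \<gamma> (2 * of_real pi * \<i> * winding_number \<gamma> z)"
proof -
  obtain q where q: "path q" "pathfinish q - pathstart q = 2 * of_real pi * \<i> * winding_number \<gamma> z"
    "\<And>t. t \<in> {0..1} \<Longrightarrow> \<gamma> t = z + exp (q t)"
    using winding_number_as_continuous_log[OF \<gamma>(1) z] by blast
  obtain V where V: "variation_bound \<gamma> V" using rectifiable_variation_bound[OF \<gamma>(2)] by blast
  have V0: "V \<ge> 0" using V by (simp add: variation_bound_def)
  obtain m where m: "m > 0" "\<And>s. s \<in> path_image \<gamma> \<Longrightarrow> m \<le> norm (s - z)"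
  proof -
    have "open (- path_image \<gamma>)" using \<gamma>(1) by (simp add: closed_path_image open_Compl)
    then obtain m where "m > 0" "ball z m \<subseteq> - path_image \<gamma>"
      using z by (meson ComplI openE)
    then show ?thesis using that[of m] by (force simp: dist_norm norm_minus_commute subset_iff not_less)
  qed
  show ?thesis
    unfolding has_line_integral_rsum
  proof (intro allI impI)
    fix \<epsilon> :: real assume \<epsilon>: "\<epsilon> > 0"
    \<comment> \<open>The bound 1/2 allows the error to be absorbed, giving norm (u - v) \<le> 2
      norm (exp u - exp v); the other bound makes 2 e V / m smaller than \<epsilon>.\<close>
    define e where "e = min (1/2) (\<epsilon> * m / (4 * (V + 1)))"
    have e: "e > 0" using \<epsilon> m V0 by (simp add: e_def)
    have e2: "e \<le> 1/2" unfolding e_def by (rule min.cobounded1)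
    have eV: "2 * e / m * V < \<epsilon>"
    proof -
      define k where "k = V + 1"
      have k: "k > 0" "V < 2 * k" using V0 by (simp_all add: k_def)
      have "e \<le> \<epsilon> * m / (4 * k)" by (simp add: e_def k_def)
      then have "2 * e / m \<le> 2 * (\<epsilon> * m / (4 * k)) / m" using m(1) by (intro divide_right_mono) auto
      also have "\<dots> = \<epsilon> / (2 * k)" using m(1) by simp
      finally have "2 * e / m * V \<le> \<epsilon> / (2 * k) * V" using V0 by (rule mult_right_mono)
      also have "\<dots> < \<epsilon> / (2 * k) * (2 * k)" using \<epsilon> k by (intro mult_strict_left_mono) auto
      also have "\<dots> = \<epsilon>" using k by simp
      finally show ?thesis .
    qed
    obtain r where r: "r > 0" "\<And>u v :: complex. norm u < r \<Longrightarrow> norm v < r \<Longrightarrow>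
      norm (exp u - exp v - (u - v)) \<le> e * norm (u - v)"
      using exp_increment_estimate[OF e] by blast
    have "uniformly_continuous_on {0..1} q"
      using q(1) by (intro compact_uniformly_continuous) (auto simp: path_def)
    then obtain d where d: "d > 0" "\<And>s t. s \<in> {0..1} \<Longrightarrow> t \<in> {0..1} \<Longrightarrow> dist t s < d \<Longrightarrow> dist (q t) (q s) < r"
      using r(1) unfolding uniformly_continuous_on_def by metis
    show "\<exists>d>0. \<forall>p. fine_tagged d p \<longrightarrow>
       norm (rsum (\<lambda>s. 1 / (s - z)) \<gamma> p - 2 * of_real pi * \<i> * winding_number \<gamma> z) < \<epsilon>"
    proof (intro exI[of _ d] conjI allI impI)
      fix p :: "(real \<times> real set) set"
      assume "fine_tagged d p"
      then have p: "p tagged_division_of {0..1}" "(\<lambda>t. ball t d) fine p" by auto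
      have tel: "2 * of_real pi * \<i> * winding_number \<gamma> z = (\<Sum>x\<in>p. increment q (snd x))"
      proof -
        have "(\<Sum>(t, K)\<in>p. q (Sup K) - q (Inf K)) = q 1 - q 0"
          by (rule additive_tagged_division_1[OF _ p(1)]) simp
        moreover have "(\<Sum>(t, K)\<in>p. q (Sup K) - q (Inf K)) = (\<Sum>x\<in>p. increment q (snd x))"
          using tagged_cells(5)[OF p(1)] by (intro sum.cong) (auto simp: increment_def)
        ultimately show ?thesis using q(2) by (simp add: pathfinish_def pathstart_def)
      qed
      have cell: "norm (1 / (\<gamma> (fst x) - z) * increment \<gamma> (snd x) - increment q (snd x))
          \<le> 2 * e / m * norm (increment \<gamma> (snd x))" if x: "x \<in> p" for x
      proof -
        obtain t a b where xt: "x = (t, {a..b})" "t \<in> {a..b}" "{a..b} \<subseteq> {0..1}" "t \<in> {0..1}"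
          using tagged_cells[OF p(1), of "fst x" "snd x"] x by (metis prod.collapse)
        have ab: "a \<le> b" "a \<in> {0..1}" "b \<in> {0..1}" using xt by auto
        have "{a..b} \<subseteq> ball t d" using fineD[OF p(2), of t "{a..b}"] x xt(1) by simp
        then have near: "dist (q a) (q t) < r" "dist (q b) (q t) < r"
          using ab xt(4) by (auto intro!: d(2) simp: dist_commute)
        define u v where "u = q b - q t" and "v = q a - q t"
        have uv: "norm (exp u - exp v - (u - v)) \<le> e * norm (u - v)"
          using near by (intro r(2)) (simp_all add: u_def v_def dist_norm)
        \<comment> \<open>q itself may have unbounded variation, so its increments are bounded back
          by those of exp q, that is, of \<gamma>.\<close>
        have "norm (u - v) - norm (exp u - exp v) \<le> norm (exp u - exp v - (u - v))"
          by (metis norm_minus_commute norm_triangle_ineq2)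
        also have "\<dots> \<le> (1/2) * norm (u - v)" using uv mult_right_mono[OF e2 norm_ge_zero[of "u - v"]] by linarith
        finally have uv2: "norm (u - v) \<le> 2 * norm (exp u - exp v)" by simp
        \<comment> \<open>Dividing by \<gamma> t - z = exp (q t) makes the exponents relative to the
          tag, where they are small.\<close>
        have inc: "1 / (\<gamma> t - z) * increment \<gamma> {a..b} = exp u - exp v"
          using ab xt(4) by (simp add: increment_def q(3) u_def v_def exp_diff diff_divide_distrib)
        have gt: "m \<le> norm (\<gamma> t - z)" using xt(4) by (intro m(2)) (auto simp: path_image_def)
        have "norm (exp u - exp v) = norm (increment \<gamma> {a..b}) / norm (\<gamma> t - z)"
          by (simp flip: inc add: norm_divide)
        also have "\<dots> \<le> norm (increment \<gamma> {a..b}) / m" using gt m(1) by (intro divide_left_mono mult_pos_pos norm_ge_zero) linarith+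
        finally have nx: "norm (exp u - exp v) \<le> norm (increment \<gamma> {a..b}) / m" .
        have "norm (exp u - exp v - (u - v)) \<le> e * (2 * (norm (increment \<gamma> {a..b}) / m))"
          using uv uv2 nx e by (meson mult_left_mono order_trans less_imp_le zero_le_numeral)
        moreover have "increment q {a..b} = u - v" using ab by (simp add: increment_def u_def v_def)
        ultimately show ?thesis unfolding xt(1) fst_conv snd_conv inc by (simp add: mult_ac)
      qed
      have "rsum (\<lambda>s. 1 / (s - z)) \<gamma> p - 2 * of_real pi * \<i> * winding_number \<gamma> z =
          (\<Sum>x\<in>p. 1 / (\<gamma> (fst x) - z) * increment \<gamma> (snd x) - increment q (snd x))"
        unfolding rsum_increment[OF p(1)] tel by (simp only: sum_subtractf)
      also have "norm \<dots> \<le> (\<Sum>x\<in>p. 2 * e / m * norm (increment \<gamma> (snd x)))" by (rule sum_norm_le[OF cell])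
      also have "\<dots> \<le> 2 * e / m * V"
        unfolding sum_distrib_left[symmetric] using e m by (intro mult_left_mono tagged_increment_le[OF V p(1)]) simp
      finally show "norm (rsum (\<lambda>s. 1 / (s - z)) \<gamma> p - 2 * of_real pi * \<i> * winding_number \<gamma> z) < \<epsilon>"
        using eV by linarith
    qed (rule d(1))
  qed
qed

text \<open>Riemann sums are finite sums of holomorphic functions of z and converge locally
  uniformly, so no differentiation under the integral occurs.\<close>

lemma pint_holomorphic:
  assumes \<gamma>: "path \<gamma>" "rectifiable \<gamma>" and W: "open W"
    and \<phi>: "continuous_on (path_image \<gamma> \<times> W) (\<lambda>(s, z). \<phi> z s)"
      "\<And>s. s \<in> path_image \<gamma> \<Longrightarrow> (\<lambda>z. \<phi> z s) holomorphic_on W"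
  shows "(\<lambda>z. path_int (\<phi> z) \<gamma>) holomorphic_on W"
proof -
  have "\<exists>p. p tagged_division_of {0..1} \<and> (\<lambda>t::real. ball t (1 / real (Suc n))) fine p" for n
    using ball_fine_exists[of "1 / real (Suc n)"] by (metis of_nat_0_less_iff zero_less_Suc zero_less_divide_1_iff)
  then obtain P where P: "\<And>n. P n tagged_division_of {0..1}" "\<And>n. (\<lambda>t::real. ball t (1 / real (Suc n))) fine P n" by metis
  show ?thesis
  proof (rule holomorphic_uniform_sequence[OF W])
    fix n
    show "(\<lambda>z. rsum (\<phi> z) \<gamma> (P n)) holomorphic_on W"
      unfolding rsum_def case_prod_beta
    proof (intro holomorphic_on_sum holomorphic_on_mult holomorphic_on_const \<phi>(2))
      fix x assume "x \<in> P n"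
      then show "\<gamma> (fst x) \<in> path_image \<gamma>"
        using tagged_cells(2)[OF P(1), of "fst x" "snd x" n] by (auto simp: path_image_def)
    qed
  next
    fix x assume "x \<in> W"
    then obtain d where d: "d > 0" "cball x d \<subseteq> W" using W by (meson open_contains_cball)
    have "uniform_limit (cball x d) (\<lambda>n z. rsum (\<phi> z) \<gamma> (P n)) (\<lambda>z. path_int (\<phi> z) \<gamma>) sequentially"
      unfolding uniform_limit_iff
    proof (intro allI impI)
      fix e :: real assume e: "e > 0"
      have "continuous_on (path_image \<gamma> \<times> cball x d) (\<lambda>(s, z). \<phi> z s)"
        by (rule continuous_on_subset[OF \<phi>(1)]) (use d in auto)
      from rsum_uniform[OF \<gamma> this compact_cball e]
      obtain d' where d': "d' > 0" "\<And>p. p tagged_division_of {0..1} \<Longrightarrow> (\<lambda>t. ball t d') fine p \<Longrightarrow>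
         \<forall>w\<in>cball x d. norm (rsum (\<phi> w) \<gamma> p - path_int (\<phi> w) \<gamma>) < e" by blast
      have "\<forall>\<^sub>F n in sequentially. 1 / real (Suc n) < d'"
        using order_tendstoD(2)[OF LIMSEQ_Suc[OF lim_1_over_n] d'(1)] .
      then show "\<forall>\<^sub>F n in sequentially. \<forall>z\<in>cball x d. dist (rsum (\<phi> z) \<gamma> (P n)) (path_int (\<phi> z) \<gamma>) < e"
        by eventually_elim (unfold dist_norm, rule d'(2)[OF P(1)], rule fine_ball_mono[OF _ P(2)], simp)
    qed
    with d show "\<exists>d. 0 < d \<and> cball x d \<subseteq> W \<and>
      uniform_limit (cball x d) (\<lambda>n z. rsum (\<phi> z) \<gamma> (P n)) (\<lambda>z. path_int (\<phi> z) \<gamma>) sequentially" by blast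
  qed
qed

definition dquot :: "(complex \<Rightarrow> complex) \<Rightarrow> complex \<Rightarrow> complex \<Rightarrow> complex" where
  "dquot h z s = (if s = z then deriv h z else (h s - h z) / (s - z))"

text \<open>The issue is joint continuity at the diagonal. There the mean value estimate on a ball
  where \<open>deriv h\<close> is nearly constant controls the quotient for all pairs s, z at
  once.\<close>

lemma continuous_on_dquot:
  assumes h: "h holomorphic_on W" and W: "open W"
  shows "continuous_on (W \<times> W) (\<lambda>(s, z). dquot h z s)"
proof (rule continuous_at_imp_continuous_on, safe)
  fix a b assume ab: "a \<in> W" "b \<in> W"
  show "isCont (\<lambda>(s, z). dquot h z s) (a, b)"
  proof (cases "a = b")
    case False
    have o: "open {x::complex \<times> complex. fst x \<noteq> snd x}"
      by (intro open_Collect_neq continuous_intros)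
    have c: "continuous_on (W \<times> W) (\<lambda>x. h (fst x))" "continuous_on (W \<times> W) (\<lambda>x. h (snd x))"
      by (intro continuous_on_compose2[OF holomorphic_on_imp_continuous_on[OF h]] continuous_intros; auto)+
    have "continuous_on ((W \<times> W) \<inter> {x. fst x \<noteq> snd x}) (\<lambda>x. (h (fst x) - h (snd x)) / (fst x - snd x))"
      by (intro continuous_intros continuous_on_subset[OF c(1)] continuous_on_subset[OF c(2)]) auto
    then have "continuous_on ((W \<times> W) \<inter> {x. fst x \<noteq> snd x}) (\<lambda>(s, z). dquot h z s)"
      by (rule continuous_on_eq) (auto simp: dquot_def)
    moreover have "open ((W \<times> W) \<inter> {x. fst x \<noteq> snd x})" using o W by (intro open_Int open_Times)
    ultimately show ?thesis using False ab by (simp add: continuous_on_eq_continuous_at)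
  next
    case True
    have dh: "continuous_on W (deriv h)"
      using holomorphic_deriv[OF h W] holomorphic_on_imp_continuous_on by blast
    show ?thesis
      unfolding isCont_def LIM_def
    proof (intro allI impI)
      fix e :: real assume e: "e > 0"
      have "open (W \<inter> (\<lambda>z. dist (deriv h z) (deriv h a)) -` {..<e / 2})"
        by (intro continuous_open_preimage continuous_intros dh W)
      then obtain r where r0: "r > 0" "ball a r \<subseteq> W \<inter> (\<lambda>z. dist (deriv h z) (deriv h a)) -` {..<e / 2}"
        by (rule openE[of _ a]) (use e ab(1) in simp_all)
      then have r: "r > 0" "ball a r \<subseteq> W" "\<And>z. z \<in> ball a r \<Longrightarrow> dist (deriv h z) (deriv h a) < e / 2"
        by blast+
      have der: "(h has_field_derivative deriv h z) (at z)" if "z \<in> W" for z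
        using holomorphic_derivI[OF h W that] .
      have key: "norm (dquot h z s - deriv h a) \<le> e / 2" if "s \<in> ball a r" "z \<in> ball a r" for s z
      proof (cases "s = z")
        case True
        then show ?thesis using r(3)[OF that(2)] by (simp add: dquot_def dist_norm)
      next
        case False
        \<comment> \<open>Subtracting the linear function with slope \<open>deriv h a\<close> leaves
          a function whose derivative is at most e / 2 on the ball.\<close>
        have "norm ((h s - deriv h a * s) - (h z - deriv h a * z)) \<le> e / 2 * norm (s - z)"
        proof (rule field_differentiable_bound[of "ball a r" _ "\<lambda>z. deriv h z - deriv h a"])
          fix w assume w: "w \<in> ball a r"
          show "((\<lambda>s. h s - deriv h a * s) has_field_derivative deriv h w - deriv h a) (at w within ball a r)"
            using r(2) w by (auto intro!: derivative_eq_intros DERIV_subset[OF der])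
          show "norm (deriv h w - deriv h a) \<le> e / 2" using r(3)[OF w] by (simp add: dist_norm)
        qed (use that in auto)
        moreover have "dquot h z s - deriv h a = ((h s - deriv h a * s) - (h z - deriv h a * z)) / (s - z)"
          using False by (simp add: dquot_def field_simps)
        ultimately show ?thesis using False by (simp add: norm_divide divide_le_eq)
      qed
      show "\<exists>d>0. \<forall>x. x \<noteq> (a, b) \<and> dist x (a, b) < d \<longrightarrow>
          dist (case x of (s, z) \<Rightarrow> dquot h z s) (case (a, b) of (s, z) \<Rightarrow> dquot h z s) < e"
      proof (intro exI[of _ r] conjI allI impI)
        fix x :: "complex \<times> complex" assume x: "x \<noteq> (a, b) \<and> dist x (a, b) < r"
        obtain s z where sz: "x = (s, z)" by (cases x)
        have "s \<in> ball a r" "z \<in> ball a r"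
          using x True dist_fst_le[of x "(a, b)"] dist_snd_le[of x "(a, b)"] by (auto simp: sz dist_commute)
        from key[OF this] e True show "dist (case x of (s, z) \<Rightarrow> dquot h z s) (case (a, b) of (s, z) \<Rightarrow> dquot h z s) < e"
          by (simp add: sz dist_norm) (simp add: dquot_def)
      qed (rule r(1))
    qed
  qed
qed

text \<open>The singularity at z = s is removable by continuity.\<close>

lemma dquot_holomorphic:
  assumes h: "h holomorphic_on W" and W: "open W" and s: "s \<in> W"
  shows "(\<lambda>z. dquot h z s) holomorphic_on W"
proof (rule no_isolated_singularity)
  have "continuous_on W ((\<lambda>(s, z). dquot h z s) \<circ> (\<lambda>z. (s, z)))"
    by (intro continuous_on_compose continuous_intros continuous_on_subset[OF continuous_on_dquot[OF h W]]) (use s in auto)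
  then show "continuous_on W (\<lambda>z. dquot h z s)" by (simp add: o_def)
  have "(\<lambda>z. (h s - h z) / (s - z)) holomorphic_on W - {s}"
    by (intro holomorphic_intros holomorphic_on_subset[OF h]) auto
  then show "(\<lambda>z. dquot h z s) holomorphic_on W - {s}"
    by (rule holomorphic_transform) (auto simp: dquot_def)
qed (use W in auto)

text \<open>Dixon's argument: the integrals of the difference quotient and of the Cauchy kernel
  patch to an entire function vanishing at infinity.\<close>

lemma cauchy_formula_cycle:
  assumes W: "open W" "h holomorphic_on W"
    and U: "open U'" "bounded U'" "closure U' \<subseteq> W"
    and \<gamma>s: "positively_oriented_boundary U' \<gamma>s"
    and z: "z \<in> U'"
  shows "(\<Sum>\<gamma>\<leftarrow>\<gamma>s. path_int (\<lambda>s. h s / (s - z)) \<gamma>) = 2 * of_real pi * \<i> * h z"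
proof -
  have path: "path \<gamma>" "rectifiable \<gamma>" if "\<gamma> \<in> set \<gamma>s" for \<gamma>
    using \<gamma>s that by (auto simp: positively_oriented_boundary_def simple_path_def)
  have im: "path_image \<gamma> \<subseteq> closure U' - U'" if "\<gamma> \<in> set \<gamma>s" for \<gamma>
    using \<gamma>s that U(1) by (auto simp: positively_oriented_boundary_def frontier_def interior_open)
  have imW: "path_image \<gamma> \<subseteq> W" if "\<gamma> \<in> set \<gamma>s" for \<gamma> using im[OF that] U(3) by blast
  define g1 where "g1 w = (\<Sum>\<gamma>\<leftarrow>\<gamma>s. path_int (dquot h w) \<gamma>)" for w
  define g2 where "g2 w = (\<Sum>\<gamma>\<leftarrow>\<gamma>s. path_int (\<lambda>s. h s / (s - w)) \<gamma>)" for w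
  have ck: "continuous_on (path_image \<gamma>) (\<lambda>s. h s / (s - w))" if "\<gamma> \<in> set \<gamma>s" "w \<notin> path_image \<gamma>" for \<gamma> w
    by (intro continuous_intros continuous_on_subset[OF holomorphic_on_imp_continuous_on[OF W(2)]] imW) (use that in auto)
  \<comment> \<open>Off the contour the difference quotient splits into two Cauchy kernels, and the
    second one integrates to winding numbers. Its contribution vanishes outside the closure of U',
    which glues g1 to g2, and equals 2 pi i h z at z.\<close>
  have split: "g1 w = g2 w - h w * (2 * of_real pi * \<i> * (\<Sum>\<gamma>\<leftarrow>\<gamma>s. winding_number \<gamma> w))"
    if w: "w \<notin> frontier U'" for w
  proof -
    have "path_int (dquot h w) \<gamma> = path_int (\<lambda>s. h s / (s - w)) \<gamma> - h w * (2 * of_real pi * \<i> * winding_number \<gamma> w)"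
      if \<gamma>: "\<gamma> \<in> set \<gamma>s" for \<gamma>
    proof -
      have wn: "w \<notin> path_image \<gamma>" using \<gamma>s \<gamma> w unfolding positively_oriented_boundary_def by blast
      have L: "has_line_integral (integrand (\<lambda>s. h s / (s - w) - h w * (1 / (s - w)))) \<gamma>
         (path_int (\<lambda>s. h s / (s - w)) \<gamma> - h w * (2 * of_real pi * \<i> * winding_number \<gamma> w))"
        by (intro has_line_integral_linear has_pint has_line_integral_winding path \<gamma> wn ck)
      have "has_line_integral (integrand (dquot h w)) \<gamma>
         (path_int (\<lambda>s. h s / (s - w)) \<gamma> - h w * (2 * of_real pi * \<i> * winding_number \<gamma> w))"
      proof (rule has_line_integral_cong[OF _ L])
        fix s ds assume "s \<in> path_image \<gamma>"
        then have "s \<noteq> w" using wn by blast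
        then show "(h s / (s - w) - h w * (1 / (s - w))) * ds = dquot h w s * ds"
          by (simp add: dquot_def diff_divide_distrib)
      qed
      then show ?thesis by (rule line_integral_eq)
    qed
    then have "g1 w = (\<Sum>\<gamma>\<leftarrow>\<gamma>s. path_int (\<lambda>s. h s / (s - w)) \<gamma> - h w * (2 * of_real pi * \<i> * winding_number \<gamma> w))"
      unfolding g1_def by (intro arg_cong[where f = sum_list] map_cong) auto
    then show ?thesis by (simp add: g2_def sum_list_subtractf sum_list_const_mult)
  qed
  have w0: "(\<Sum>\<gamma>\<leftarrow>\<gamma>s. winding_number \<gamma> w) = 0" if "w \<notin> closure U'" for w
    using \<gamma>s that by (auto simp: positively_oriented_boundary_def)
  have w1: "(\<Sum>\<gamma>\<leftarrow>\<gamma>s. winding_number \<gamma> z) = 1"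
    using \<gamma>s z by (auto simp: positively_oriented_boundary_def)
  have hol1: "g1 holomorphic_on W"
    unfolding g1_def
  proof -
    have "(\<lambda>w. path_int (dquot h w) \<gamma>) holomorphic_on W" if "\<gamma> \<in> set \<gamma>s" for \<gamma>
      by (intro pint_holomorphic path that W(1) continuous_on_subset[OF continuous_on_dquot[OF W(2,1)]] dquot_holomorphic W)
         (use imW[OF that] in auto)
    then show "(\<lambda>w. \<Sum>\<gamma>\<leftarrow>\<gamma>s. path_int (dquot h w) \<gamma>) holomorphic_on W"
      by (induction \<gamma>s) (auto intro!: holomorphic_intros)
  qed
  have hol2: "g2 holomorphic_on - closure U'"
    unfolding g2_def
  proof -
    have "(\<lambda>w. path_int (\<lambda>s. h s / (s - w)) \<gamma>) holomorphic_on - closure U'" if \<gamma>: "\<gamma> \<in> set \<gamma>s" for \<gamma>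
    proof (intro pint_holomorphic path \<gamma>)
      have "continuous_on (path_image \<gamma> \<times> - closure U') (\<lambda>x. h (fst x))"
        by (intro continuous_on_compose2[OF holomorphic_on_imp_continuous_on[OF W(2)]] continuous_intros) (use imW[OF \<gamma>] in auto)
      then show "continuous_on (path_image \<gamma> \<times> - closure U') (\<lambda>(s, w). h s / (s - w))"
        unfolding case_prod_beta by (intro continuous_intros) (use im[OF \<gamma>] in auto)
      fix s assume "s \<in> path_image \<gamma>"
      then show "(\<lambda>w. h s / (s - w)) holomorphic_on - closure U'"
        using im[OF \<gamma>] by (intro holomorphic_intros) auto
    qed auto
    then show "(\<lambda>w. \<Sum>\<gamma>\<leftarrow>\<gamma>s. path_int (\<lambda>s. h s / (s - w)) \<gamma>) holomorphic_on - closure U'"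
      by (induction \<gamma>s) (auto intro!: holomorphic_intros)
  qed
  \<comment> \<open>g1 and g2 agree where both apply, and W together with the exterior of the
    closure of U' is the whole plane, so g is entire.\<close>
  define g where "g w = (if w \<in> W then g1 w else g2 w)" for w
  have eq: "g w = g2 w" if "w \<notin> closure U'" for w
    using split[of w] w0[OF that] that by (auto simp: g_def frontier_def)
  have "g holomorphic_on W \<union> - closure U'"
  proof (rule holomorphic_on_Un)
    show "g holomorphic_on W" by (rule holomorphic_transform[OF hol1]) (simp add: g_def)
    show "g holomorphic_on - closure U'" by (rule holomorphic_transform[OF hol2]) (simp add: eq)
  qed (use W(1) in auto)
  moreover have "W \<union> - closure U' = UNIV" using U(3) by auto
  ultimately have holg: "g holomorphic_on UNIV" by simp
  \<comment> \<open>With \<bar>h\<bar> \<le> M and \<bar>s\<bar> \<le> R on the curve, the integral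
    is at most M V / (norm w - R).\<close>
  have lim2: "((\<lambda>w. path_int (\<lambda>s. h s / (s - w)) \<gamma>) \<longlongrightarrow> 0) at_infinity" if \<gamma>: "\<gamma> \<in> set \<gamma>s" for \<gamma>
  proof -
    obtain V where V: "variation_bound \<gamma> V" using rectifiable_variation_bound path \<gamma> by blast
    have V0: "V \<ge> 0" using V by (simp add: variation_bound_def)
    have cp: "compact (path_image \<gamma>)" by (rule compact_path_image[OF path(1)[OF \<gamma>]])
    have "compact (h ` path_image \<gamma>)"
      by (intro compact_continuous_image continuous_on_subset[OF holomorphic_on_imp_continuous_on[OF W(2)]] imW[OF \<gamma>] cp)
    then obtain M where M: "\<And>s. s \<in> path_image \<gamma> \<Longrightarrow> norm (h s) \<le> M" "M > 0"
      using compact_imp_bounded bounded_pos by (metis image_eqI)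
    obtain R where R: "\<And>s. s \<in> path_image \<gamma> \<Longrightarrow> norm s \<le> R" "R > 0"
      using compact_imp_bounded[OF cp] bounded_pos by metis
    show ?thesis
    proof (rule Lim_null_comparison)
      show "\<forall>\<^sub>F w in at_infinity. norm (path_int (\<lambda>s. h s / (s - w)) \<gamma>) \<le> (M * V) / (norm w - R)"
        unfolding eventually_at_infinity
      proof (intro exI[of _ "R + 1"] allI impI)
        fix w :: complex assume w: "R + 1 \<le> norm w"
        have far: "norm w - R \<le> norm (s - w)" if "s \<in> path_image \<gamma>" for s
          using R(1)[OF that] norm_triangle_ineq2[of w s] by (simp add: norm_minus_commute)
        have wn: "w \<notin> path_image \<gamma>" using R(1)[of w] w by auto
        have "norm (path_int (\<lambda>s. h s / (s - w)) \<gamma>) \<le> (M / (norm w - R)) * V"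
        proof (rule pint_norm_le[OF V has_pint[OF path[OF \<gamma>] ck[OF \<gamma> wn]]])
          fix s assume s: "s \<in> path_image \<gamma>"
          then show "norm (h s / (s - w)) \<le> M / (norm w - R)"
            unfolding norm_divide using M far[OF s] w by (intro frac_le) auto
        qed
        then show "norm (path_int (\<lambda>s. h s / (s - w)) \<gamma>) \<le> (M * V) / (norm w - R)" by simp
      qed
      have "filterlim (\<lambda>w::complex. - R + norm w) at_top at_infinity"
        by (rule filterlim_tendsto_add_at_top[OF tendsto_const filterlim_norm_at_top])
      then show "((\<lambda>w. (M * V) / (norm w - R)) \<longlongrightarrow> 0) (at_infinity :: complex filter)"
        by (intro tendsto_divide_0[OF tendsto_const] filterlim_at_top_imp_at_infinity) simp
    qed
  qed
  have "(g2 \<longlongrightarrow> 0) at_infinity"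
    unfolding g2_def using lim2
  proof (induction \<gamma>s)
    case (Cons \<gamma> \<gamma>s)
    have "((\<lambda>w. \<Sum>\<gamma>\<leftarrow>\<gamma>s. path_int (\<lambda>s. h s / (s - w)) \<gamma>) \<longlongrightarrow> 0) at_infinity"
      by (rule Cons.IH, rule Cons.prems) simp
    with Cons.prems[of \<gamma>] show ?case
      using tendsto_add[of "\<lambda>w. path_int (\<lambda>s. h s / (s - w)) \<gamma>" 0 at_infinity] by (simp add: tendsto_add_zero)
  qed simp
  moreover have "\<forall>\<^sub>F w in at_infinity. g2 w = g w"
  proof -
    obtain R where R: "\<And>w. w \<in> closure U' \<Longrightarrow> norm w \<le> R"
      using bounded_closure[OF U(2)] unfolding bounded_iff by blast
    show ?thesis unfolding eventually_at_infinity
    proof (intro exI[of _ "R + 1"] allI impI)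
      fix w :: complex assume "R + 1 \<le> norm w"
      then have "w \<notin> closure U'" using R[of w] by auto
      then show "g2 w = g w" by (simp add: eq)
    qed
  qed
  ultimately have "(g \<longlongrightarrow> 0) at_infinity" by (rule Lim_transform_eventually)
  \<comment> \<open>An entire function vanishing at infinity is 0; at z, where the winding numbers
    add up to 1, this is Cauchy's formula.\<close>
  from Liouville_weak_0[OF holg this] have "g z = 0" .
  moreover have "z \<in> W" "z \<notin> frontier U'"
    using z U closure_subset[of U'] by (auto simp: frontier_def interior_open)
  ultimately show ?thesis
    using split[of z] w1 by (simp add: g_def g2_def mult_ac)
qed

section \<open>Splitting slice functions along a quaternionic basis\<close>

lemma quat_basis_relations:
  assumes "\<jj> \<in> \<S>" "\<kappa> \<in> \<S>" "\<jj> * \<kappa> = - (\<kappa> * \<jj>)"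
  shows "\<jj> * \<jj> = -1" "\<kappa> * \<kappa> = -1" "\<kappa> * \<jj> = - (\<jj> * \<kappa>)" "qre \<jj> = 0" "qre \<kappa> = 0" "qre (\<jj> * \<kappa>) = 0"
proof -
  show "\<jj> * \<jj> = -1" "\<kappa> * \<kappa> = -1" "\<kappa> * \<jj> = - (\<jj> * \<kappa>)" "qre \<jj> = 0" "qre \<kappa> = 0"
    using assms by (auto simp: imag_unit_square imag_units_iff)
  have "qre (\<jj> * \<kappa>) = qre (- (\<kappa> * \<jj>))" using assms(3) by simp
  also have "\<dots> = - qre (\<jj> * \<kappa>)" by (simp add: quat_sel_mult)
  finally show "qre (\<jj> * \<kappa>) = 0" by simp
qed

text \<open>Products of distinct basis elements have real part 0, so the real parts after
  multiplication by 1, \<jj>, \<kappa> isolate a, b, c up to sign. For d it suffices that \<jj>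
  \<kappa> is nonzero.\<close>

lemma quat_basis_independent:
  assumes jk: "\<jj> \<in> \<S>" "\<kappa> \<in> \<S>" "\<jj> * \<kappa> = - (\<kappa> * \<jj>)"
    and zero: "of_real a + of_real b * \<jj> + of_real c * \<kappa> + of_real d * \<jj> * \<kappa> = 0"
  shows "a = 0 \<and> b = 0 \<and> c = 0 \<and> d = 0"
proof -
  note r = quat_basis_relations[OF jk]
  have r': "\<jj> * (\<jj> * x) = - x" "\<kappa> * (\<kappa> * x) = - x" "\<kappa> * (\<jj> * x) = - (\<jj> * (\<kappa> * x))" for x
    using r(1-3) by (simp_all flip: mult.assoc)
  have z: "a *\<^sub>R 1 + b *\<^sub>R \<jj> + c *\<^sub>R \<kappa> + d *\<^sub>R (\<jj> * \<kappa>) = 0"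
    using zero by (simp add: of_real_def mult.assoc)
  have "qre (a *\<^sub>R 1 + b *\<^sub>R \<jj> + c *\<^sub>R \<kappa> + d *\<^sub>R (\<jj> * \<kappa>)) = 0" unfolding z by simp
  then have a: "a = 0" by (simp add: r)
  have "qre ((a *\<^sub>R 1 + b *\<^sub>R \<jj> + c *\<^sub>R \<kappa> + d *\<^sub>R (\<jj> * \<kappa>)) * \<jj>) = 0" unfolding z by simp
  then have b: "b = 0" by (simp add: distrib_right mult.assoc r r')
  have "qre ((a *\<^sub>R 1 + b *\<^sub>R \<jj> + c *\<^sub>R \<kappa> + d *\<^sub>R (\<jj> * \<kappa>)) * \<kappa>) = 0" unfolding z by simp
  then have c: "c = 0" by (simp add: distrib_right mult.assoc r r')
  have "\<jj> * \<kappa> \<noteq> 0"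
  proof
    assume "\<jj> * \<kappa> = 0"
    then have "\<jj> * (\<jj> * \<kappa>) * \<kappa> = 0" by simp
    then show False by (simp add: r r')
  qed
  with z a b c show ?thesis by simp
qed

text \<open>The Euclidean inner product of q with a purely imaginary e. At e = -1 it returns the
  real part, so one formula serves all four basis elements.\<close>

definition coef :: "quat \<Rightarrow> quat \<Rightarrow> real" where "coef e q = - qre (q * e)"

lemma quat_basis_expansion:
  assumes jk: "\<jj> \<in> \<S>" "\<kappa> \<in> \<S>" "\<jj> * \<kappa> = - (\<kappa> * \<jj>)"
  shows "q = of_real (coef (-1) q) + of_real (coef \<jj> q) * \<jj> + of_real (coef \<kappa> q) * \<kappa>
    + of_real (coef (\<jj> * \<kappa>) q) * \<jj> * \<kappa>"
proof -
  have s: "qre \<jj> = 0" "qre \<kappa> = 0" "(qi \<jj>)\<^sup>2 + (qj \<jj>)\<^sup>2 + (qk \<jj>)\<^sup>2 = 1" "(qi \<kappa>)\<^sup>2 + (qj \<kappa>)\<^sup>2 + (qk \<kappa>)\<^sup>2 = 1"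
    using jk by (auto simp: imag_units_iff)
  have o: "qi \<jj> * qi \<kappa> + qj \<jj> * qj \<kappa> + qk \<jj> * qk \<kappa> = 0"
    using quat_basis_relations(6)[OF jk] by (simp add: quat_sel_mult s)
  show ?thesis
    \<comment> \<open>Each coordinate is a polynomial identity modulo the orthonormality relations
      of the vector parts of \<jj> and \<kappa>.\<close>
    unfolding coef_def quat_eq_iff quat_sel quat_sel_of_real quat_sel_mult s
  proof (intro conjI)
  qed (use s(3,4) o in algebra)+
qed

lemma coef_linear: "bounded_linear (coef e)"
proof -
  have "bounded_linear (\<lambda>q. - inner 1 (q * e))"
    by (intro bounded_linear_intros bounded_linear_compose[OF bounded_linear_inner_right] bounded_linear_mult_left bounded_linear_minus)
  then show ?thesis by (simp add: coef_def[abs_def] inner_quat_def)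
qed

definition stem_coef :: "quat \<Rightarrow> (complex \<Rightarrow> quat \<times> quat) \<Rightarrow> complex \<Rightarrow> complex" where
  "stem_coef e F z = Complex (coef e (fst (F z))) (coef e (snd (F z)))"

text \<open>\<open>coef e\<close> is real linear on each component and so carries
  \<open>mult_i\<close> to multiplication by i. The derivative is then a real linear map of the
  plane commuting with i, that is, multiplication by its value at 1.\<close>

lemma stem_coef_holomorphic:
  assumes F: "stem_holomorphic_on W F"
  shows "stem_coef e F holomorphic_on W"
proof -
  have "stem_coef e F field_differentiable at z" if z: "z \<in> W" for z
  proof -
    obtain F' where F': "(F has_derivative F') (at z)" "\<And>w. F' (\<i> * w) = mult_i (F' w)"
      using F z unfolding stem_holomorphic_on_def by blast
    interpret c: bounded_linear "coef e" by (rule coef_linear)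
    define M where "M w = of_real (coef e (fst (F' w))) + \<i> * of_real (coef e (snd (F' w)))" for w
    have d: "((\<lambda>z. of_real (coef e (fst (F z))) + \<i> * of_real (coef e (snd (F z)))) has_derivative M) (at z)"
      unfolding M_def
      by (intro derivative_intros F' bounded_linear.has_derivative[OF bounded_linear_of_real]
          bounded_linear.has_derivative[OF coef_linear] has_derivative_fst has_derivative_snd)
    interpret M: bounded_linear M by (rule has_derivative_bounded_linear[OF d])
    have i: "M (\<i> * w) = \<i> * M w" for w
      by (simp add: M_def F'(2) mult_i_def c.neg algebra_simps)
    have "M w = M 1 * w" for w
    proof -
      have "w = Re w *\<^sub>R 1 + Im w *\<^sub>R (\<i> * 1)" by (simp add: complex_eq_iff)
      then have "M w = Re w *\<^sub>R M 1 + Im w *\<^sub>R M (\<i> * 1)" by (metis M.add M.scaleR)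
      also have "\<dots> = M 1 * (Re w *\<^sub>R 1 + Im w *\<^sub>R \<i>)" unfolding i by (simp add: algebra_simps scaleR_conv_of_real)
      also have "Re w *\<^sub>R 1 + Im w *\<^sub>R \<i> = w" by (simp add: complex_eq_iff)
      finally show ?thesis .
    qed
    then have MM: "(*) (M 1) = M" by (intro ext) (rule sym)
    have "((\<lambda>z. of_real (coef e (fst (F z))) + \<i> * of_real (coef e (snd (F z)))) has_field_derivative M 1) (at z)"
      unfolding has_field_derivative_def MM by (rule d)
    moreover have "stem_coef e F = (\<lambda>z. of_real (coef e (fst (F z))) + \<i> * of_real (coef e (snd (F z))))"
      by (simp add: fun_eq_iff stem_coef_def Complex_eq)
    ultimately show ?thesis unfolding field_differentiable_def by auto
  qed
  then show ?thesis by (simp add: holomorphic_on_def field_differentiable_at_within)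
qed

lemma stem_coef_cnj:
  assumes "stem_on W F" "z \<in> W" shows "stem_coef e F (cnj z) = cnj (stem_coef e F z)"
proof -
  interpret c: bounded_linear "coef e" by (rule coef_linear)
  show ?thesis using assms by (simp add: stem_coef_def stem_on_def c.neg complex_eq_iff)
qed

lemma stem_coef_expansion:
  assumes jk: "\<jj> \<in> \<S>" "\<kappa> \<in> \<S>" "\<jj> * \<kappa> = - (\<kappa> * \<jj>)"
    and F: "induces_on W F f" and z: "z \<in> W" "\<iota> \<in> \<S>"
  shows "f (slice \<iota> z) = slice \<iota> (stem_coef (-1) F z) + slice \<iota> (stem_coef \<jj> F z) * \<jj>
    + slice \<iota> (stem_coef \<kappa> F z) * \<kappa> + slice \<iota> (stem_coef (\<jj> * \<kappa>) F z) * \<jj> * \<kappa>"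
proof -
  have "f (slice \<iota> z) = fst (F z) + \<iota> * snd (F z)" using F z by (simp add: induces_on_def)
  also have "\<dots> = (of_real (coef (-1) (fst (F z))) + of_real (coef \<jj> (fst (F z))) * \<jj> + of_real (coef \<kappa> (fst (F z))) * \<kappa>
    + of_real (coef (\<jj> * \<kappa>) (fst (F z))) * \<jj> * \<kappa>) + \<iota> * (of_real (coef (-1) (snd (F z))) + of_real (coef \<jj> (snd (F z))) * \<jj>
    + of_real (coef \<kappa> (snd (F z))) * \<kappa> + of_real (coef (\<jj> * \<kappa>) (snd (F z))) * \<jj> * \<kappa>)"
    using quat_basis_expansion[OF jk, of "fst (F z)"] quat_basis_expansion[OF jk, of "snd (F z)"] by argo
  also have "\<dots> = slice \<iota> (stem_coef (-1) F z) + slice \<iota> (stem_coef \<jj> F z) * \<jj>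
    + slice \<iota> (stem_coef \<kappa> F z) * \<kappa> + slice \<iota> (stem_coef (\<jj> * \<kappa>) F z) * \<jj> * \<kappa>"
    by (simp add: slice_def stem_coef_def distrib_left distrib_right mult.assoc add_ac)
  finally show ?thesis .
qed

text \<open>Real part and norm determine the point of the plane up to conjugation, and a conjugation
  is undone by the opposite unit.\<close>

lemma circular_slice:
  assumes W: "circular W" and \<iota>: "\<iota> \<in> \<S>" "\<iota>' \<in> \<S>" and z: "slice \<iota> z \<in> W"
  shows "slice \<iota>' z \<in> W"
proof -
  obtain D where D: "W = Omega D" using W by (auto simp: circular_def)
  obtain \<iota>1 z1 where 1: "\<iota>1 \<in> \<S>" "z1 \<in> D" "slice \<iota> z = slice \<iota>1 z1" using z unfolding D Omega_def by blast
  have "Re z = Re z1" using arg_cong[OF 1(3), of qre] \<iota> 1(1) by simp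
  moreover have "norm z = norm z1" using arg_cong[OF 1(3), of norm] \<iota> 1(1) by (simp add: norm_slice)
  then have "(Re z)\<^sup>2 + (Im z)\<^sup>2 = (Re z1)\<^sup>2 + (Im z1)\<^sup>2" by (simp flip: cmod_power2)
  ultimately have "z1 = z \<or> z1 = cnj z" by (auto simp: complex_eq_iff power2_eq_iff)
  then show ?thesis
  proof
    assume "z1 = z" then show ?thesis using 1 \<iota> unfolding D Omega_def by blast
  next
    assume "z1 = cnj z"
    then have "slice \<iota>' z = slice (- \<iota>') z1" by (simp add: slice_uminus_unit)
    then show ?thesis using 1 \<iota> uminus_imag_unit unfolding D Omega_def by blast
  qed
qed

lemma circular_profile: "circular W \<Longrightarrow> \<iota> \<in> \<S> \<Longrightarrow> profile W = {z. slice \<iota> z \<in> W}"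
  unfolding profile_def using circular_slice by blast

lemma continuous_on_slice: "continuous_on S (slice \<iota>)"
  unfolding slice_def[abs_def] by (intro continuous_intros)

text \<open>A total extension of a plane function to all quaternions. At real q the sign of the
  vector part is 0, which suppresses the imaginary part of h; for conjugation-symmetric h that part
  is 0 there anyway.\<close>

definition lift :: "(complex \<Rightarrow> complex) \<Rightarrow> quat \<Rightarrow> quat" where
  "lift h q = (let v = q - of_real (qre q); w = h (Complex (qre q) (norm v)) in of_real (Re w) + sgn v * of_real (Im w))"

lemma lift_slice:
  assumes \<iota>: "\<iota> \<in> \<S>" and h: "h (cnj z) = cnj (h z)"
  shows "lift h (slice \<iota> z) = slice \<iota> (h z)"
proof -
  have v: "slice \<iota> z - of_real (Re z) = Im z *\<^sub>R \<iota>" by (simp add: slice_def of_real_def)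
  have n: "norm \<iota> = 1" using norm_slice[OF \<iota>, of \<i>] by (simp add: slice_def)
  have l: "lift h (slice \<iota> z) = of_real (Re (h (Complex (Re z) \<bar>Im z\<bar>))) + (sgn (Im z) *\<^sub>R \<iota>) * of_real (Im (h (Complex (Re z) \<bar>Im z\<bar>)))"
    by (simp add: lift_def Let_def v \<iota> n sgn_scaleR) (simp add: sgn_div_norm n)
  \<comment> \<open>\<open>lift\<close> always evaluates h in the closed upper half plane, so the
    lower half plane needs the symmetry of h together with the sign of the unit.\<close>
  consider "Im z > 0" | "Im z < 0" | "Im z = 0" by linarith
  then show ?thesis
  proof cases
    case 1
    then have "Complex (Re z) \<bar>Im z\<bar> = z" by (simp add: complex_eq_iff)
    then show ?thesis unfolding l using 1 by (simp add: slice_def)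
  next
    case 2
    then have "Complex (Re z) \<bar>Im z\<bar> = cnj z" by (simp add: complex_eq_iff)
    then show ?thesis unfolding l using 2 by (simp add: slice_def h)
  next
    case 3
    then have e: "Complex (Re z) \<bar>Im z\<bar> = z" "cnj z = z" by (simp_all add: complex_eq_iff)
    then have "Im (h z) = 0" using arg_cong[OF h, of Im] by simp
    then show ?thesis unfolding l using 3 e by (simp add: slice_def)
  qed
qed

section \<open>Comparison of the two calculi\<close>

text \<open>\<open>symm_re k\<close> and \<open>symm_im k\<close> are the parts of k for the
  involution that conjugates argument and value: k = \<open>symm_re k\<close> + i
  \<open>symm_im k\<close>, with both parts symmetric under conjugation. Only such functions are
  stems of real slice functions.\<close>

definition symm_re :: "(complex \<Rightarrow> complex) \<Rightarrow> complex \<Rightarrow> complex" where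
  "symm_re k w = (k w + cnj (k (cnj w))) / 2"

definition symm_im :: "(complex \<Rightarrow> complex) \<Rightarrow> complex \<Rightarrow> complex" where
  "symm_im k w = (k w - cnj (k (cnj w))) / (2 * \<i>)"

text \<open>Stated for any \<Psi> meeting the specification, since
  \<open>real_slice_calculus\<close> is a choice among such maps.\<close>

locale real_slice_calc =
  fixes T :: "'h::quaternionic_hilbert \<Rightarrow>\<^sub>L 'h" and \<Psi> :: "(quat \<Rightarrow> quat) \<Rightarrow> 'h \<Rightarrow>\<^sub>L 'h"
  assumes T_qlin: "T \<in> \<BB>" and calculus: "is_real_slice_calculus T \<Psi>"
begin

abbreviation D :: "complex set" where "D \<equiv> profile (\<sigma>\<^sub>S T)"
abbreviation SR :: "(quat \<Rightarrow> quat) set" where "SR \<equiv> slice_cont_real (\<sigma>\<^sub>S T)"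

definition intrinsic :: "(complex \<Rightarrow> complex) \<Rightarrow> bool" where
  "intrinsic h \<longleftrightarrow> continuous_on D h \<and> (\<forall>z\<in>D. h (cnj z) = cnj (h z))"

definition \<Phi> :: "(complex \<Rightarrow> complex) \<Rightarrow> 'h \<Rightarrow>\<^sub>L 'h" where "\<Phi> h = \<Psi> (lift h)"

definition represents :: "(quat \<Rightarrow> quat) \<Rightarrow> (complex \<Rightarrow> complex) \<Rightarrow> bool" where
  "represents g h \<longleftrightarrow> intrinsic h \<and> (\<forall>\<iota>\<in>\<S>. \<forall>z\<in>D. g (slice \<iota> z) = slice \<iota> (h z))"

lemma \<Psi>_laws:
  "g \<in> SR \<Longrightarrow> \<Psi> g \<in> \<BB>"
  "g \<in> SR \<Longrightarrow> h \<in> SR \<Longrightarrow> \<Psi> (\<lambda>q. g q + h q) = \<Psi> g + \<Psi> h"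
  "g \<in> SR \<Longrightarrow> h \<in> SR \<Longrightarrow> \<Psi> (\<lambda>q. g q * h q) = \<Psi> g o\<^sub>L \<Psi> h"
  "g \<in> SR \<Longrightarrow> \<Psi> (\<lambda>q. r *\<^sub>R g q) = r *\<^sub>R \<Psi> g"
  "\<Psi> (\<lambda>q. 1) = id_blinfun" "\<Psi> (\<lambda>q. q) = T"
  "g \<in> SR \<Longrightarrow> e > 0 \<Longrightarrow> \<exists>d>0. \<forall>h\<in>SR. (\<forall>q\<in>\<sigma>\<^sub>S T. norm (h q - g q) \<le> d) \<longrightarrow> norm (\<Psi> h - \<Psi> g) < e"
  using calculus unfolding is_real_slice_calculus_def by (elim conjE; blast)+

text \<open>A function equal to g on the spectrum is within every d of g, so continuity at g with e
  = norm (\<Psi> h - \<Psi> g) would give e < e.\<close>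

lemma \<Psi>_cong:
  assumes "g \<in> SR" "h \<in> SR" "\<And>q. q \<in> \<sigma>\<^sub>S T \<Longrightarrow> h q = g q" shows "\<Psi> h = \<Psi> g"
proof (rule ccontr)
  assume "\<Psi> h \<noteq> \<Psi> g"
  then have "norm (\<Psi> h - \<Psi> g) > 0" by simp
  from \<Psi>_laws(7)[OF assms(1) this] obtain d where "d > 0"
    "\<forall>k\<in>SR. (\<forall>q\<in>\<sigma>\<^sub>S T. norm (k q - g q) \<le> d) \<longrightarrow> norm (\<Psi> k - \<Psi> g) < norm (\<Psi> h - \<Psi> g)" by blast
  with assms(2,3) show False by force
qed

lemma represents_SR: assumes "represents g h" shows "g \<in> SR"
proof -
  let ?F = "\<lambda>z. (of_real (Re (h z)), of_real (Im (h z))) :: quat \<times> quat"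
  have h: "continuous_on D h" "\<And>z. z \<in> D \<Longrightarrow> h (cnj z) = cnj (h z)"
    using assms by (auto simp: represents_def intrinsic_def)
  have "stem_on D ?F" by (simp add: stem_on_def h(2) cnj_profile_spectrum)
  moreover have "continuous_on D ?F" by (intro continuous_intros h(1))
  moreover have "induces_on D ?F g" using assms by (simp add: induces_on_def represents_def slice_def)
  ultimately show ?thesis unfolding slice_cont_real_def by (intro CollectI exI[of _ ?F]) simp
qed

lemma represents_lift: "intrinsic h \<Longrightarrow> represents (lift h) h"
  by (simp add: represents_def intrinsic_def lift_slice)

lemma \<Psi>_eq: assumes "represents g h" shows "\<Psi> g = \<Phi> h"
  unfolding \<Phi>_def
proof (rule \<Psi>_cong)
  have l: "represents (lift h) h" by (rule represents_lift) (use assms in \<open>simp add: represents_def\<close>)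
  then show "lift h \<in> SR" "g \<in> SR" using assms represents_SR by auto
  fix q assume "q \<in> \<sigma>\<^sub>S T"
  then show "g q = lift h q" using spectrum_slice[of q T] assms l by (auto simp: represents_def)
qed

lemma intrinsic_intros:
  "intrinsic h \<Longrightarrow> intrinsic k \<Longrightarrow> intrinsic (\<lambda>z. h z + k z)"
  "intrinsic h \<Longrightarrow> intrinsic k \<Longrightarrow> intrinsic (\<lambda>z. h z * k z)"
  "intrinsic h \<Longrightarrow> intrinsic (\<lambda>z. of_real r * h z)"
  "intrinsic (\<lambda>z. 1)" "intrinsic (\<lambda>z. z)"
  by (auto simp: intrinsic_def intro!: continuous_intros)

lemma \<Phi>_add: "intrinsic h \<Longrightarrow> intrinsic k \<Longrightarrow> \<Phi> (\<lambda>z. h z + k z) = \<Phi> h + \<Phi> k"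
proof -
  assume hk: "intrinsic h" "intrinsic k"
  note l = represents_lift[OF hk(1)] represents_lift[OF hk(2)]
  have "represents (\<lambda>q. lift h q + lift k q) (\<lambda>z. h z + k z)"
    using l by (auto simp: represents_def slice_add intro: intrinsic_intros)
  from \<Psi>_eq[OF this] show ?thesis using l by (simp add: \<Psi>_laws represents_SR \<Phi>_def)
qed

lemma \<Phi>_mult: "intrinsic h \<Longrightarrow> intrinsic k \<Longrightarrow> \<Phi> (\<lambda>z. h z * k z) = \<Phi> h o\<^sub>L \<Phi> k"
proof -
  assume hk: "intrinsic h" "intrinsic k"
  note l = represents_lift[OF hk(1)] represents_lift[OF hk(2)]
  have "represents (\<lambda>q. lift h q * lift k q) (\<lambda>z. h z * k z)"
    using l by (auto simp: represents_def slice_mult intro: intrinsic_intros)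
  from \<Psi>_eq[OF this] show ?thesis using l by (simp add: \<Psi>_laws represents_SR \<Phi>_def)
qed

lemma \<Phi>_scale: "intrinsic h \<Longrightarrow> \<Phi> (\<lambda>z. of_real r * h z) = r *\<^sub>R \<Phi> h"
proof -
  assume h: "intrinsic h"
  note l = represents_lift[OF h]
  have "represents (\<lambda>q. r *\<^sub>R lift h q) (\<lambda>z. of_real r * h z)"
    using l intrinsic_intros(3)[OF h] by (auto simp: represents_def slice_scaleR simp flip: scaleR_conv_of_real)
  from \<Psi>_eq[OF this] show ?thesis using l by (simp add: \<Psi>_laws represents_SR \<Phi>_def)
qed

lemma \<Phi>_one: "\<Phi> (\<lambda>z. 1) = id_blinfun"
proof -
  have "represents (\<lambda>q. 1) (\<lambda>z. 1)" by (simp add: represents_def intrinsic_intros)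
  from \<Psi>_eq[OF this] show ?thesis by (simp add: \<Psi>_laws)
qed

lemma \<Phi>_id: "\<Phi> (\<lambda>z. z) = T"
proof -
  have "represents (\<lambda>q. q) (\<lambda>z. z)" by (simp add: represents_def intrinsic_intros)
  from \<Psi>_eq[OF this] show ?thesis by (simp add: \<Psi>_laws)
qed

lemma \<Phi>_qlin: "intrinsic h \<Longrightarrow> \<Phi> h \<in> \<BB>"
  unfolding \<Phi>_def by (intro \<Psi>_laws represents_SR[OF represents_lift])

lemma intrinsic_cong: "intrinsic h \<Longrightarrow> (\<And>z. z \<in> D \<Longrightarrow> h z = k z) \<Longrightarrow> intrinsic k"
proof -
  assume h: "intrinsic h" and eq: "\<And>z. z \<in> D \<Longrightarrow> h z = k z"
  have "k (cnj z) = cnj (k z)" if "z \<in> D" for z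
    using h eq[OF that] eq[OF cnj_profile_spectrum[OF that]] that by (simp add: intrinsic_def)
  moreover have "continuous_on D k" using h eq by (simp add: intrinsic_def cong: continuous_on_cong)
  ultimately show "intrinsic k" by (simp add: intrinsic_def)
qed

lemma \<Phi>_cong: "intrinsic h \<Longrightarrow> (\<And>z. z \<in> D \<Longrightarrow> h z = k z) \<Longrightarrow> \<Phi> h = \<Phi> k"
proof -
  assume h: "intrinsic h" "\<And>z. z \<in> D \<Longrightarrow> h z = k z"
  have "represents (lift h) k"
    using represents_lift[OF h(1)] intrinsic_cong[OF h] h(2) by (auto simp: represents_def)
  from \<Psi>_eq[OF this] show ?thesis by (simp add: \<Phi>_def)
qed

lemma intrinsic_zero: "intrinsic (\<lambda>z. 0)" and \<Phi>_zero: "\<Phi> (\<lambda>z. 0) = 0"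
  using intrinsic_intros(3)[OF intrinsic_intros(4), of 0] \<Phi>_scale[OF intrinsic_intros(4), of 0] by simp_all

lemma intrinsic_sum: "(\<And>i. i \<in> I \<Longrightarrow> intrinsic (k i)) \<Longrightarrow> intrinsic (\<lambda>z. \<Sum>i\<in>I. k i z)"
  by (induction I rule: infinite_finite_induct) (auto intro: intrinsic_zero intrinsic_intros)

lemma \<Phi>_sum: "finite I \<Longrightarrow> (\<And>i. i \<in> I \<Longrightarrow> intrinsic (k i)) \<Longrightarrow> \<Phi> (\<lambda>z. \<Sum>i\<in>I. k i z) = (\<Sum>i\<in>I. \<Phi> (k i))"
  by (induction I rule: finite_induct) (simp_all add: \<Phi>_zero \<Phi>_add intrinsic_sum)

lemma \<Phi>_sum_list: "(\<And>x. x \<in> set xs \<Longrightarrow> intrinsic (k x)) \<Longrightarrow>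
    intrinsic (\<lambda>z. \<Sum>x\<leftarrow>xs. k x z) \<and> \<Phi> (\<lambda>z. \<Sum>x\<leftarrow>xs. k x z) = (\<Sum>x\<leftarrow>xs. \<Phi> (k x))"
  by (induction xs) (simp_all add: \<Phi>_zero \<Phi>_add intrinsic_zero intrinsic_intros)

lemma \<Phi>_continuous:
  assumes h: "intrinsic h" and e: "e > 0"
  shows "\<exists>d>0. \<forall>k. intrinsic k \<and> (\<forall>z\<in>D. norm (k z - h z) \<le> d) \<longrightarrow> norm (\<Phi> k - \<Phi> h) < e"
proof -
  obtain d where d: "d > 0" "\<And>g. g \<in> SR \<Longrightarrow> (\<forall>q\<in>\<sigma>\<^sub>S T. norm (g q - lift h q) \<le> d) \<Longrightarrow> norm (\<Psi> g - \<Psi> (lift h)) < e"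
    using \<Psi>_laws(7)[OF represents_SR[OF represents_lift[OF h]] e] by blast
  show ?thesis
  proof (intro exI[of _ d] conjI allI impI)
    fix k assume k: "intrinsic k \<and> (\<forall>z\<in>D. norm (k z - h z) \<le> d)"
    show "norm (\<Phi> k - \<Phi> h) < e"
      unfolding \<Phi>_def
    proof (rule d(2))
      show "lift k \<in> SR" using k represents_SR represents_lift by blast
      show "\<forall>q\<in>\<sigma>\<^sub>S T. norm (lift k q - lift h q) \<le> d"
      proof
        fix q assume "q \<in> \<sigma>\<^sub>S T"
        then obtain \<iota> z where z: "\<iota> \<in> \<S>" "z \<in> D" "q = slice \<iota> z" using spectrum_slice by blast
        then have "lift k q - lift h q = slice \<iota> (k z - h z)"
          using represents_lift[OF h] represents_lift[OF conjunct1[OF k]] by (simp add: represents_def slice_diff)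
        then show "norm (lift k q - lift h q) \<le> d" using k z by (simp add: norm_slice)
      qed
    qed
  qed (rule d(1))
qed

lemma intrinsic_symm:
  assumes "continuous_on D k" shows "intrinsic (symm_re k)" "intrinsic (symm_im k)"
proof -
  have "continuous_on D (\<lambda>z. k (cnj z))"
    by (rule continuous_on_compose2[OF assms]) (auto intro!: continuous_intros cnj_profile_spectrum)
  then show "intrinsic (symm_re k)" "intrinsic (symm_im k)"
    using assms by (auto simp: intrinsic_def symm_re_def[abs_def] symm_im_def[abs_def] divide_simps intro!: continuous_intros)
      (simp_all add: algebra_simps)
qed

text \<open>The stem of the inverse of \<open>Delta\<close>: the reciprocal of the real polynomial
  w\<cdot>w - 2 Re z w + \<bar>z\<bar>\<cdot>\<bar>z\<bar>, factored over the complex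
  numbers.\<close>

definition kernel :: "complex \<Rightarrow> complex \<Rightarrow> complex" where
  "kernel z w = 1 / ((w - z) * (w - cnj z))"

lemma cnj_notin: "z \<notin> D \<Longrightarrow> cnj z \<notin> D"
  using cnj_profile_spectrum[of "cnj z" T] by auto

lemma intrinsic_kernel: "z \<notin> D \<Longrightarrow> intrinsic (kernel z)"
  using cnj_notin[of z] by (auto simp: intrinsic_def kernel_def[abs_def] mult.commute intro!: continuous_intros)

lemma inverse_sph: assumes z: "z \<notin> D" shows "inverse_op (sph_op T z) = \<Phi> (kernel z)"
proof (rule inverse_op_eq)
  \<comment> \<open>The product with 1 presents the constant term as a real multiple of the unit
    function, the shape on which the laws of \<Phi> act.\<close>
  let ?\<rho> = "\<lambda>w. w * w + (of_real (- 2 * Re z) * w + of_real ((norm z)\<^sup>2) * 1)"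
  have i: "intrinsic ?\<rho>" by (intro intrinsic_intros)
  have \<rho>: "\<Phi> ?\<rho> = sph_op T z"
  proof -
    have "\<Phi> ?\<rho> = (T o\<^sub>L T) + ((- 2 * Re z) *\<^sub>R T + (norm z)\<^sup>2 *\<^sub>R id_blinfun)"
      by (simp only: \<Phi>_add \<Phi>_mult \<Phi>_scale \<Phi>_one \<Phi>_id intrinsic_intros)
    then show ?thesis by (simp add: sph_op_def)
  qed
  have n: "of_real ((norm z)\<^sup>2) = z * cnj z" by (rule complex_norm_square)
  have r: "of_real (- 2 * Re z) = - z - cnj z" by (simp add: complex_eq_iff)
  have one: "?\<rho> w * kernel z w = 1" if w: "w \<in> D" for w
  proof -
    have "w \<noteq> z" "w \<noteq> cnj z" using w z cnj_notin[OF z] by auto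
    moreover have "?\<rho> w = (w - z) * (w - cnj z)" unfolding n r by (simp add: algebra_simps)
    ultimately show ?thesis by (simp add: kernel_def)
  qed
  note ik = intrinsic_kernel[OF z]
  have "\<Phi> (\<lambda>w. ?\<rho> w * kernel z w) = id_blinfun" "\<Phi> (\<lambda>w. kernel z w * ?\<rho> w) = id_blinfun"
    unfolding \<Phi>_one[symmetric]
    by (rule \<Phi>_cong, (intro intrinsic_intros ik), use one in \<open>simp add: mult.commute\<close>)+
  then show "is_inverse_op (sph_op T z) (\<Phi> (kernel z))"
    unfolding is_inverse_op_def \<Phi>_mult[OF i ik] \<Phi>_mult[OF ik i] \<rho> using \<Phi>_qlin[OF ik] by simp
qed

text \<open>Over the common denominator, c / (z - w) has the numerator
  \<open>cnj z * c - w * c\<close>. As \<open>kernel z\<close> and w are conjugation symmetric,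
  symmetrising acts only on the coefficients \<open>cnj z * c\<close> and c, taking their real or
  imaginary parts.\<close>

lemma kernel_symm:
  assumes z: "z \<notin> D" and w: "w \<in> D"
  shows "symm_re (\<lambda>w. c / (z - w)) w = of_real (Re (cnj z * c)) * kernel z w + of_real (- Re c) * (kernel z w * w)"
    "symm_im (\<lambda>w. c / (z - w)) w = of_real (Im (cnj z * c)) * kernel z w + of_real (- Im c) * (kernel z w * w)"
proof -
  have nz: "w - z \<noteq> 0" "w - cnj z \<noteq> 0" using w z cnj_notin[OF z] by auto
  have a: "c / (z - w) = (cnj z * c - w * c) * kernel z w"
  proof -
    have "(cnj z * c - w * c) * kernel z w = - c * ((w - cnj z) / ((w - z) * (w - cnj z)))"
      by (simp add: kernel_def algebra_simps flip: diff_divide_distrib)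
    also have "\<dots> = - c / (w - z)" using nz by simp
    also have "\<dots> = c / (z - w)" by (metis minus_diff_eq minus_divide_divide minus_divide_left minus_minus)
    finally show ?thesis by simp
  qed
  have b: "cnj (c / (z - cnj w)) = (z * cnj c - w * cnj c) * kernel z w"
  proof -
    have "(z * cnj c - w * cnj c) * kernel z w = - cnj c * ((w - z) / ((w - z) * (w - cnj z)))"
      by (simp add: kernel_def algebra_simps flip: diff_divide_distrib)
    also have "\<dots> = - cnj c / (w - cnj z)" using nz by simp
    also have "\<dots> = cnj c / (cnj z - w)" by (metis minus_diff_eq minus_divide_divide minus_divide_left minus_minus)
    finally show ?thesis by simp
  qed
  have re: "of_real (Re x) = (x + cnj x) / 2" and im: "of_real (Im x) = (x - cnj x) / (2 * \<i>)" for x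
    by (simp_all add: complex_eq_iff)
  show "symm_re (\<lambda>w. c / (z - w)) w = of_real (Re (cnj z * c)) * kernel z w + of_real (- Re c) * (kernel z w * w)"
    unfolding symm_re_def a b of_real_minus re by (simp add: field_simps)
  show "symm_im (\<lambda>w. c / (z - w)) w = of_real (Im (cnj z * c)) * kernel z w + of_real (- Im c) * (kernel z w * w)"
    unfolding symm_im_def a b of_real_minus im by (simp add: field_simps)
qed

end

section \<open>Cauchy kernels and contour integrals of operators\<close>

locale slice_resolvent = real_slice_calc T \<Psi> for T :: "'h::quaternionic_hilbert \<Rightarrow>\<^sub>L 'h" and \<Psi> +
  fixes L :: "quat \<Rightarrow> 'h \<Rightarrow>\<^sub>L 'h" and \<iota> :: quat
  assumes L: "left_scalar_mult L" and \<iota>: "\<iota> \<in> \<S>"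
begin

lemmas L_laws = left_scalar_mult_algebra[OF L]

lemma L_slice: "L (slice \<iota> c) = Re c *\<^sub>R id_blinfun + Im c *\<^sub>R L \<iota>"
proof -
  have "slice \<iota> c = Re c *\<^sub>R 1 + Im c *\<^sub>R \<iota>" by (simp add: slice_def of_real_def)
  then show ?thesis by (simp only: L_laws)
qed

text \<open>\<Phi> extended from symmetric to complex functions, applied to c / (z - w): the complex
  unit becomes composition with \<open>L \<iota>\<close> on the right.\<close>

definition resolvent_op :: "complex \<Rightarrow> complex \<Rightarrow> 'h \<Rightarrow>\<^sub>L 'h" where
  "resolvent_op z c = \<Phi> (symm_re (\<lambda>w. c / (z - w))) + (\<Phi> (symm_im (\<lambda>w. c / (z - w))) o\<^sub>L L \<iota>)"

lemma kernel_continuous: "z \<notin> D \<Longrightarrow> continuous_on D (\<lambda>w. c / (z - w))"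
  by (intro continuous_intros) auto

text \<open>Composing the resolvent with \<open>L (slice \<iota> c)\<close> merges the conjugate of
  z with c inside the slice. Each remaining L is a real combination of the identity and
  \<open>L \<iota>\<close>, already at the right end, so it never has to pass T.\<close>

lemma resolvent_eq:
  assumes z: "z \<notin> D"
  shows "left_S_resolvent L T (slice \<iota> z) o\<^sub>L L (slice \<iota> c) = resolvent_op z c"
proof -
  define R where "R = \<Phi> (kernel z)"
  have ik: "intrinsic (kernel z)" "intrinsic (\<lambda>w. kernel z w * w)"
    by (intro intrinsic_intros intrinsic_kernel z)+
  have RT: "\<Phi> (\<lambda>w. kernel z w * w) = R o\<^sub>L T" by (simp only: \<Phi>_mult ik intrinsic_intros \<Phi>_id R_def)
  have P: "\<Phi> (symm_re (\<lambda>w. c / (z - w))) = Re (cnj z * c) *\<^sub>R R + (- Re c) *\<^sub>R (R o\<^sub>L T)"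
  proof -
    have "\<Phi> (symm_re (\<lambda>w. c / (z - w))) = \<Phi> (\<lambda>w. of_real (Re (cnj z * c)) * kernel z w + of_real (- Re c) * (kernel z w * w))"
      by (rule \<Phi>_cong[OF intrinsic_symm(1)[OF kernel_continuous[OF z]] kernel_symm(1)[OF z]])
    then show ?thesis by (simp only: \<Phi>_add \<Phi>_scale intrinsic_intros ik RT R_def[symmetric])
  qed
  have Q: "\<Phi> (symm_im (\<lambda>w. c / (z - w))) = Im (cnj z * c) *\<^sub>R R + (- Im c) *\<^sub>R (R o\<^sub>L T)"
  proof -
    have "\<Phi> (symm_im (\<lambda>w. c / (z - w))) = \<Phi> (\<lambda>w. of_real (Im (cnj z * c)) * kernel z w + of_real (- Im c) * (kernel z w * w))"
      by (rule \<Phi>_cong[OF intrinsic_symm(2)[OF kernel_continuous[OF z]] kernel_symm(2)[OF z]])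
    then show ?thesis by (simp only: \<Phi>_add \<Phi>_scale intrinsic_intros ik RT R_def[symmetric])
  qed
  have "left_S_resolvent L T (slice \<iota> z) o\<^sub>L L (slice \<iota> c) =
      (R o\<^sub>L (L (qcnj (slice \<iota> z)) o\<^sub>L L (slice \<iota> c))) - ((R o\<^sub>L T) o\<^sub>L L (slice \<iota> c))"
    unfolding left_S_resolvent_def Delta_slice[OF \<iota>] inverse_sph[OF z] R_def[symmetric]
    by (rule blinfun_eqI) (simp add: blinfun.bilinear_simps)
  also have "L (qcnj (slice \<iota> z)) o\<^sub>L L (slice \<iota> c) = L (slice \<iota> (cnj z * c))"
    by (simp add: L_laws slice_mult slice_cnj \<iota>)
  also have "(R o\<^sub>L L (slice \<iota> (cnj z * c))) - ((R o\<^sub>L T) o\<^sub>L L (slice \<iota> c)) = resolvent_op z c"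
    unfolding resolvent_op_def P Q L_slice
    by (rule blinfun_eqI) (simp only: blinfun_apply_blinfun_compose blinfun.bilinear_simps blinfun_apply_id_blinfun id_apply
      , simp add: algebra_simps)
  finally show ?thesis .
qed

definition cauchy_op :: "(complex \<Rightarrow> complex) \<Rightarrow> (real \<Rightarrow> complex) \<Rightarrow> 'h \<Rightarrow>\<^sub>L 'h" where
  "cauchy_op H \<gamma> = \<Phi> (symm_re (\<lambda>w. path_int (\<lambda>s. H s / (s - w)) \<gamma>)) + (\<Phi> (symm_im (\<lambda>w. path_int (\<lambda>s. H s / (s - w)) \<gamma>)) o\<^sub>L L \<iota>)"

context
  fixes \<gamma> :: "real \<Rightarrow> complex" and H :: "complex \<Rightarrow> complex" and V :: "complex set"
  assumes \<gamma>: "path \<gamma>" "rectifiable \<gamma>" and H: "continuous_on (path_image \<gamma>) H"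
    and V: "open V" "D \<subseteq> V" "V \<inter> path_image \<gamma> = {}"
begin

lemma cauchy_kernel_continuous: "continuous_on (path_image \<gamma> \<times> V) (\<lambda>(s, w). H s / (s - w))"
proof -
  have "continuous_on (path_image \<gamma> \<times> V) (\<lambda>x. H (fst x))"
    by (intro continuous_on_compose2[OF H] continuous_intros) auto
  then show ?thesis unfolding case_prod_beta by (intro continuous_intros) (use V in auto)
qed

lemma cauchy_transform_continuous: "continuous_on D (\<lambda>w. path_int (\<lambda>s. H s / (s - w)) \<gamma>)"
proof -
  have "(\<lambda>w. path_int (\<lambda>s. H s / (s - w)) \<gamma>) holomorphic_on V"
    by (intro pint_holomorphic \<gamma> V cauchy_kernel_continuous holomorphic_intros) (use V in auto)
  then show ?thesis using V(2) holomorphic_on_imp_continuous_on continuous_on_subset by blast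
qed

lemma cauchy_op_integral: "has_line_integral (\<lambda>s ds. resolvent_op s (H s * ds)) \<gamma> (cauchy_op H \<gamma>)"
  unfolding has_line_integral_def
proof (intro allI impI)
  fix e :: real assume e: "e > 0"
  define C where "C w = path_int (\<lambda>s. H s / (s - w)) \<gamma>" for w
  have cC: "continuous_on D C" unfolding C_def by (rule cauchy_transform_continuous)
  \<comment> \<open>\<Phi> of the imaginary part is composed with \<open>L \<iota>\<close>, so its
    tolerance k is chosen with k * norm (\<open>L \<iota>\<close>) \<le> e / 2.\<close>
  define m where "m = norm (L \<iota>) + 1"
  define k where "k = e / (2 * m)"
  have nL: "m > 0" by (simp add: m_def add_nonneg_pos)
  have k: "k > 0" "k * norm (L \<iota>) \<le> e / 2"
  proof -
    show "k > 0" using e nL by (simp add: k_def)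
    then have "k * norm (L \<iota>) \<le> k * m" by (simp add: m_def)
    also have "\<dots> = e / 2" using nL by (simp add: k_def)
    finally show "k * norm (L \<iota>) \<le> e / 2" .
  qed
  obtain d1 where d1: "d1 > 0" "\<And>g. intrinsic g \<Longrightarrow> (\<forall>z\<in>D. norm (g z - symm_re C z) \<le> d1) \<Longrightarrow> norm (\<Phi> g - \<Phi> (symm_re C)) < e / 2"
    using \<Phi>_continuous[OF intrinsic_symm(1)[OF cC] half_gt_zero[OF e]] by blast
  obtain d2 where d2: "d2 > 0" "\<And>g. intrinsic g \<Longrightarrow> (\<forall>z\<in>D. norm (g z - symm_im C z) \<le> d2) \<Longrightarrow> norm (\<Phi> g - \<Phi> (symm_im C)) < k"
    using \<Phi>_continuous[OF intrinsic_symm(2)[OF cC] k(1)] by blast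
  have "continuous_on (path_image \<gamma> \<times> D) (\<lambda>(s, w). H s / (s - w))"
    by (rule continuous_on_subset[OF cauchy_kernel_continuous]) (use V in auto)
  moreover have "min d1 d2 > 0" using d1(1) d2(1) by simp
  ultimately have "\<exists>d>0. \<forall>p. fine_tagged d p \<longrightarrow>
     (\<forall>w\<in>D. norm (rsum (\<lambda>s. H s / (s - w)) \<gamma> p - C w) < min d1 d2)"
    unfolding C_def by (intro rsum_uniform[OF \<gamma> _ compact_profile_spectrum[OF T_qlin]])
  then
  obtain d where d: "d > 0" "\<And>p. p tagged_division_of {0..1} \<Longrightarrow> (\<lambda>t. ball t d) fine p \<Longrightarrow>
     \<forall>w\<in>D. norm (rsum (\<lambda>s. H s / (s - w)) \<gamma> p - C w) < min d1 d2"
    by blast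
  show "\<exists>d>0. \<forall>p. fine_tagged d p \<longrightarrow>
      norm ((\<Sum>(t, I)\<in>p. resolvent_op (\<gamma> t) (H (\<gamma> t) * (\<gamma> (Sup I) - \<gamma> (Inf I)))) - cauchy_op H \<gamma>) < e"
  proof (intro exI[of _ d] conjI allI impI)
    fix p :: "(real \<times> real set) set" assume "fine_tagged d p"
    then have p: "p tagged_division_of {0..1}" "(\<lambda>t. ball t d) fine p" by auto
    define \<kappa> where "\<kappa> x w = H (\<gamma> (fst x)) * (\<gamma> (Sup (snd x)) - \<gamma> (Inf (snd x))) / (\<gamma> (fst x) - w)" for x :: "real \<times> real set" and w
    have fin: "finite p" using p(1) by blast
    have nD: "\<gamma> (fst x) \<notin> D" if "x \<in> p" for x
      using tagged_cells(2)[OF p(1), of "fst x" "snd x"] that V by (auto simp: path_image_def)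
    have c\<kappa>: "continuous_on D (\<kappa> x)" if "x \<in> p" for x
      unfolding \<kappa>_def by (rule kernel_continuous[OF nD[OF that]])
    have rs: "rsum (\<lambda>s. H s / (s - w)) \<gamma> p = (\<Sum>x\<in>p. \<kappa> x w)" for w
      by (simp add: rsum_def \<kappa>_def case_prod_beta)
    define K where "K w = (\<Sum>x\<in>p. \<kappa> x w)" for w
    have cK: "continuous_on D K" unfolding K_def by (intro continuous_intros c\<kappa>)
    \<comment> \<open>Symmetrisation is additive, so the operator Riemann sum is the extension of
      \<Phi> at the scalar Riemann sum K.\<close>
    have S: "symm_re K = (\<lambda>w. \<Sum>x\<in>p. symm_re (\<kappa> x) w)" "symm_im K = (\<lambda>w. \<Sum>x\<in>p. symm_im (\<kappa> x) w)"
      by (rule ext, simp only: symm_re_def symm_im_def K_def cnj_sum sum_subtractf[symmetric]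
          sum.distrib[symmetric] sum_divide_distrib)+
    have "(\<Sum>(t, I)\<in>p. resolvent_op (\<gamma> t) (H (\<gamma> t) * (\<gamma> (Sup I) - \<gamma> (Inf I)))) =
        (\<Sum>x\<in>p. \<Phi> (symm_re (\<kappa> x)) + (\<Phi> (symm_im (\<kappa> x)) o\<^sub>L L \<iota>))"
      unfolding case_prod_beta resolvent_op_def \<kappa>_def[abs_def] by (rule refl)
    also have "\<dots> = \<Phi> (symm_re K) + (\<Phi> (symm_im K) o\<^sub>L L \<iota>)"
      unfolding S by (simp add: \<Phi>_sum fin intrinsic_symm c\<kappa> sum.distrib
          bounded_bilinear.sum_left[OF bounded_bilinear_blinfun_compose])
    finally have eq: "(\<Sum>(t, I)\<in>p. resolvent_op (\<gamma> t) (H (\<gamma> t) * (\<gamma> (Sup I) - \<gamma> (Inf I)))) - cauchy_op H \<gamma> =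
        (\<Phi> (symm_re K) - \<Phi> (symm_re C)) + ((\<Phi> (symm_im K) - \<Phi> (symm_im C)) o\<^sub>L L \<iota>)"
      unfolding cauchy_op_def C_def[symmetric]
      by (simp add: bounded_bilinear.diff_left[OF bounded_bilinear_blinfun_compose])
    have KC: "norm (K w - C w) \<le> min d1 d2" if "w \<in> D" for w
      using d(2)[OF p] that unfolding rs K_def by force
    \<comment> \<open>Symmetrisation averages contributions from w and \<open>cnj w\<close>, both in
      D, and so does not enlarge the supremum distance.\<close>
    have s1: "norm (symm_re K w - symm_re C w) \<le> min d1 d2" and s2: "norm (symm_im K w - symm_im C w) \<le> min d1 d2" if w: "w \<in> D" for w
    proof -
      have avg: "x \<le> (a + b) / 2 \<Longrightarrow> a \<le> m \<Longrightarrow> b \<le> m \<Longrightarrow> x \<le> m" for x a b m :: real by simp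
      have b: "norm (K w - C w) \<le> min d1 d2" "norm (cnj (K (cnj w) - C (cnj w))) \<le> min d1 d2"
        using KC[OF w] KC[OF cnj_profile_spectrum[OF w]] by (simp_all only: complex_mod_cnj)
      have "symm_re K w - symm_re C w = ((K w - C w) + cnj (K (cnj w) - C (cnj w))) / 2"
        by (simp add: symm_re_def field_simps)
      then have "norm (symm_re K w - symm_re C w) \<le> (norm (K w - C w) + norm (cnj (K (cnj w) - C (cnj w)))) / 2"
        by (simp only: norm_divide) (simp add: norm_triangle_ineq divide_right_mono del: complex_cnj_diff complex_mod_cnj)
      then show "norm (symm_re K w - symm_re C w) \<le> min d1 d2" by (rule avg[OF _ b])
      have "symm_im K w - symm_im C w = ((K w - C w) - cnj (K (cnj w) - C (cnj w))) / (2 * \<i>)"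
        by (simp add: symm_im_def field_simps)
      then have "norm (symm_im K w - symm_im C w) \<le> (norm (K w - C w) + norm (cnj (K (cnj w) - C (cnj w)))) / 2"
        by (simp only: norm_divide norm_mult) (simp add: norm_triangle_ineq4 divide_right_mono del: complex_cnj_diff complex_mod_cnj)
      then show "norm (symm_im K w - symm_im C w) \<le> min d1 d2" by (rule avg[OF _ b])
    qed
    have n1: "norm (\<Phi> (symm_re K) - \<Phi> (symm_re C)) < e / 2"
      by (rule d1(2)[OF intrinsic_symm(1)[OF cK]]) (use s1 in force)
    have n2: "norm (\<Phi> (symm_im K) - \<Phi> (symm_im C)) < k"
      by (rule d2(2)[OF intrinsic_symm(2)[OF cK]]) (use s2 in force)
    have "norm ((\<Phi> (symm_im K) - \<Phi> (symm_im C)) o\<^sub>L L \<iota>) \<le> norm (\<Phi> (symm_im K) - \<Phi> (symm_im C)) * norm (L \<iota>)"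
      by (rule norm_blinfun_compose)
    also have "\<dots> \<le> k * norm (L \<iota>)" using n2 by (intro mult_right_mono) auto
    also have "\<dots> \<le> e / 2" by (rule k(2))
    finally show "norm ((\<Sum>(t, I)\<in>p. resolvent_op (\<gamma> t) (H (\<gamma> t) * (\<gamma> (Sup I) - \<gamma> (Inf I)))) - cauchy_op H \<gamma>) < e"
      unfolding eq by (intro norm_triangle_lt) (use n1 in linarith)
  qed (rule d(1))
qed

end

text \<open>The factor - i stands for the inverse of \<iota> in the integral and turns Cauchy's
  constant 2 pi i into the real number 2 pi, so the total transform is again symmetric under
  conjugation on D.\<close>

lemma cauchy_op_cycle:
  assumes W: "open W" "h holomorphic_on W" "\<And>z. z \<in> W \<Longrightarrow> cnj z \<in> W \<Longrightarrow> h (cnj z) = cnj (h z)"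
    and V: "open V" "bounded V" "closure V \<subseteq> W" "D \<subseteq> V"
    and \<gamma>s: "positively_oriented_boundary V \<gamma>s"
  shows "(\<Sum>\<gamma>\<leftarrow>\<gamma>s. cauchy_op (\<lambda>s. - \<i> * h s) \<gamma>) = (2 * pi) *\<^sub>R \<Phi> h"
proof -
  have VW: "V \<subseteq> W" using V(3) closure_subset by blast
  define C where "C \<gamma> w = path_int (\<lambda>s. - \<i> * h s / (s - w)) \<gamma>" for \<gamma> w
  have path: "path \<gamma>" "rectifiable \<gamma>" "path_image \<gamma> \<subseteq> closure V - V" if "\<gamma> \<in> set \<gamma>s" for \<gamma>
    using \<gamma>s that V(1) by (auto simp: positively_oriented_boundary_def simple_path_def frontier_def interior_open)
  have hol: "(\<lambda>s. - \<i> * h s) holomorphic_on W" by (intro holomorphic_intros W)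
  have cC: "continuous_on D (C \<gamma>)" if \<gamma>: "\<gamma> \<in> set \<gamma>s" for \<gamma>
    unfolding C_def
  proof (rule cauchy_transform_continuous)
    show "continuous_on (path_image \<gamma>) (\<lambda>s. - \<i> * h s)"
      by (rule continuous_on_subset[OF holomorphic_on_imp_continuous_on[OF hol]]) (use path(3)[OF \<gamma>] V(3) in blast)
  qed (use path[OF \<gamma>] V in auto)
  have sumC: "(\<Sum>\<gamma>\<leftarrow>\<gamma>s. C \<gamma> w) = 2 * of_real pi * h w" if "w \<in> D" for w
  proof -
    have "(\<Sum>\<gamma>\<leftarrow>\<gamma>s. C \<gamma> w) = 2 * of_real pi * \<i> * (- \<i> * h w)"
      unfolding C_def by (rule cauchy_formula_cycle[OF W(1) hol V(1-3) \<gamma>s]) (use that V(4) in auto)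
    then show ?thesis by (simp add: algebra_simps)
  qed
  have ih: "intrinsic h"
    unfolding intrinsic_def
  proof (intro conjI ballI)
    show "continuous_on D h"
      using V(4) VW by (intro continuous_on_subset[OF holomorphic_on_imp_continuous_on[OF W(2)]]) auto
    show "h (cnj z) = cnj (h z)" if "z \<in> D" for z
      using that cnj_profile_spectrum[OF that] V(4) VW by (intro W(3)) auto
  qed
  have re: "(\<Sum>\<gamma>\<leftarrow>\<gamma>s. \<Phi> (symm_re (C \<gamma>))) = (2 * pi) *\<^sub>R \<Phi> h"
  proof -
    have s: "(\<Sum>\<gamma>\<leftarrow>\<gamma>s. symm_re (C \<gamma>) w) = ((\<Sum>\<gamma>\<leftarrow>\<gamma>s. C \<gamma> w) + cnj (\<Sum>\<gamma>\<leftarrow>\<gamma>s. C \<gamma> (cnj w))) / 2" for w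
      by (induction \<gamma>s) (auto simp: symm_re_def field_simps)
    have "(\<Sum>\<gamma>\<leftarrow>\<gamma>s. \<Phi> (symm_re (C \<gamma>))) = \<Phi> (\<lambda>w. \<Sum>\<gamma>\<leftarrow>\<gamma>s. symm_re (C \<gamma>) w)"
      using \<Phi>_sum_list[of \<gamma>s "\<lambda>\<gamma>. symm_re (C \<gamma>)"] intrinsic_symm(1) cC by simp
    also have "\<dots> = \<Phi> (\<lambda>w. of_real (2 * pi) * h w)"
    proof (rule \<Phi>_cong[symmetric])
      show "intrinsic (\<lambda>w. of_real (2 * pi) * h w)" by (rule intrinsic_intros(3)[OF ih])
      fix w assume w: "w \<in> D"
      then show "of_real (2 * pi) * h w = (\<Sum>\<gamma>\<leftarrow>\<gamma>s. symm_re (C \<gamma>) w)"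
        using ih unfolding s by (simp add: sumC cnj_profile_spectrum intrinsic_def)
    qed
    finally show ?thesis by (simp only: \<Phi>_scale[OF ih])
  qed
  have im: "(\<Sum>\<gamma>\<leftarrow>\<gamma>s. \<Phi> (symm_im (C \<gamma>))) = 0"
  proof -
    have s: "(\<Sum>\<gamma>\<leftarrow>\<gamma>s. symm_im (C \<gamma>) w) = ((\<Sum>\<gamma>\<leftarrow>\<gamma>s. C \<gamma> w) - cnj (\<Sum>\<gamma>\<leftarrow>\<gamma>s. C \<gamma> (cnj w))) / (2 * \<i>)" for w
      by (induction \<gamma>s) (auto simp: symm_im_def field_simps)
    have "(\<Sum>\<gamma>\<leftarrow>\<gamma>s. \<Phi> (symm_im (C \<gamma>))) = \<Phi> (\<lambda>w. \<Sum>\<gamma>\<leftarrow>\<gamma>s. symm_im (C \<gamma>) w)"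
      using \<Phi>_sum_list[of \<gamma>s "\<lambda>\<gamma>. symm_im (C \<gamma>)"] intrinsic_symm(2) cC by simp
    also have "\<dots> = \<Phi> (\<lambda>w. 0)"
    proof (rule \<Phi>_cong[symmetric, OF intrinsic_zero])
      fix w assume w: "w \<in> D"
      then show "0 = (\<Sum>\<gamma>\<leftarrow>\<gamma>s. symm_im (C \<gamma>) w)"
        using ih unfolding s by (simp add: sumC cnj_profile_spectrum intrinsic_def)
    qed
    finally show ?thesis by (simp only: \<Phi>_zero)
  qed
  have "(\<Sum>\<gamma>\<leftarrow>\<gamma>s. cauchy_op (\<lambda>s. - \<i> * h s) \<gamma>) =
      (\<Sum>\<gamma>\<leftarrow>\<gamma>s. \<Phi> (symm_re (C \<gamma>)) + (\<Phi> (symm_im (C \<gamma>)) o\<^sub>L L \<iota>))"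
    unfolding cauchy_op_def C_def[abs_def] by (rule refl)
  also have "\<dots> = (\<Sum>\<gamma>\<leftarrow>\<gamma>s. \<Phi> (symm_re (C \<gamma>))) + ((\<Sum>\<gamma>\<leftarrow>\<gamma>s. \<Phi> (symm_im (C \<gamma>))) o\<^sub>L L \<iota>)"
    by (induction \<gamma>s) (simp_all add: bounded_bilinear.add_left[OF bounded_bilinear_blinfun_compose] add_ac)
  also have "\<dots> = (2 * pi) *\<^sub>R \<Phi> h" unfolding re im by simp
  finally show ?thesis .
qed

end

context real_slice_calc
begin

lemma represents_stem: "g \<in> SR \<Longrightarrow> represents g (stem_at_i g)"
  using slice_cont_realD[of g "\<sigma>\<^sub>S T"] by (simp add: represents_def intrinsic_def)

text \<open>This makes the definite description in the continuous calculus meaningful: four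
  components are determined on the spectrum, and \<Psi> sees nothing else.\<close>

lemma split_unique:
  assumes jk: "\<jj> \<in> \<S>" "\<kappa> \<in> \<S>" "\<jj> * \<kappa> = - (\<kappa> * \<jj>)"
    and g: "g0 \<in> SR" "g1 \<in> SR" "g2 \<in> SR" "g3 \<in> SR"
    and h: "intrinsic h0" "intrinsic h1" "intrinsic h2" "intrinsic h3"
    and eq: "\<And>q. q \<in> \<sigma>\<^sub>S T \<Longrightarrow> g0 q + g1 q * \<jj> + g2 q * \<kappa> + g3 q * \<jj> * \<kappa> =
      lift h0 q + lift h1 q * \<jj> + lift h2 q * \<kappa> + lift h3 q * \<jj> * \<kappa>"
  shows "\<Psi> g0 = \<Phi> h0 \<and> \<Psi> g1 = \<Phi> h1 \<and> \<Psi> g2 = \<Phi> h2 \<and> \<Psi> g3 = \<Phi> h3"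
proof -
  note u = represents_stem[OF g(1)] represents_stem[OF g(2)] represents_stem[OF g(3)] represents_stem[OF g(4)]
  note l = represents_lift[OF h(1)] represents_lift[OF h(2)] represents_lift[OF h(3)] represents_lift[OF h(4)]
  have "stem_at_i g0 z = h0 z \<and> stem_at_i g1 z = h1 z \<and> stem_at_i g2 z = h2 z \<and> stem_at_i g3 z = h3 z"
    if z: "z \<in> D" for z
  proof -
    let ?i = "Quat 0 1 0 0"
    define d0 d1 d2 d3 where "d0 = stem_at_i g0 z - h0 z" and "d1 = stem_at_i g1 z - h1 z"
      and "d2 = stem_at_i g2 z - h2 z" and "d3 = stem_at_i g3 z - h3 z"
    define a where "a = of_real (Re d0) + of_real (Re d1) * \<jj> + of_real (Re d2) * \<kappa> + of_real (Re d3) * \<jj> * \<kappa>"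
    define b where "b = of_real (Im d0) + of_real (Im d1) * \<jj> + of_real (Im d2) * \<kappa> + of_real (Im d3) * \<jj> * \<kappa>"
    have ab: "a + \<iota> * b = 0" if \<iota>: "\<iota> \<in> \<S>" for \<iota>
    proof -
      have q: "slice \<iota> z \<in> \<sigma>\<^sub>S T" using z \<iota> by (simp add: profile_spectrum(2))
      have "slice \<iota> d0 + slice \<iota> d1 * \<jj> + slice \<iota> d2 * \<kappa> + slice \<iota> d3 * \<jj> * \<kappa> = 0"
        using eq[OF q] u l z \<iota> unfolding d0_def d1_def d2_def d3_def slice_diff[OF \<iota>]
        by (simp add: represents_def algebra_simps)
      then show ?thesis
        by (simp add: slice_def a_def b_def distrib_left distrib_right mult.assoc add_ac)
    qed
    \<comment> \<open>Two opposite units on the same sphere separate the two stem parts a and b of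
      the difference.\<close>
    have "a + ?i * b = 0" "a + - ?i * b = 0" using ab uminus_imag_unit quat_i_imag_unit by blast+
    then have ib: "a = - (?i * b)" "a = ?i * b" by (simp_all add: eq_neg_iff_add_eq_0)
    then have "a + a = 0" by (metis add.left_inverse)
    then have "(2::real) *\<^sub>R a = 0" by (simp add: scaleR_2)
    then have a0: "a = 0" by simp
    have "?i \<noteq> 0" by (simp add: zero_quat_def)
    with ib a0 have b0: "b = 0" by (metis mult_eq_0_iff)
    have "d0 = 0" "d1 = 0" "d2 = 0" "d3 = 0"
      using quat_basis_independent[OF jk a0[unfolded a_def]] quat_basis_independent[OF jk b0[unfolded b_def]]
      by (simp_all add: complex_eq_iff)
    then show ?thesis by (simp add: d0_def d1_def d2_def d3_def)
  qed
  then show ?thesis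
    using \<Psi>_eq[OF u(1)] \<Psi>_eq[OF u(2)] \<Psi>_eq[OF u(3)] \<Psi>_eq[OF u(4)]
      \<Phi>_cong[OF h(1), of "stem_at_i g0"] \<Phi>_cong[OF h(2), of "stem_at_i g1"]
      \<Phi>_cong[OF h(3), of "stem_at_i g2"] \<Phi>_cong[OF h(4), of "stem_at_i g3"] by simp
qed

end

theorem proposition7p14:
  fixes T A B J K :: "'h::quaternionic_hilbert \<Rightarrow>\<^sub>L 'h"
    and L :: "quat \<Rightarrow> 'h \<Rightarrow>\<^sub>L 'h"
    and \<jj> \<kappa> :: quat
    and U :: "quat set"
    and f :: "quat \<Rightarrow> quat"
  assumes T: "T \<in> \<BB>" "normal_op T"
    and U: "circular U" "open U" "\<sigma>\<^sub>S T \<subseteq> U"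
    and f: "slice_regular_on U f"
    and A: "A = (1/2) *\<^sub>R (T + adj T)"
    and B: "B = (1/2) *\<^sub>R abs_op (T - adj T)"
    and J: "J \<in> \<BB>" "anti_self_adjoint J" "unitary_op J"
      "T o\<^sub>L J = J o\<^sub>L T" "adj T o\<^sub>L J = J o\<^sub>L adj T" "T = A + (J o\<^sub>L B)"
    and jk: "\<jj> \<in> \<S>" "\<kappa> \<in> \<S>" "\<jj> * \<kappa> = - (\<kappa> * \<jj>)"
    and L: "left_scalar_mult L" "L \<jj> = J" "L \<kappa> = K"
      "\<And>q. L q o\<^sub>L A = A o\<^sub>L L q" "\<And>q. L q o\<^sub>L B = B o\<^sub>L L q"
  shows "f \<in> slice_cont (\<sigma>\<^sub>S T) \<and>
    (\<forall>\<iota> U' \<gamma>s. admissible_contour T U \<iota> U' \<gamma>s \<longrightarrow>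
       slice_regular_calculus L \<iota> \<gamma>s T f = cont_slice_calculus L \<jj> \<kappa> T f)"
proof (intro conjI allI impI)
  interpret N: normal_decomposition T A B J by (rule normal_decomposition_intro[OF T A J])
  define \<Psi> where "\<Psi> = real_slice_calculus T"
  interpret C: real_slice_calc T \<Psi>
    by unfold_locales (simp_all add: T \<Psi>_def N.real_slice_calculus)
  obtain F where F: "stem_on (profile U) F" "stem_holomorphic_on (profile U) F" "induces_on (profile U) F f"
    using f unfolding slice_regular_on_def by blast
  have DU: "C.D \<subseteq> profile U" unfolding profile_def using U(3) by blast
  show "f \<in> slice_cont (\<sigma>\<^sub>S T)"
  proof -
    have "continuous_on (profile U) F"
      using F(2) unfolding stem_holomorphic_on_def
      by (meson continuous_at_imp_continuous_on has_derivative_continuous)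
    then have "continuous_on C.D F" by (rule continuous_on_subset[OF _ DU])
    moreover have "stem_on C.D F" using F(1) DU cnj_profile_spectrum unfolding stem_on_def by blast
    moreover have "induces_on C.D F f" using F(3) DU unfolding induces_on_def by blast
    ultimately show ?thesis unfolding slice_cont_def by blast
  qed
  fix \<iota> U' \<gamma>s assume adm: "admissible_contour T U \<iota> U' \<gamma>s"
  define V where "V = {z. slice \<iota> z \<in> U'}"
  have \<iota>: "\<iota> \<in> \<S>" and U': "bounded U'" "open U'" "\<sigma>\<^sub>S T \<subseteq> U'" "closure U' \<subseteq> U"
    and \<gamma>s: "positively_oriented_boundary V \<gamma>s"
    using adm by (auto simp: admissible_contour_def V_def)
  interpret R: slice_resolvent T \<Psi> L \<iota> by unfold_locales (use L \<iota> in auto)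
  \<comment> \<open>For circular U the profile is the preimage under the single map
    \<open>slice \<iota>\<close>, hence open.\<close>
  have oU: "open (profile U)"
    unfolding circular_profile[OF U(1) \<iota>] using open_vimage[OF U(2) continuous_on_slice] by (simp add: vimage_def)
  have oV: "open V"
    unfolding V_def using open_vimage[OF U'(2) continuous_on_slice] by (simp add: vimage_def)
  have bV: "bounded V"
  proof -
    obtain M where M: "\<And>q. q \<in> U' \<Longrightarrow> norm q \<le> M" using U'(1) unfolding bounded_iff by blast
    show ?thesis
    proof (rule boundedI)
      fix z assume "z \<in> V"
      then show "norm z \<le> M" using M[of "slice \<iota> z"] by (simp add: V_def norm_slice[OF \<iota>])
    qed
  qed
  have cV: "closure V \<subseteq> profile U"
  proof -
    have "closed (slice \<iota> -` closure U')" by (rule closed_vimage[OF closed_closure continuous_on_slice])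
    moreover have "V \<subseteq> slice \<iota> -` closure U'" unfolding V_def using closure_subset by blast
    ultimately have "closure V \<subseteq> slice \<iota> -` closure U'" by (rule closure_minimal[rotated])
    then show ?thesis unfolding circular_profile[OF U(1) \<iota>] using U'(4) by blast
  qed
  have DV: "C.D \<subseteq> V"
    unfolding V_def using U'(3) profile_spectrum(2)[OF \<iota>] by blast
  define h where "h e = stem_coef e F" for e
  have hol: "h e holomorphic_on profile U" for e unfolding h_def by (rule stem_coef_holomorphic[OF F(2)])
  have hc: "h e (cnj z) = cnj (h e z)" if "z \<in> profile U" for e z
    unfolding h_def by (rule stem_coef_cnj[OF F(1) that])
  have ih: "C.intrinsic (h e)" for e
    unfolding C.intrinsic_def
    using continuous_on_subset[OF holomorphic_on_imp_continuous_on[OF hol] DU] hc DU by blast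
  have fh: "f (slice \<iota>' z) = slice \<iota>' (h (-1) z) + slice \<iota>' (h \<jj> z) * \<jj> + slice \<iota>' (h \<kappa> z) * \<kappa>
      + slice \<iota>' (h (\<jj> * \<kappa>) z) * \<jj> * \<kappa>" if "z \<in> profile U" "\<iota>' \<in> \<S>" for z \<iota>'
    unfolding h_def by (rule stem_coef_expansion[OF jk F(3) that])
  note LL = R.L_laws
  \<comment> \<open>The common value of both calculi: basis elements act through L on the right of
    the operators of the symmetric components of f.\<close>
  define X where "X = C.\<Phi> (h (-1)) + (C.\<Phi> (h \<jj>) o\<^sub>L L \<jj>) + (C.\<Phi> (h \<kappa>) o\<^sub>L L \<kappa>) + (C.\<Phi> (h (\<jj> * \<kappa>)) o\<^sub>L L \<jj> o\<^sub>L L \<kappa>)"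
  define Q where "Q e \<gamma> = R.cauchy_op (\<lambda>s. - \<i> * h e s) \<gamma>" for e \<gamma>
  have line: "line_integral (\<lambda>s ds. left_S_resolvent L T (slice \<iota> s) o\<^sub>L L (slice \<iota> ds) o\<^sub>L L (inverse \<iota>) o\<^sub>L
      L (f (slice \<iota> s))) \<gamma> = Q (-1) \<gamma> + (Q \<jj> \<gamma> o\<^sub>L L \<jj>) + (Q \<kappa> \<gamma> o\<^sub>L L \<kappa>) + (Q (\<jj> * \<kappa>) \<gamma> o\<^sub>L L (\<jj> * \<kappa>))"
    if \<gamma>: "\<gamma> \<in> set \<gamma>s" for \<gamma>
  proof (rule line_integral_eq)
    have p: "path \<gamma>" "rectifiable \<gamma>" "path_image \<gamma> \<subseteq> closure V - V"
      using \<gamma>s \<gamma> oV by (auto simp: positively_oriented_boundary_def simple_path_def frontier_def interior_open)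
    have i: "has_line_integral (\<lambda>s ds. R.resolvent_op s (- \<i> * h e s * ds)) \<gamma> (Q e \<gamma>)" for e
      unfolding Q_def
    proof (rule R.cauchy_op_integral[OF p(1,2) _ oV DV])
      show "continuous_on (path_image \<gamma>) (\<lambda>s. - \<i> * h e s)"
        by (intro continuous_intros continuous_on_subset[OF holomorphic_on_imp_continuous_on[OF hol]]) (use p(3) cV in blast)
    qed (use p(3) in blast)
    have ic: "has_line_integral (\<lambda>s ds. R.resolvent_op s (- \<i> * h e s * ds) o\<^sub>L L e') \<gamma> (Q e \<gamma> o\<^sub>L L e')" for e e'
      by (rule has_line_integral_bounded_linear[OF bounded_bilinear.bounded_linear_left[OF bounded_bilinear_blinfun_compose] i])
    have tot: "has_line_integral (\<lambda>s ds. R.resolvent_op s (- \<i> * h (-1) s * ds) + (R.resolvent_op s (- \<i> * h \<jj> s * ds) o\<^sub>L L \<jj>) +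
       (R.resolvent_op s (- \<i> * h \<kappa> s * ds) o\<^sub>L L \<kappa>) + (R.resolvent_op s (- \<i> * h (\<jj> * \<kappa>) s * ds) o\<^sub>L L (\<jj> * \<kappa>))) \<gamma>
       (Q (-1) \<gamma> + (Q \<jj> \<gamma> o\<^sub>L L \<jj>) + (Q \<kappa> \<gamma> o\<^sub>L L \<kappa>) + (Q (\<jj> * \<kappa>) \<gamma> o\<^sub>L L (\<jj> * \<kappa>)))"
      by (intro has_line_integral_add i ic)
    show "has_line_integral (\<lambda>s ds. left_S_resolvent L T (slice \<iota> s) o\<^sub>L L (slice \<iota> ds) o\<^sub>L L (inverse \<iota>) o\<^sub>L
      L (f (slice \<iota> s))) \<gamma> (Q (-1) \<gamma> + (Q \<jj> \<gamma> o\<^sub>L L \<jj>) + (Q \<kappa> \<gamma> o\<^sub>L L \<kappa>) + (Q (\<jj> * \<kappa>) \<gamma> o\<^sub>L L (\<jj> * \<kappa>)))"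
    proof (rule has_line_integral_cong[OF _ tot])
      fix s ds assume s: "s \<in> path_image \<gamma>"
      have sD: "s \<notin> C.D" "s \<in> profile U" using s p(3) DV cV by auto
      define S where "S = left_S_resolvent L T (slice \<iota> s)"
      have inv: "inverse \<iota> = slice \<iota> (- \<i>)" by (simp add: inverse_imag_unit[OF \<iota>] slice_def)
      have SL: "S o\<^sub>L L (slice \<iota> c) = R.resolvent_op s c" for c unfolding S_def by (rule R.resolvent_eq[OF sD(1)])
      have SLe: "S o\<^sub>L L (slice \<iota> c * e) = R.resolvent_op s c o\<^sub>L L e" for c e
        by (simp only: LL(1)[symmetric] SL[symmetric] blinfun_assoc)
      \<comment> \<open>The increment, the inverse of \<iota> and the component of f all lie in one
        slice, which is commutative; they merge into one complex factor to the left of the basis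
        element.\<close>
      have m: "slice \<iota> ds * slice \<iota> (- \<i>) * slice \<iota> c = slice \<iota> (- \<i> * c * ds)" for c
        by (simp add: \<iota> mult_ac flip: slice_mult[OF \<iota>])
      have "S o\<^sub>L L (slice \<iota> ds) o\<^sub>L L (inverse \<iota>) o\<^sub>L L (f (slice \<iota> s)) =
          S o\<^sub>L L (slice \<iota> ds * slice \<iota> (- \<i>) * f (slice \<iota> s))"
        by (simp only: blinfun_assoc LL(1) inv mult.assoc)
      also have "slice \<iota> ds * slice \<iota> (- \<i>) * f (slice \<iota> s) = slice \<iota> (- \<i> * h (-1) s * ds) + slice \<iota> (- \<i> * h \<jj> s * ds) * \<jj> +
          slice \<iota> (- \<i> * h \<kappa> s * ds) * \<kappa> + slice \<iota> (- \<i> * h (\<jj> * \<kappa>) s * ds) * (\<jj> * \<kappa>)"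
        unfolding fh[OF sD(2) \<iota>] m[symmetric] by (simp only: distrib_left mult.assoc)
      also have "S o\<^sub>L L \<dots> = R.resolvent_op s (- \<i> * h (-1) s * ds) + (R.resolvent_op s (- \<i> * h \<jj> s * ds) o\<^sub>L L \<jj>) +
       (R.resolvent_op s (- \<i> * h \<kappa> s * ds) o\<^sub>L L \<kappa>) + (R.resolvent_op s (- \<i> * h (\<jj> * \<kappa>) s * ds) o\<^sub>L L (\<jj> * \<kappa>))"
        by (simp only: LL(2) bounded_bilinear.add_right[OF bounded_bilinear_blinfun_compose] SL SLe)
      finally show "R.resolvent_op s (- \<i> * h (-1) s * ds) + (R.resolvent_op s (- \<i> * h \<jj> s * ds) o\<^sub>L L \<jj>) +
       (R.resolvent_op s (- \<i> * h \<kappa> s * ds) o\<^sub>L L \<kappa>) + (R.resolvent_op s (- \<i> * h (\<jj> * \<kappa>) s * ds) o\<^sub>L L (\<jj> * \<kappa>)) =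
       left_S_resolvent L T (slice \<iota> s) o\<^sub>L L (slice \<iota> ds) o\<^sub>L L (inverse \<iota>) o\<^sub>L L (f (slice \<iota> s))"
        unfolding S_def by (rule sym)
    qed
  qed
  have sumQ: "(\<Sum>\<gamma>\<leftarrow>\<gamma>s. Q e \<gamma>) = (2 * pi) *\<^sub>R C.\<Phi> (h e)" for e
    unfolding Q_def by (rule R.cauchy_op_cycle[OF oU hol hc oV bV cV DV \<gamma>s])
  have sumQc: "(\<Sum>\<gamma>\<leftarrow>\<gamma>s. Q e \<gamma> o\<^sub>L M) = (2 * pi) *\<^sub>R (C.\<Phi> (h e) o\<^sub>L M)" for e M
  proof -
    have "(\<Sum>\<gamma>\<leftarrow>\<gamma>s. Q e \<gamma> o\<^sub>L M) = (\<Sum>\<gamma>\<leftarrow>\<gamma>s. Q e \<gamma>) o\<^sub>L M"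
      by (induction \<gamma>s) (simp_all add: bounded_bilinear.add_left[OF bounded_bilinear_blinfun_compose])
    then show ?thesis by (simp add: sumQ bounded_bilinear.scaleR_left[OF bounded_bilinear_blinfun_compose])
  qed
  have reg: "slice_regular_calculus L \<iota> \<gamma>s T f = X"
  proof -
    have "(\<Sum>\<gamma>\<leftarrow>\<gamma>s. line_integral (\<lambda>s ds. left_S_resolvent L T (slice \<iota> s) o\<^sub>L L (slice \<iota> ds) o\<^sub>L L (inverse \<iota>) o\<^sub>L
      L (f (slice \<iota> s))) \<gamma>) = (\<Sum>\<gamma>\<leftarrow>\<gamma>s. Q (-1) \<gamma> + (Q \<jj> \<gamma> o\<^sub>L L \<jj>) + (Q \<kappa> \<gamma> o\<^sub>L L \<kappa>) + (Q (\<jj> * \<kappa>) \<gamma> o\<^sub>L L (\<jj> * \<kappa>)))"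
      by (intro arg_cong[where f = sum_list] map_cong refl line)
    also have "\<dots> = (2 * pi) *\<^sub>R X"
      unfolding sum_list_addf sumQ sumQc X_def LL(1)[symmetric] blinfun_assoc scaleR_add_right ..
    finally show ?thesis unfolding slice_regular_calculus_def by simp
  qed
  have cont: "cont_slice_calculus L \<jj> \<kappa> T f = X"
    unfolding cont_slice_calculus_def
  proof (rule the_equality)
    have fl: "f q = lift (h (-1)) q + lift (h \<jj>) q * \<jj> + lift (h \<kappa>) q * \<kappa> + lift (h (\<jj> * \<kappa>)) q * \<jj> * \<kappa>" if "q \<in> \<sigma>\<^sub>S T" for q
    proof -
      obtain \<iota>' z where z: "\<iota>' \<in> \<S>" "z \<in> C.D" "q = slice \<iota>' z" using spectrum_slice \<open>q \<in> \<sigma>\<^sub>S T\<close> by blast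
      then have "lift (h e) q = slice \<iota>' (h e z)" for e
        using C.represents_lift[OF ih[of e]] by (simp add: C.represents_def)
      then show ?thesis using z fh[of z \<iota>'] DU by auto
    qed
    \<comment> \<open>The lifted components are the witnesses for existence;
      \<open>split_unique\<close> settles uniqueness below.\<close>
    have lSR: "lift (h e) \<in> C.SR" for e by (rule C.represents_SR[OF C.represents_lift[OF ih]])
    show "\<exists>g0\<in>C.SR. \<exists>g1\<in>C.SR. \<exists>g2\<in>C.SR. \<exists>g3\<in>C.SR.
        (\<forall>q\<in>\<sigma>\<^sub>S T. f q = g0 q + g1 q * \<jj> + g2 q * \<kappa> + g3 q * \<jj> * \<kappa>) \<and>
        X = real_slice_calculus T g0 + (real_slice_calculus T g1 o\<^sub>L L \<jj>) +
            (real_slice_calculus T g2 o\<^sub>L L \<kappa>) + (real_slice_calculus T g3 o\<^sub>L L \<jj> o\<^sub>L L \<kappa>)"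
    proof (rule bexI[OF _ lSR[of "-1"]], rule bexI[OF _ lSR[of \<jj>]], rule bexI[OF _ lSR[of \<kappa>]],
        rule bexI[OF _ lSR[of "\<jj> * \<kappa>"]], rule conjI, rule ballI, erule fl)
    qed (unfold X_def C.\<Phi>_def, unfold \<Psi>_def, rule refl)
    fix Y assume "\<exists>g0\<in>C.SR. \<exists>g1\<in>C.SR. \<exists>g2\<in>C.SR. \<exists>g3\<in>C.SR.
        (\<forall>q\<in>\<sigma>\<^sub>S T. f q = g0 q + g1 q * \<jj> + g2 q * \<kappa> + g3 q * \<jj> * \<kappa>) \<and>
        Y = real_slice_calculus T g0 + (real_slice_calculus T g1 o\<^sub>L L \<jj>) +
            (real_slice_calculus T g2 o\<^sub>L L \<kappa>) + (real_slice_calculus T g3 o\<^sub>L L \<jj> o\<^sub>L L \<kappa>)"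
    then obtain g0 g1 g2 g3 where g: "g0 \<in> C.SR" "g1 \<in> C.SR" "g2 \<in> C.SR" "g3 \<in> C.SR"
      and fg: "\<And>q. q \<in> \<sigma>\<^sub>S T \<Longrightarrow> f q = g0 q + g1 q * \<jj> + g2 q * \<kappa> + g3 q * \<jj> * \<kappa>"
      and Y: "Y = \<Psi> g0 + (\<Psi> g1 o\<^sub>L L \<jj>) + (\<Psi> g2 o\<^sub>L L \<kappa>) + (\<Psi> g3 o\<^sub>L L \<jj> o\<^sub>L L \<kappa>)"
      unfolding \<Psi>_def by blast
    have "\<Psi> g0 = C.\<Phi> (h (-1)) \<and> \<Psi> g1 = C.\<Phi> (h \<jj>) \<and> \<Psi> g2 = C.\<Phi> (h \<kappa>) \<and> \<Psi> g3 = C.\<Phi> (h (\<jj> * \<kappa>))"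
      by (rule C.split_unique[OF jk g ih ih ih ih]) (simp flip: fg fl)
    then show "Y = X" unfolding Y X_def by simp
  qed
  show "slice_regular_calculus L \<iota> \<gamma>s T f = cont_slice_calculus L \<jj> \<kappa> T f"
    unfolding reg cont ..
qed

end
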